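(* Let $A, B$ be positive operators in $\mathscr{R}$. Then $$\Delta(A+B) \ge \Delta(A) + \Delta(B).$$ Moreover, if $B$ is invertible, then equality $\Delta(A+B) = \Delta(A)+\Delta(B)$ holds if and only if $A$ is a nonnegative scalar multiple of $B$.
   Context: $\mathscr{R}$ is a finite von Neumann algebra acting on a complex (separable) Hilbert space $\mathscr{H}$ and containing the identity operator $I$. $\tau$ is a fixed faithful tracial state on $\mathscr{R}$: a linear functional $\tau:\mathscr{R}\to\mathbb{C}$ such that $\tau(AB)=\tau(BA)$ for all $A,B \in \mathscr{R}$, $\tau(A^*A)\ge 0$ with equality if and only if $A=0$, and $\tau(I)=1$. "Positive operator" means positive semidefinite, i.e. not necessarily invertible. $\Delta$ is the Fuglede-Kadison determinant associated with $\tau$. For invertible $A\in\mathscr{R}$, $\Delta(A)=\exp(\tau(\log\sqrt{A^*A}))$. It is extended to all of $\mathscr{R}$ by the analytic extension: for $A\in\mathscr{R}$, let $|A| = \sqrt{A^*A}$, let $\sigma(|A|)\subset[0,\infty)$ be its spectrum, and let $\mu$ be the probability measure on $\sigma(|A|)$ induced by $\tau$ (i.e. $\mu(S)=\tau(\mathbf{1}_S(|A|))$ for Borel $S$); then $\Delta(A)=\exp\left(\int_{\sigma(|A|)}\log\lambda\,d\mu(\lambda)\right)$, with $\Delta(A)=0$ whenever the integral equals $-\infty$. *)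

theory Defs
  imports "HOL-Probability.Probability"
begin

section \<open>Complex Hilbert spaces and bounded operators\<close>

text \<open>The inner product is linear in its first argument. Definiteness and completeness come from
  \<open>banach\<close> through the last axiom.\<close>

class chilbert_space = banach +
  fixes scaleC :: "complex \<Rightarrow> 'a \<Rightarrow> 'a"  (infixr "*\<^sub>C" 75)
    and cinner :: "'a \<Rightarrow> 'a \<Rightarrow> complex"
  assumes scaleC_add_right: "c *\<^sub>C (x + y) = c *\<^sub>C x + c *\<^sub>C y"
    and scaleC_add_left: "(c + d) *\<^sub>C x = c *\<^sub>C x + d *\<^sub>C x"
    and scaleC_scaleC: "c *\<^sub>C d *\<^sub>C x = (c * d) *\<^sub>C x"
    and scaleC_of_real: "complex_of_real r *\<^sub>C x = r *\<^sub>R x"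
    and cinner_add_left: "cinner (x + y) z = cinner x z + cinner y z"
    and cinner_scaleC_left: "cinner (c *\<^sub>C x) y = c * cinner x y"
    and cinner_commute: "cinner x y = cnj (cinner y x)"
    and cinner_self: "cinner x x = complex_of_real ((norm x)\<^sup>2)"

text \<open>\<open>blinfun\<close> only knows real linearity, so complex linearity is a predicate.\<close>

type_synonym 'h op = "'h \<Rightarrow>\<^sub>L 'h"

definition bounded_op :: "'h::chilbert_space op \<Rightarrow> bool" where
  "bounded_op A \<longleftrightarrow> (\<forall>c x. A (c *\<^sub>C x) = c *\<^sub>C A x)"

lemma norm_scaleC: "norm (c *\<^sub>C x) = cmod c * norm (x::'h::chilbert_space)"
proof -
  have "complex_of_real ((norm (c *\<^sub>C x))\<^sup>2) = c * cnj (c * cinner x x)"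
    by (metis cinner_self cinner_scaleC_left cinner_commute)
  also have "\<dots> = complex_of_real ((cmod c)\<^sup>2) * complex_of_real ((norm x)\<^sup>2)"
    by (simp add: cinner_self complex_norm_square [symmetric] mult.assoc [symmetric]
        del: of_real_power)
  also have "\<dots> = complex_of_real ((cmod c * norm x)\<^sup>2)"
    by (simp add: power_mult_distrib)
  finally have "(norm (c *\<^sub>C x))\<^sup>2 = (cmod c * norm x)\<^sup>2"
    using of_real_eq_iff by blast
  then show ?thesis
    by (simp add: power2_eq_iff_nonneg)
qed

lift_definition scaleC_op :: "complex \<Rightarrow> 'h::chilbert_space op \<Rightarrow> 'h op"
  is "\<lambda>c A x. c *\<^sub>C A x"
proof -
  fix c :: complex and A :: "'h \<Rightarrow> 'h"
  assume "bounded_linear A"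
  moreover have "bounded_linear (\<lambda>x::'h. c *\<^sub>C x)"
  proof (rule bounded_linear_intro [where K = "cmod c"])
    show "c *\<^sub>C (r *\<^sub>R x) = r *\<^sub>R c *\<^sub>C x" for r and x :: 'h
      by (metis scaleC_of_real scaleC_scaleC mult.commute)
  qed (simp_all add: scaleC_add_right norm_scaleC mult.commute)
  ultimately show "bounded_linear (\<lambda>x. c *\<^sub>C A x)"
    using bounded_linear_compose by blast
qed

definition adj :: "'h::chilbert_space op \<Rightarrow> 'h op" where
  "adj A = (THE B :: 'h op. \<forall>x y. cinner (A x) y = cinner x (B y))"

definition positive_op :: "'h::chilbert_space op \<Rightarrow> bool" where
  "positive_op A \<longleftrightarrow> bounded_op A \<and> (\<forall>x. cinner (A x) x \<in> \<real>\<^sub>\<ge>\<^sub>0)"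

definition invertible_op :: "'h::chilbert_space op \<Rightarrow> bool" where
  "invertible_op A \<longleftrightarrow>
     (\<exists>B. bounded_op B \<and> A o\<^sub>L B = id_blinfun \<and> B o\<^sub>L A = id_blinfun)"

definition spectrum :: "'h::chilbert_space op \<Rightarrow> complex set" where
  "spectrum A = {z. \<not> invertible_op (A - scaleC_op z id_blinfun)}"

definition abs_op :: "'h::chilbert_space op \<Rightarrow> 'h op" where
  "abs_op A = (THE P. positive_op P \<and> P o\<^sub>L P = adj A o\<^sub>L A)"


section \<open>Finite von Neumann algebras and traces\<close>

definition commutant :: "'h::chilbert_space op set \<Rightarrow> 'h op set" where
  "commutant S = {T. bounded_op T \<and> (\<forall>A\<in>S. T o\<^sub>L A = A o\<^sub>L T)}"

text \<open>Being a double commutant makes \<open>R\<close> a weakly closed algebra containing the identity.\<close>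

definition von_neumann_algebra :: "'h::chilbert_space op set \<Rightarrow> bool" where
  "von_neumann_algebra R \<longleftrightarrow>
     (\<forall>A\<in>R. bounded_op A \<and> adj A \<in> R) \<and> commutant (commutant R) = R"

text \<open>Finiteness: the identity is not equivalent to a proper subprojection, i.e. every isometry in
  \<open>R\<close> is unitary.\<close>

definition finite_von_neumann_algebra :: "'h::chilbert_space op set \<Rightarrow> bool" where
  "finite_von_neumann_algebra R \<longleftrightarrow> von_neumann_algebra R \<and>
     (\<forall>V\<in>R. adj V o\<^sub>L V = id_blinfun \<longrightarrow> V o\<^sub>L adj V = id_blinfun)"

definition faithful_tracial_state :: "'h::chilbert_space op set \<Rightarrow> ('h op \<Rightarrow> complex) \<Rightarrow> bool" where
  "faithful_tracial_state R \<tau> \<longleftrightarrow>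
     (\<forall>A\<in>R. \<forall>B\<in>R. \<tau> (A + B) = \<tau> A + \<tau> B) \<and>
     (\<forall>A\<in>R. \<forall>c. \<tau> (scaleC_op c A) = c * \<tau> A) \<and>
     (\<forall>A\<in>R. \<forall>B\<in>R. \<tau> (A o\<^sub>L B) = \<tau> (B o\<^sub>L A)) \<and>
     (\<forall>A\<in>R. \<tau> (adj A o\<^sub>L A) \<in> \<real>\<^sub>\<ge>\<^sub>0 \<and> (\<tau> (adj A o\<^sub>L A) = 0 \<longleftrightarrow> A = 0)) \<and>
     \<tau> id_blinfun = 1"


section \<open>Spectral projections\<close>

text \<open>Values off the Borel sets are fixed to \<open>0\<close> so that the spectral measure of an operator is
  unique.\<close>

definition projection_valued_measure :: "(real set \<Rightarrow> 'h::chilbert_space op) \<Rightarrow> bool" where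
  "projection_valued_measure E \<longleftrightarrow>
     (\<forall>S. S \<notin> sets borel \<longrightarrow> E S = 0) \<and>
     (\<forall>S\<in>sets borel. bounded_op (E S) \<and> adj (E S) = E S \<and> E S o\<^sub>L E S = E S) \<and>
     E UNIV = id_blinfun \<and>
     (\<forall>S\<in>sets borel. \<forall>S'\<in>sets borel. E (S \<inter> S') = E S o\<^sub>L E S') \<and>
     (\<forall>F :: nat \<Rightarrow> real set. range F \<subseteq> sets borel \<longrightarrow> disjoint_family F \<longrightarrow>
        (\<forall>x. (\<lambda>n. E (F n) x) sums E (\<Union>n. F n) x))"

definition scalar_measure :: "(real set \<Rightarrow> 'h::chilbert_space op) \<Rightarrow> 'h \<Rightarrow> real measure" where
  "scalar_measure E x = measure_of UNIV (sets borel) (\<lambda>S. ennreal ((norm (E S x))\<^sup>2))"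

definition real_spectrum :: "'h::chilbert_space op \<Rightarrow> real set" where
  "real_spectrum T = {t. complex_of_real t \<in> spectrum T}"

text \<open>For self-adjoint \<open>T\<close>, \<open>spectral_projection T S\<close> is the operator \<open>1\<^sub>S(T)\<close>: the projection-valued
  measure carried by the spectrum of \<open>T\<close> with \<open>T = \<integral> t dE(t)\<close> in the weak sense
  \<open>\<langle>T x, x\<rangle> = \<integral> t d\<langle>E(t) x, x\<rangle>\<close>, where \<open>\<langle>E(S) x, x\<rangle> = \<parallel>E(S) x\<parallel>\<^sup>2\<close>.\<close>

definition spectral_projection :: "'h::chilbert_space op \<Rightarrow> real set \<Rightarrow> 'h op" where
  "spectral_projection T = (THE E. projection_valued_measure E \<and>
     E (real_spectrum T) = id_blinfun \<and>
     (\<forall>x. cinner (T x) x = complex_of_real (LINT t|scalar_measure E x. t)))"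


section \<open>The measure induced by a trace\<close>

text \<open>The probability measure \<open>\<mu>\<close> with \<open>\<mu>(S) = \<tau>(1\<^sub>S(T))\<close>. When \<open>\<tau>\<close> is normal, \<open>S \<mapsto> \<tau>(1\<^sub>S(T))\<close> is
  countably additive and the equation holds for every Borel set \<open>S\<close>; \<open>induced_measure_eqI\<close> shows
  that the definition then gives exactly this measure. Normality is not part of being a
  faithful tracial state, and without it \<open>S \<mapsto> \<tau>(1\<^sub>S(T))\<close> may be only finitely additive; so the
  equation is demanded only for continuity sets of \<open>\<mu>\<close>. In general \<open>\<mu>\<close> is the Riesz measure,
  \<open>\<integral> f d\<mu> = \<tau>(f(T))\<close> for continuous \<open>f\<close>.\<close>

definition induced_measure :: "('h::chilbert_space op \<Rightarrow> complex) \<Rightarrow> 'h op \<Rightarrow> real measure" where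
  "induced_measure \<tau> T = (THE M. real_distribution M \<and>
     (\<forall>S\<in>sets borel. measure M (frontier S) = 0 \<longrightarrow>
        complex_of_real (measure M S) = \<tau> (spectral_projection T S)))"

lemma real_distribution_eqI_cocountable:
  assumes M: "real_distribution M" and N: "real_distribution N"
    and eq: "\<And>x. measure M {x} = 0 \<Longrightarrow> measure N {x} = 0 \<Longrightarrow> cdf M x = cdf N x"
  shows "M = N"
proof (rule cdf_unique [OF M N], rule ext)
  fix a :: real
  interpret M: real_distribution M by fact
  interpret N: real_distribution N by fact
  let ?C = "{x. measure M {x} > 0} \<union> {x. measure N {x} > 0}"
  have C: "countable ?C"
    using M.countable_atoms N.countable_atoms by blast
  have "\<exists>x\<in>{a<..<a + 1 / Suc n}. x \<notin> ?C" for n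
    using uncountable_open_interval [of a "a + 1 / Suc n"] countable_subset [OF _ C] by fastforce
  then obtain u where u: "\<And>n. u n \<in> {a<..<a + 1 / Suc n}" "\<And>n. u n \<notin> ?C"
    by metis
  have "u \<longlonglongrightarrow> a"
  proof (rule tendsto_sandwich [of "\<lambda>_. a" _ _ "\<lambda>n. a + 1 / Suc n"])
    show "(\<lambda>n. a + 1 / Suc n) \<longlonglongrightarrow> a"
      using tendsto_add [OF tendsto_const LIMSEQ_inverse_real_of_nat, of a]
      by (simp add: inverse_eq_divide)
  qed (use u(1) in \<open>auto intro!: always_eventually less_imp_le simp: less_eq_real_def\<close>)
  then have lim: "filterlim u (at_right a) sequentially"
    using u(1) by (auto simp: filterlim_at intro!: always_eventually)
  have "(\<lambda>n. cdf M (u n)) \<longlonglongrightarrow> cdf M a" "(\<lambda>n. cdf N (u n)) \<longlonglongrightarrow> cdf N a"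
    using M.cdf_is_right_cont [of a] N.cdf_is_right_cont [of a] lim
    by (auto simp: continuous_within intro: filterlim_compose)
  moreover have "cdf M (u n) = cdf N (u n)" for n
    using u(2) [of n] by (intro eq) (auto simp: less_le)
  ultimately show "cdf M a = cdf N a"
    using LIMSEQ_unique by simp
qed

lemma induced_measure_eqI:
  assumes N: "real_distribution N"
    and eq: "\<And>S. S \<in> sets borel \<Longrightarrow> complex_of_real (measure N S) = \<tau> (spectral_projection T S)"
  shows "induced_measure \<tau> T = N"
  unfolding induced_measure_def
proof (rule the_equality)
  show "real_distribution N \<and> (\<forall>S\<in>sets borel. measure N (frontier S) = 0 \<longrightarrow>
      complex_of_real (measure N S) = \<tau> (spectral_projection T S))"
    using assms by simp
next
  fix M
  assume *: "real_distribution M \<and> (\<forall>S\<in>sets borel. measure M (frontier S) = 0 \<longrightarrow>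
      complex_of_real (measure M S) = \<tau> (spectral_projection T S))"
  show "M = N"
  proof (rule real_distribution_eqI_cocountable)
    fix x assume "measure M {x} = 0"
    then have "complex_of_real (measure M {..x}) = complex_of_real (measure N {..x})"
      using * eq [of "{..x}"] by simp
    then show "cdf M x = cdf N x"
      by (simp add: cdf_def)
  qed (use * N in auto)
qed


section \<open>The Fuglede-Kadison determinant\<close>

text \<open>\<open>ln 0 = 0\<close> in the library, whereas here \<open>log 0 = -\<infinity>\<close>.\<close>

definition elog :: "real \<Rightarrow> ereal" where
  "elog t = (if t > 0 then ereal (ln t) else -\<infinity>)"

text \<open>\<open>\<integral>\<^sub>K log d\<mu>\<close> with values in \<open>[-\<infinity>, \<infinity>)\<close> for bounded \<open>K\<close>, as the integral of the positive
  part minus that of the negative part (\<open>e2ennreal\<close> sends negative numbers to \<open>0\<close>).\<close>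

definition log_integral :: "real measure \<Rightarrow> real set \<Rightarrow> ereal" where
  "log_integral M K =
     enn2ereal (\<integral>\<^sup>+ t\<in>K. e2ennreal (elog t) \<partial>M) - enn2ereal (\<integral>\<^sup>+ t\<in>K. e2ennreal (- elog t) \<partial>M)"

definition fk_det :: "('h::chilbert_space op \<Rightarrow> complex) \<Rightarrow> 'h op \<Rightarrow> real" where
  "fk_det \<tau> A =
     (let L = log_integral (induced_measure \<tau> (abs_op A)) (real_spectrum (abs_op A))
      in if L = -\<infinity> then 0 else exp (real_of_ereal L))"

end

(*
  For invertible B write S for its square root and A = S C S with C positive.  Then
  \<Delta>(A + B) = \<Delta>(B) \<Delta>(C + 1) and \<Delta>(A) = \<Delta>(B) \<Delta>(C), so that the inequality becomes
  \<Delta>(C + 1) \<ge> \<Delta>(C) + 1.  This is Jensen's inequality for the strictly convex function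
  x \<mapsto> ln (1 + exp x) and the distribution of C under the trace, and equality forces that
  distribution to be a point mass, i.e. C to be a scalar.  The case of a general B follows by
  replacing B by B + \<epsilon> and letting \<epsilon> tend to 0.

  The determinant is multiplicative in this sense because d/dt \<tau>(log (X + t Y)) =
  \<tau>((X + t Y)^-1 Y), which by the trace property gives the same value for the paths
  1 + t (C - 1) and S (1 + t (C - 1)) S.

  The Borel functional calculus of a positive T rests on the Hausdorff moment problem: T^k (r - T)^m
  is positive for elementary reasons when 0 \<le> T \<le> r, so each vector (and likewise the trace)
  defines a measure on [0, r] with the moments of T.
*)

theory Submission
  imports Defs
begin

text \<open>Four notions of the statement, \<open>adj\<close>, \<open>abs_op\<close>,
  \<open>spectral_projection\<close> and \<open>induced_measure\<close>, are definite descriptions,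
  so each needs existence and uniqueness before anything can be computed with it. The trace is not
  assumed normal: norm continuity is all that is available, so it passes to uniform limits of
  polynomials but not to the weak limits that build Borel functions of T. Its distribution therefore
  comes from a moment problem of its own and is compared with the spectral projections only
  afterwards, on continuity sets. No operator logarithm is formed: the trace of log X is a series in
  the traces of powers of 1 - X/r, and cyclicity makes its termwise derivative collapse. That series
  needs X bounded below, and A may fail this even when B is invertible. The factorisation is
  therefore proved for A + d B, and as d tends to 0 monotonicity in the operator order identifies
  the limit as the determinant of A.\<close>

section \<open>Geometry of the inner product and the Riesz representation\<close>

lemma scaleC_1 [simp]: "1 *\<^sub>C x = (x::'h::chilbert_space)"
  using scaleC_of_real [of 1 x] by simp

lemma cinner_add_right: "cinner x (y + z) = cinner x y + cinner x (z::'h::chilbert_space)"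
  by (metis cinner_add_left cinner_commute complex_cnj_add)

lemma cinner_scaleC_right: "cinner x (c *\<^sub>C y) = cnj c * cinner x (y::'h::chilbert_space)"
  by (metis cinner_scaleC_left cinner_commute complex_cnj_mult)

lemma cinner_scaleR_left: "cinner (r *\<^sub>R x) y = r *\<^sub>R cinner x (y::'h::chilbert_space)"
  by (metis cinner_scaleC_left scaleC_of_real scaleR_conv_of_real)

lemma cinner_scaleR_right: "cinner x (r *\<^sub>R y) = r *\<^sub>R cinner x (y::'h::chilbert_space)"
  by (metis cinner_scaleC_right scaleC_of_real scaleR_conv_of_real complex_cnj_complex_of_real)

lemma cinner_Cauchy_Schwarz: "cmod (cinner x y) \<le> norm x * norm (y::'h::chilbert_space)"
proof (cases "y = 0")
  case True
  then show ?thesis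
    using cinner_scaleR_right [of x 0 y] by simp
next
  case False
  define c where "c = cinner x y / complex_of_real ((norm y)\<^sup>2)"
  \<comment> \<open>The component of \<open>x\<close> orthogonal to \<open>y\<close>; that its norm
    is nonnegative is the inequality.\<close>
  define z where "z = x + (- c) *\<^sub>C y"
  have cy: "c * complex_of_real ((norm y)\<^sup>2) = cinner x y"
    using False by (simp add: c_def)
  have "complex_of_real ((norm z)\<^sup>2) = cinner x x - cnj c * cinner x y
      - c * cinner y x + cnj c * (c * cinner y y)"
    unfolding cinner_self [symmetric] z_def
    by (simp add: cinner_add_left cinner_add_right cinner_scaleC_left cinner_scaleC_right
        algebra_simps)
  also have "cnj c * (c * cinner y y) = cnj c * cinner x y"
    by (simp add: cinner_self cy del: of_real_power)
  also have "c * cinner y x = cinner x y * cnj (cinner x y) / complex_of_real ((norm y)\<^sup>2)"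
    using cinner_commute [of y x] by (simp add: c_def)
  also have "\<dots> = complex_of_real ((cmod (cinner x y))\<^sup>2 / (norm y)\<^sup>2)"
    by (metis complex_norm_square of_real_divide of_real_power)
  finally have "complex_of_real ((norm z)\<^sup>2)
      = complex_of_real ((norm x)\<^sup>2 - (cmod (cinner x y))\<^sup>2 / (norm y)\<^sup>2)"
    by (simp add: cinner_self)
  then have "(norm z)\<^sup>2 = (norm x)\<^sup>2 - (cmod (cinner x y))\<^sup>2 / (norm y)\<^sup>2"
    using of_real_eq_iff by blast
  then have "(cmod (cinner x y))\<^sup>2 / (norm y)\<^sup>2 \<le> (norm x)\<^sup>2"
    using zero_le_power2 [of "norm z"] by linarith
  then have "(cmod (cinner x y))\<^sup>2 \<le> (norm x * norm y)\<^sup>2"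
    using False by (simp add: field_simps)
  then show ?thesis
    by (simp add: power2_le_iff_abs_le)
qed

interpretation cinner: bounded_bilinear "cinner :: 'h::chilbert_space \<Rightarrow> 'h \<Rightarrow> complex"
  by standard (use cinner_Cauchy_Schwarz in \<open>auto simp: cinner_add_left cinner_add_right
    cinner_scaleR_left cinner_scaleR_right intro!: exI [of _ 1]\<close>)

interpretation scaleC: bounded_bilinear "scaleC :: complex \<Rightarrow> 'h::chilbert_space \<Rightarrow> 'h"
proof
  show "(r *\<^sub>R c) *\<^sub>C x = r *\<^sub>R (c *\<^sub>C x)" for r c and x :: 'h
    by (metis scaleC_of_real scaleC_scaleC scaleR_conv_of_real)
  show "c *\<^sub>C (r *\<^sub>R x) = r *\<^sub>R (c *\<^sub>C x)" for r c and x :: 'h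
    by (metis scaleC_of_real scaleC_scaleC mult.commute)
  show "\<exists>K. \<forall>c (x::'h). norm (c *\<^sub>C x) \<le> norm c * norm x * K"
    by (rule exI [of _ 1]) (simp add: norm_scaleC)
qed (simp_all add: scaleC_add_left scaleC_add_right)

lemma Re_cinner_self: "Re (cinner x x) = (norm (x::'h::chilbert_space))\<^sup>2"
  by (simp add: cinner_self del: of_real_power)

lemma Re_cinner_commute: "Re (cinner x y) = Re (cinner y (x::'h::chilbert_space))"
  by (subst cinner_commute) simp

lemma norm_add_square: "(norm (x + y))\<^sup>2 = (norm x)\<^sup>2 + 2 * Re (cinner x y) + (norm (y::'h::chilbert_space))\<^sup>2"
  unfolding Re_cinner_self [symmetric]
  by (simp add: cinner.add_left cinner.add_right Re_cinner_commute [of y x])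

lemma norm_diff_square: "(norm (x - y))\<^sup>2 = (norm x)\<^sup>2 - 2 * Re (cinner x y) + (norm (y::'h::chilbert_space))\<^sup>2"
  unfolding Re_cinner_self [symmetric]
  by (simp add: cinner.diff_left cinner.diff_right Re_cinner_commute [of y x])

lemma cinner_ext: "(\<And>y. cinner x y = cinner x' y) \<Longrightarrow> x = (x'::'h::chilbert_space)"
proof -
  assume "\<And>y. cinner x y = cinner x' y"
  then have "cinner (x - x') (x - x') = 0"
    by (simp add: cinner.diff_left)
  then show ?thesis by (simp add: cinner_self)
qed

text \<open>Real parts suffice, so vectors produced by the real functionals of
  \<open>Riesz_real\<close> can be compared directly.\<close>

lemma Re_cinner_ext: "(\<And>y. Re (cinner x y) = Re (cinner x' y)) \<Longrightarrow> x = (x'::'h::chilbert_space)"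
proof -
  assume "\<And>y. Re (cinner x y) = Re (cinner x' y)"
  then have "Re (cinner (x - x') (x - x')) = 0"
    by (simp add: cinner.diff_left)
  then show ?thesis by (simp add: Re_cinner_self)
qed

text \<open>The representing vector minimises \<open>\<parallel>x\<parallel>\<^sup>2 - 2 f(x)\<close>.\<close>

lemma Riesz_real:
  fixes f :: "'h::chilbert_space \<Rightarrow> real"
  assumes f: "bounded_linear f"
  obtains z where "\<And>x. f x = Re (cinner x z)"
proof -
  interpret f: bounded_linear f by fact
  define J where "J x = (norm x)\<^sup>2 - 2 * f x" for x
  obtain K where K: "\<And>x. norm (f x) \<le> norm x * K" "0 \<le> K"
    using f.nonneg_bounded by auto
  have below: "- K\<^sup>2 \<le> J x" for x
  proof -
    have "f x \<le> norm x * K" using K(1) [of x] by simp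
    moreover have "0 \<le> (norm x - K)\<^sup>2" by simp
    ultimately show ?thesis by (simp add: J_def power2_eq_square algebra_simps)
  qed
  define m where "m = (INF x. J x)"
  have bdd: "bdd_below (range J)" using below by (intro bdd_belowI [of _ "- K\<^sup>2"]) auto
  have m_le: "m \<le> J x" for x unfolding m_def using bdd by (rule cINF_lower) simp
  have "\<exists>x. J x < m + 1 / Suc n" for n
    using cINF_less_iff [of UNIV J "m + 1 / Suc n"] bdd by (simp add: m_def)
  then obtain u where u: "\<And>n. J (u n) < m + 1 / Suc n" by metis
  \<comment> \<open>Parallelogram law: \<open>J\<close> is at least \<open>m\<close> at the midpoint
    of \<open>x\<close> and \<open>y\<close>, so two near-minimisers are close to each
    other.\<close>
  have mid: "(norm (x - y))\<^sup>2 \<le> 2 * (J x - m) + 2 * (J y - m)" for x y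
  proof -
    have "norm ((1/2) *\<^sub>R (x + y)) = norm (x + y) / 2"
      by (subst norm_scaleR) simp
    then have n: "(norm ((1/2) *\<^sub>R (x + y)))\<^sup>2 = (norm (x + y))\<^sup>2 / 4"
      by (simp add: power_divide del: scaleR_add_right)
    have f: "f ((1/2) *\<^sub>R (x + y)) = (f x + f y) / 2"
      by (subst f.scaleR) (simp add: f.add)
    have "4 * J ((1/2) *\<^sub>R (x + y)) = (norm (x + y))\<^sup>2 - 4 * (f x + f y)"
      unfolding J_def n f by (simp add: field_simps)
    moreover have "(norm (x + y))\<^sup>2 + (norm (x - y))\<^sup>2 = 2 * (norm x)\<^sup>2 + 2 * (norm y)\<^sup>2"
      by (simp add: norm_add_square norm_diff_square)
    ultimately show ?thesis
      using m_le [of "(1/2) *\<^sub>R (x + y)"] by (simp add: J_def)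
  qed
  have lim0: "(\<lambda>n. 1 / real (Suc n)) \<longlonglongrightarrow> 0"
    using LIMSEQ_inverse_real_of_nat by (simp add: inverse_eq_divide)
  have "Cauchy u"
  proof (rule metric_CauchyI)
    fix e :: real assume "0 < e"
    then have "0 < e\<^sup>2 / 4" by simp
    then obtain N where N: "\<And>n. n \<ge> N \<Longrightarrow> 1 / real (Suc n) < e\<^sup>2 / 4"
      using order_tendstoD(2) [OF lim0] unfolding eventually_sequentially by blast
    show "\<exists>M. \<forall>m\<ge>M. \<forall>n\<ge>M. dist (u m) (u n) < e"
    proof (intro exI allI impI)
      fix a b assume "N \<le> a" "N \<le> b"
      then have "J (u a) < m + e\<^sup>2 / 4" "J (u b) < m + e\<^sup>2 / 4"
        using N u by (meson add_strict_left_mono less_trans)+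
      then have "(norm (u a - u b))\<^sup>2 < e\<^sup>2"
        using mid [of "u a" "u b"] by argo
      then show "dist (u a) (u b) < e"
        using \<open>0 < e\<close> by (simp add: dist_norm power2_less_imp_less)
    qed
  qed
  then obtain z where z: "u \<longlonglongrightarrow> z"
    using Cauchy_convergent convergentD by blast
  have "(\<lambda>n. J (u n)) \<longlonglongrightarrow> J z"
    unfolding J_def by (intro tendsto_intros f.tendsto z)
  moreover have "(\<lambda>n. J (u n)) \<longlonglongrightarrow> m"
  proof (rule tendsto_sandwich [of "\<lambda>_. m" _ _ "\<lambda>n. m + 1 / Suc n"])
    show "(\<lambda>n. m + 1 / Suc n) \<longlonglongrightarrow> m"
      using tendsto_add [OF tendsto_const lim0, of m] by simp
  qed (use m_le u in \<open>auto intro!: always_eventually less_imp_le simp del: of_nat_Suc\<close>)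
  ultimately have Jz: "J z = m" using LIMSEQ_unique by blast
  have "f x = Re (cinner x z)" for x
  proof (rule ccontr)
    define d where "d = f x - Re (cinner x z)"
    assume "f x \<noteq> Re (cinner x z)"
    then have d: "d \<noteq> 0" by (simp add: d_def)
    have *: "J z \<le> J z - 2 * t * d + t\<^sup>2 * (norm x)\<^sup>2" for t
    proof -
      have "J (z + t *\<^sub>R x) = J z - 2 * t * d + t\<^sup>2 * (norm x)\<^sup>2"
        unfolding J_def norm_add_square d_def
        by (simp add: cinner.scaleR_right f.add f.scaleR power_mult_distrib
            Re_cinner_commute [of z x] algebra_simps)
      then show ?thesis using Jz m_le by metis
    qed
    \<comment> \<open>The minimiser of the quadratic above, up to the 1 that keeps the denominator
      positive.\<close>
    define t where "t = d / (1 + (norm x)\<^sup>2)"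
    have pos: "0 < 1 + (norm x)\<^sup>2" by (simp add: add_pos_nonneg)
    have "2 * t * d \<le> t\<^sup>2 * (norm x)\<^sup>2" using * [of t] by simp
    also have "\<dots> \<le> t\<^sup>2 * (1 + (norm x)\<^sup>2)" by (simp add: mult_left_mono)
    also have "\<dots> = t * d"
      using pos by (simp add: t_def power2_eq_square)
    finally have "t * d \<le> 0" by (simp add: mult.commute)
    moreover have "t * d = d\<^sup>2 / (1 + (norm x)\<^sup>2)" by (simp add: t_def power2_eq_square)
    ultimately show False
      using d pos by (simp add: divide_le_0_iff not_le)
  qed
  then show ?thesis using that by blast
qed

text \<open>Lifts an identity of real parts to the complex one: it is applied at \<open>x\<close>
  and at \<i> times \<open>x\<close>.\<close>

lemma cinner_scaleC_imaginary: "cinner x y = Re (cinner x y) - \<i> * Re (cinner (\<i> *\<^sub>C x) (y::'h::chilbert_space))"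
  by (simp add: cinner_scaleC_left complex_eq_iff)

text \<open>\<open>\<Phi>\<close> plays the role of the real part of a sesquilinear form, which determines the form.\<close>

lemma bounded_form_operator:
  fixes \<Phi> :: "'h::chilbert_space \<Rightarrow> 'h \<Rightarrow> real"
  assumes \<Phi>: "bounded_bilinear \<Phi>" and i: "\<And>x y. \<Phi> (\<i> *\<^sub>C x) (\<i> *\<^sub>C y) = \<Phi> x y"
  obtains B :: "'h op" where "bounded_op B" "\<And>x y. \<Phi> x y = Re (cinner x (B y))"
proof -
  interpret \<Phi>: bounded_bilinear \<Phi> by fact
  have "\<exists>z. \<forall>x. \<Phi> x y = Re (cinner x z)" for y
    using Riesz_real [OF \<Phi>.bounded_linear_left [of y]] by blast
  then obtain b where b: "\<And>x y. \<Phi> x y = Re (cinner x (b y))" by metis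
  have b': "Re (cinner (b y) x) = \<Phi> x y" for x y
    using b Re_cinner_commute by metis
  obtain K where K: "0 \<le> K" "\<And>x y. norm (\<Phi> x y) \<le> norm x * norm y * K"
    using \<Phi>.nonneg_bounded by blast
  have "bounded_linear b"
  proof (rule bounded_linear_intro [where K = K])
    show "b (x + y) = b x + b y" for x y
      by (rule Re_cinner_ext) (simp add: b' cinner.add_left \<Phi>.add_right)
    show "b (r *\<^sub>R x) = r *\<^sub>R b x" for r x
      by (rule Re_cinner_ext) (simp add: b' cinner.scaleR_left \<Phi>.scaleR_right)
    show "norm (b x) \<le> norm x * K" for x
    proof (cases "b x = 0")
      case False
      have "norm (b x) * norm (b x) \<le> norm (b x) * (norm x * K)"
        using K(2) [of "b x" x] b [of "b x" x]
        by (simp add: Re_cinner_self power2_eq_square mult.assoc)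
      then show ?thesis using False by simp
    qed (use K in simp)
  qed
  then have B: "blinfun_apply (Blinfun b) = b" by (rule bounded_linear_Blinfun_apply)
  \<comment> \<open>The invariance of \<open>\<Phi>\<close> becomes commutation of \<open>b\<close>
    with \<i>, which together with real linearity is complex linearity.\<close>
  have bi: "b (\<i> *\<^sub>C y) = \<i> *\<^sub>C b y" for y
  proof (rule Re_cinner_ext)
    fix x
    have "Re (cinner (\<i> *\<^sub>C b y) x) = - Re (cinner (b y) (\<i> *\<^sub>C x))"
      by (simp add: cinner_scaleC_left cinner_scaleC_right)
    also have "\<dots> = - \<Phi> (\<i> *\<^sub>C x) y" by (simp add: b')
    also have "\<dots> = - \<Phi> (\<i> *\<^sub>C \<i> *\<^sub>C x) (\<i> *\<^sub>C y)" by (simp add: i)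
    also have "\<dots> = \<Phi> x (\<i> *\<^sub>C y)" by (simp add: scaleC_scaleC scaleC.minus_left \<Phi>.minus_left)
    finally show "Re (cinner (b (\<i> *\<^sub>C y)) x) = Re (cinner (\<i> *\<^sub>C b y) x)" by (simp add: b')
  qed
  have "bounded_op (Blinfun b)"
    unfolding bounded_op_def
  proof (intro allI)
    fix c x
    interpret b: bounded_linear b by fact
    have c: "c *\<^sub>C y = Re c *\<^sub>R y + Im c *\<^sub>R (\<i> *\<^sub>C y)" for y :: 'h
      unfolding scaleC_of_real [symmetric] scaleC_scaleC scaleC.add_left [symmetric]
      using complex_eq [of c] by (metis mult.commute)
    show "Blinfun b (c *\<^sub>C x) = c *\<^sub>C Blinfun b x"
      unfolding B c [of x] c [of "b x"] by (simp add: b.add b.scaleR bi)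
  qed
  then show ?thesis using that b B by metis
qed

subsection \<open>Bounded operators\<close>

lemma compose_id [simp]: "A o\<^sub>L id_blinfun = A" "id_blinfun o\<^sub>L A = A"
  by (auto intro: blinfun_eqI)

named_theorems bop
lemma bounded_op_add [bop]: "bounded_op A \<Longrightarrow> bounded_op B \<Longrightarrow> bounded_op (A + B)"
  by (simp add: bounded_op_def blinfun.add_left scaleC.add_right)
lemma bounded_op_diff [bop]: "bounded_op A \<Longrightarrow> bounded_op B \<Longrightarrow> bounded_op (A - B)"
  by (simp add: bounded_op_def blinfun.diff_left scaleC.diff_right)
lemma bounded_op_minus [bop]: "bounded_op A \<Longrightarrow> bounded_op (- A)"
  by (simp add: bounded_op_def blinfun.minus_left scaleC.minus_right)
lemma bounded_op_scaleR [bop]: "bounded_op A \<Longrightarrow> bounded_op (r *\<^sub>R A)"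
  by (simp add: bounded_op_def blinfun.scaleR_left scaleC.scaleR_right)
lemma bounded_op_compose [bop]: "bounded_op A \<Longrightarrow> bounded_op B \<Longrightarrow> bounded_op (A o\<^sub>L B)"
  by (simp add: bounded_op_def)
lemma bounded_op_id [bop, simp]: "bounded_op id_blinfun"
  by (simp add: bounded_op_def)
lemma bounded_op_0 [bop, simp]: "bounded_op 0"
  by (simp add: bounded_op_def scaleC.zero_right)
lemma bounded_op_scaleC_op [bop]: "bounded_op A \<Longrightarrow> bounded_op (scaleC_op c A)"
  by (simp add: bounded_op_def scaleC_op.rep_eq scaleC_scaleC mult.commute)

text \<open>Over the complex numbers a quadratic form determines its operator. Expanding the form of
  the difference D at x + y and at \<i> x + y shows that <D x, y> and <D y, x> are both opposite and
  equal.\<close>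

lemma bounded_op_ext_Re:
  fixes A B :: "'h::chilbert_space op"
  assumes A: "bounded_op A" and B: "bounded_op B" and eq: "\<And>x. Re (cinner (A x) x) = Re (cinner (B x) x)"
  and sym: "\<And>x. Im (cinner (A x) x) = Im (cinner (B x) x)"
  shows "A = B"
proof -
  define D where "D = A - B"
  have D: "bounded_op D" unfolding D_def by (intro bop A B)
  have 0: "cinner (D x) x = 0" for x
    using eq [of x] sym [of x] by (simp add: D_def blinfun.diff_left cinner.diff_left complex_eq_iff)
  have "cinner (D x) y = 0" for x y
  proof -
    have 1: "cinner (D x) y + cinner (D y) x = 0"
      using 0 [of "x + y"] 0 [of x] 0 [of y] by (simp add: blinfun.add_right cinner.add_left cinner.add_right add.commute)
    have "D (\<i> *\<^sub>C x) = \<i> *\<^sub>C D x" using D by (simp add: bounded_op_def)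
    then have "\<i> * cinner (D x) y - \<i> * cinner (D y) x = 0"
      using 0 [of "\<i> *\<^sub>C x + y"] 0 [of "\<i> *\<^sub>C x"] 0 [of y]
      by (simp add: blinfun.add_right cinner.add_left cinner.add_right cinner_scaleC_left cinner_scaleC_right)
    then have "cinner (D x) y = cinner (D y) x" by simp
    with 1 show ?thesis by simp
  qed
  then have "D x = 0" for x by (intro cinner_ext) (simp add: cinner.zero_left)
  then show ?thesis unfolding D_def by (intro blinfun_eqI) (simp add: blinfun.diff_left)
qed

lemma bounded_op_ext:
  assumes "bounded_op A" "bounded_op B" "\<And>x. cinner (A x) x = cinner (B x) x"
  shows "A = B"
  using assms by (intro bounded_op_ext_Re) auto

text \<open>The definite description \<open>adj\<close> gets its content here: Re <A x, y> is a
  bounded form, hence represented by an operator acting on \<open>y\<close>.\<close>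

lemma adj_exists:
  assumes A: "bounded_op A"
  shows "\<exists>B. bounded_op B \<and> (\<forall>x y. cinner (A x) y = cinner x (B y))"
proof -
  have "bounded_bilinear (\<lambda>x y. Re (cinner (A x) y))"
  proof (standard, goal_cases)
    case 5
    have "\<bar>Re (cinner (A x) y)\<bar> \<le> norm x * norm y * norm A" for x y
    proof -
      have "\<bar>Re (cinner (A x) y)\<bar> \<le> norm (A x) * norm y"
        using abs_Re_le_cmod cinner_Cauchy_Schwarz order_trans by blast
      also have "\<dots> \<le> norm A * norm x * norm y"
        by (intro mult_right_mono norm_blinfun) simp
      finally show ?thesis by (simp add: mult_ac)
    qed
    then show ?case by auto
  qed (simp_all add: blinfun.add_right blinfun.scaleR_right cinner.add_left cinner.add_right
      cinner.scaleR_left cinner.scaleR_right)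
  moreover have Ai: "A (\<i> *\<^sub>C x) = \<i> *\<^sub>C A x" for x using A by (simp add: bounded_op_def)
  ultimately obtain B where B: "bounded_op B" "\<And>x y. Re (cinner (A x) y) = Re (cinner x (B y))"
    using bounded_form_operator [of "\<lambda>x y. Re (cinner (A x) y)"]
    by (auto simp: cinner_scaleC_left cinner_scaleC_right)
  have "cinner (A x) y = cinner x (B y)" for x y
    using B(2) [of x y] B(2) [of "\<i> *\<^sub>C x" y]
    by (subst cinner_scaleC_imaginary, subst (2) cinner_scaleC_imaginary) (simp add: Ai)
  with B show ?thesis by blast
qed

lemma adj_eqI:
  fixes A B :: "'h::chilbert_space op"
  assumes "\<And>x y. cinner (A x) y = cinner x (B y)"
  shows "adj A = B"
  unfolding adj_def
proof (rule the_equality)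
  fix B' :: "'h op" assume B': "\<forall>x y. cinner (A x) y = cinner x (B' y)"
  show "B' = B"
  proof (rule blinfun_eqI, rule cinner_ext)
    fix x y show "cinner (B' x) y = cinner (B x) y"
      using B' assms by (metis cinner_commute)
  qed
qed (use assms in simp)

lemma cinner_adj: "bounded_op A \<Longrightarrow> cinner (A x) y = cinner x (adj A y)"
  using adj_exists [of A] adj_eqI by metis

lemma bounded_op_adj [bop]: "bounded_op A \<Longrightarrow> bounded_op (adj A)"
  using adj_exists [of A] adj_eqI by metis

section \<open>Self-adjoint and positive operators\<close>

definition sa :: "'h::chilbert_space op \<Rightarrow> bool" where
  "sa A \<longleftrightarrow> bounded_op A \<and> (\<forall>x y. cinner (A x) y = cinner x (A y))"

lemma sa_bounded_op: "sa A \<Longrightarrow> bounded_op A"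
  by (simp add: sa_def)
lemma sa_adj: "sa A \<Longrightarrow> adj A = A"
  by (rule adj_eqI) (simp add: sa_def)
lemma sa_cinner: "sa A \<Longrightarrow> cinner (A x) y = cinner x (A y)"
  by (simp add: sa_def)
lemma sa_iff_adj: "sa A \<longleftrightarrow> bounded_op A \<and> adj A = A"
  by (metis cinner_adj sa_adj sa_def)
lemma sa_Im: "sa A \<Longrightarrow> Im (cinner (A x) x) = 0"
  by (metis Im_complex_of_real cinner_commute complex_cnj_cancel_iff sa_cinner Reals_cnj_iff complex_is_Real_iff)

lemma sa_of_real: "sa A \<Longrightarrow> cinner (A x) x = complex_of_real (Re (cinner (A x) x))"
  by (simp add: complex_eq_iff sa_Im)

text \<open>The quadratic forms of \<open>A\<close> and its adjoint are complex conjugates; if real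
  they agree, and a form determines its operator.\<close>

lemma saI:
  assumes A: "bounded_op A" and im: "\<And>x. Im (cinner (A x) x) = 0"
  shows "sa A"
proof -
  have "adj A = A"
  proof (rule bounded_op_ext)
    fix x show "cinner (adj A x) x = cinner (A x) x"
      using cinner_adj [OF A, of x x] cinner_commute [of "adj A x" x] im [of x]
      by (simp add: complex_eq_iff)
  qed (intro bop A)+
  then show ?thesis using A by (simp add: sa_iff_adj)
qed

lemma sa_ext:
  assumes "sa A" "sa B" "\<And>x. Re (cinner (A x) x) = Re (cinner (B x) x)"
  shows "A = B"
  using assms by (intro bounded_op_ext_Re) (auto simp: sa_Im sa_bounded_op)

lemma sa_add [bop]: "sa A \<Longrightarrow> sa B \<Longrightarrow> sa (A + B)"
  by (simp add: sa_def bop blinfun.add_left cinner.add_left cinner.add_right)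
lemma sa_diff [bop]: "sa A \<Longrightarrow> sa B \<Longrightarrow> sa (A - B)"
  by (simp add: sa_def bop blinfun.diff_left cinner.diff_left cinner.diff_right)
lemma sa_minus [bop]: "sa A \<Longrightarrow> sa (- A)"
  by (simp add: sa_def bop blinfun.minus_left cinner.minus_left cinner.minus_right)
lemma sa_scaleR [bop]: "sa A \<Longrightarrow> sa (r *\<^sub>R A)"
  by (simp add: sa_def bop blinfun.scaleR_left cinner.scaleR_left cinner.scaleR_right)
lemma sa_id [bop, simp]: "sa id_blinfun"
  by (simp add: sa_def)
lemma sa_0 [bop, simp]: "sa 0"
  by (simp add: sa_def cinner.zero_left cinner.zero_right)
lemma sa_compose: "sa A \<Longrightarrow> sa B \<Longrightarrow> A o\<^sub>L B = B o\<^sub>L A \<Longrightarrow> sa (A o\<^sub>L B)"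
  unfolding sa_def by (metis blinfun_apply_blinfun_compose bounded_op_compose)
lemma sa_sandwich [bop]: "sa S \<Longrightarrow> sa A \<Longrightarrow> sa (S o\<^sub>L A o\<^sub>L S)"
  by (simp add: sa_def bop)
lemma adj_compose: "bounded_op A \<Longrightarrow> bounded_op B \<Longrightarrow> adj (A o\<^sub>L B) = adj B o\<^sub>L adj A"
  by (rule adj_eqI) (simp add: cinner_adj)
lemma adj_adj: "bounded_op A \<Longrightarrow> adj (adj A) = A"
  by (rule adj_eqI) (metis cinner_adj cinner_commute)

lemma positive_op_sa: "positive_op A \<Longrightarrow> sa A"
  by (rule saI) (auto simp: positive_op_def complex_nonneg_Reals_iff)

lemma positive_op_iff: "positive_op A \<longleftrightarrow> sa A \<and> (\<forall>x. 0 \<le> Re (cinner (A x) x))"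
proof
  assume "positive_op A"
  then show "sa A \<and> (\<forall>x. 0 \<le> Re (cinner (A x) x))"
    using positive_op_sa [of A] by (simp add: positive_op_def complex_nonneg_Reals_iff)
next
  assume "sa A \<and> (\<forall>x. 0 \<le> Re (cinner (A x) x))"
  then show "positive_op A"
    using sa_bounded_op [of A] sa_Im [of A] by (simp add: positive_op_def complex_nonneg_Reals_iff)
qed

lemma positive_op_Re: "positive_op A \<Longrightarrow> 0 \<le> Re (cinner (A x) x)"
  by (simp add: positive_op_iff)

lemma positive_op_add [bop]: "positive_op A \<Longrightarrow> positive_op B \<Longrightarrow> positive_op (A + B)"
  by (simp add: positive_op_iff bop blinfun.add_left cinner.add_left)
lemma positive_op_scaleR [bop]: "0 \<le> r \<Longrightarrow> positive_op A \<Longrightarrow> positive_op (r *\<^sub>R A)"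
  by (simp add: positive_op_iff bop blinfun.scaleR_left cinner.scaleR_left)
lemma positive_op_id [bop, simp]: "positive_op id_blinfun"
  by (simp add: positive_op_iff Re_cinner_self)
lemma positive_op_sandwich [bop]: "sa S \<Longrightarrow> positive_op A \<Longrightarrow> positive_op (S o\<^sub>L A o\<^sub>L S)"
  by (simp add: positive_op_iff bop) (metis sa_cinner)
lemma positive_op_square [bop]: "sa S \<Longrightarrow> positive_op (S o\<^sub>L S)"
  using positive_op_sandwich [of S id_blinfun] by simp

text \<open>\<open>x\<close> minimises the form, but moving from \<open>x\<close> in the direction
  of - A x lowers it to first order unless A x = 0.\<close>

lemma positive_op_zeroD:
  assumes A: "positive_op A" and 0: "Re (cinner (A x) x) = 0"
  shows "A x = 0"
proof -
  define a where "a = (norm (A x))\<^sup>2"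
  define b where "b = Re (cinner (A (A x)) (A x))"
  have b: "0 \<le> b" using A by (simp add: b_def positive_op_iff)
  have sa: "Re (cinner (A (A x)) x) = a"
    using sa_cinner [OF positive_op_sa [OF A], of "A x" x] by (simp add: a_def Re_cinner_self)
  have *: "0 \<le> - (2 * t * a) + t\<^sup>2 * b" for t
    using positive_op_Re [OF A, of "x - t *\<^sub>R A x"] sa 0
    by (simp add: blinfun.diff_right blinfun.scaleR_right cinner.diff_left cinner.diff_right
        cinner.scaleR_left cinner.scaleR_right Re_cinner_self a_def b_def power2_eq_square algebra_simps)
  \<comment> \<open>Close to the minimiser a / b of the quadratic above; the 1 covers the case b =
    0.\<close>
  define t where "t = a / (1 + b)"
  have t: "t * (1 + b) = a" using b by (simp add: t_def)
  have "0 \<le> - (2 * t * a) + t\<^sup>2 * b" by (rule *)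
  also have "\<dots> \<le> - (2 * t * a) + t * (t * (1 + b))"
    by (simp add: power2_eq_square algebra_simps)
  also have "\<dots> = - (a\<^sup>2 / (1 + b))"
    unfolding t by (simp add: t_def power2_eq_square)
  finally have "a\<^sup>2 / (1 + b) \<le> 0" by simp
  then have "a = 0" using b by (simp add: divide_le_0_iff)
  then show ?thesis by (simp add: a_def)
qed

lemma cinner_le_norm:
  fixes A :: "'h::chilbert_space op"
  shows "\<bar>Re (cinner (A x) x)\<bar> \<le> norm A * (norm x)\<^sup>2"
proof -
  have "\<bar>Re (cinner (A x) x)\<bar> \<le> norm (A x) * norm x"
    using abs_Re_le_cmod cinner_Cauchy_Schwarz order_trans by blast
  also have "\<dots> \<le> norm A * norm x * norm x"
    by (intro mult_right_mono norm_blinfun) simp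
  finally show ?thesis by (simp add: power2_eq_square mult.assoc)
qed

lemma norm_id_diff_positive: 
  assumes "sa A" "norm A \<le> r"
  shows "positive_op (r *\<^sub>R id_blinfun - A)"
proof -
  have "Re (cinner (A x) x) \<le> r * (norm x)\<^sup>2" for x
    using cinner_le_norm [of A x] mult_right_mono [OF assms(2), of "(norm x)\<^sup>2"] by auto
  then show ?thesis using assms
    by (simp add: positive_op_iff bop blinfun.diff_left blinfun.scaleR_left cinner.diff_left
        cinner.scaleR_left Re_cinner_self)
qed

subsection \<open>Polynomials of an operator\<close>

interpretation compose: bounded_bilinear "(o\<^sub>L) :: ('b::real_normed_vector \<Rightarrow>\<^sub>L 'c::real_normed_vector) \<Rightarrow> ('a::real_normed_vector \<Rightarrow>\<^sub>L 'b) \<Rightarrow> _"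
  by (rule bounded_bilinear_blinfun_compose)

lemma compose_assoc: "(A o\<^sub>L B) o\<^sub>L C = A o\<^sub>L (B o\<^sub>L C)"
  by (rule blinfun_eqI) simp

text \<open>Horner's rule, which makes \<open>op_poly_pCons\<close> the recursion behind all
  inductions on polynomials.\<close>

definition op_poly :: "real poly \<Rightarrow> 'h::chilbert_space op \<Rightarrow> 'h op" where
  "op_poly p T = fold_coeffs (\<lambda>a F. a *\<^sub>R id_blinfun + (T o\<^sub>L F)) p 0"

lemma op_poly_0 [simp]: "op_poly 0 T = 0"
  by (simp add: op_poly_def)

lemma op_poly_pCons [simp]: "op_poly (pCons a p) T = a *\<^sub>R id_blinfun + (T o\<^sub>L op_poly p T)"
  by (cases "p = 0 \<and> a = 0") (auto simp: op_poly_def)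

lemma op_poly_1 [simp]: "op_poly 1 T = id_blinfun"
  by (simp add: one_pCons)

lemma op_poly_add [simp]: "op_poly (p + q) T = op_poly p T + op_poly q T"
proof (induction p arbitrary: q)
  case (pCons a p)
  show ?case
    by (cases q) (simp add: pCons compose.add_right scaleR_add_left)
qed simp

lemma op_poly_smult [simp]: "op_poly (smult c p) T = c *\<^sub>R op_poly p T"
  by (induction p) (auto simp: compose.scaleR_right scaleR_add_right)

lemma op_poly_mult [simp]: "op_poly (p * q) T = op_poly p T o\<^sub>L op_poly q T"
  by (induction p) (auto simp: compose.add_left compose.scaleR_left compose_assoc)

lemma op_poly_pcompose: "op_poly (pcompose p q) T = op_poly p (op_poly q T)"
  by (induction p) (auto simp: pcompose_pCons)

lemma op_poly_commute:
  assumes "C o\<^sub>L T = T o\<^sub>L C"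
  shows "C o\<^sub>L op_poly p T = op_poly p T o\<^sub>L C"
proof (induction p)
  case (pCons a p)
  have "C o\<^sub>L (T o\<^sub>L op_poly p T) = (T o\<^sub>L op_poly p T) o\<^sub>L C"
    by (metis assms pCons.IH compose_assoc)
  then show ?case
    by (simp add: compose.add_left compose.add_right compose.scaleR_left compose.scaleR_right)
qed simp

lemma op_poly_sa [bop]:
  assumes "sa T" shows "sa (op_poly p T)"
proof (induction p)
  case (pCons a p)
  have "sa (T o\<^sub>L op_poly p T)"
    using assms pCons by (intro sa_compose op_poly_commute) auto
  then show ?case by (simp add: bop)
qed simp

lemma op_poly_positive_sandwich:
  assumes "sa T" "positive_op (op_poly p T)"
  shows "positive_op (op_poly (q * p * q) T)"
  using positive_op_sandwich [OF op_poly_sa [OF assms(1)] assms(2), of q] by simp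

text \<open>Even powers can be pulled outside as a sandwich, which leaves exponents 0 and 1. The
  only case with content is then T (r - T): multiplied by r it is a sum of two sandwiches. Square
  roots cannot be used here, because they are derived from this lemma.\<close>

lemma op_poly_Bernstein_positive:
  assumes r: "0 < r" and T: "positive_op T" "positive_op (r *\<^sub>R id_blinfun - T)"
  shows "positive_op (op_poly ([:0, 1:] ^ k * [:r, -1:] ^ m) T)"
proof -
  define X Y where "X = [:0, 1::real:]" and "Y = [:r, -1:]"
  let ?P = "\<lambda>p. positive_op (op_poly p T)"
  have sa: "sa T" using T by (simp add: positive_op_sa)
  have sandwich: "?P (q * p * q)" if "?P p" for p q
    using sa that by (rule op_poly_positive_sandwich)
  have 1: "?P 1" by simp
  have X: "?P X" using T by (simp add: X_def)
  have Y: "?P Y" using T by (simp add: Y_def compose.minus_right)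
  \<comment> \<open>since \<open>X + Y = r\<close>\<close>
  have "smult r (X * Y) = Y * X * Y + X * Y * X"
    by (simp add: X_def Y_def algebra_simps)
  then have "r *\<^sub>R op_poly (X * Y) T = op_poly (Y * X * Y) T + op_poly (X * Y * X) T"
    by (metis op_poly_add op_poly_smult)
  then have "positive_op ((1/r) *\<^sub>R (r *\<^sub>R op_poly (X * Y) T))"
    using positive_op_add [OF sandwich [OF X, of Y] sandwich [OF Y, of X]] r
    by (simp only:) (rule positive_op_scaleR, auto)
  then have XY: "?P (X * Y)" using r by (simp del: op_poly_mult)
  define a b where "a = k div 2" and "b = m div 2"
  have k: "k = a + k mod 2 + a" and m: "m = b + m mod 2 + b" unfolding a_def b_def by presburger+
  have "?P (X ^ (k mod 2) * Y ^ (m mod 2))"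
    using 1 X Y XY by (cases "even k"; cases "even m") (simp_all add: odd_iff_mod_2_eq_one [symmetric]
        even_iff_mod_2_eq_zero [symmetric] mod_2_eq_odd del: op_poly_mult)
  then have "?P ((X ^ a * Y ^ b) * (X ^ (k mod 2) * Y ^ (m mod 2)) * (X ^ a * Y ^ b))"
    by (rule sandwich)
  also have "(X ^ a * Y ^ b) * (X ^ (k mod 2) * Y ^ (m mod 2)) * (X ^ a * Y ^ b) = X ^ k * Y ^ m"
  proof -
    have "X ^ k = X ^ a * X ^ (k mod 2) * X ^ a" "Y ^ m = Y ^ b * Y ^ (m mod 2) * Y ^ b"
      using k m by (metis power_add)+
    then show ?thesis by (simp only: mult_ac)
  qed
  finally show ?thesis by (simp only: X_def Y_def)
qed

subsection \<open>The Hausdorff moment problem\<close>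

text \<open>A Bernstein expansion yields ratios of falling factorials where the moments of a measure
  on the points k/n have powers. Factor by factor the two differ by at most j / (n - j), so the
  error vanishes as n grows with j fixed.\<close>

lemma falling_ratio_power_diff:
  fixes j k n :: nat
  assumes k: "k \<le> n" and n: "2 * j < n"
  shows "\<bar>real (k choose j) / real (n choose j) - (real k / real n) ^ j\<bar> \<le> real j * (real j / (real n - real j))"
proof -
  have gb: "real (m choose j) = (\<Prod>i<j. real m - real i) / fact j" for m
    by (simp add: binomial_gbinomial gbinomial_prod_rev lessThan_atLeast0)
  have ratio: "real (k choose j) / real (n choose j) = (\<Prod>i<j. (real k - real i) / (real n - real i))"
    by (simp add: gb prod_dividef)
  have pw: "(real k / real n) ^ j = (\<Prod>i<j. real k / real n)" by simp
  have "norm ((\<Prod>i<j. (real k - real i) / (real n - real i)) - (\<Prod>i<j. real k / real n))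
      \<le> (\<Sum>i<j. norm ((real k - real i) / (real n - real i) - real k / real n))"
    using k n by (intro norm_prod_diff) (auto simp: divide_simps abs_le_iff)
  also have "\<dots> \<le> (\<Sum>i<j. real j / (real n - real j))"
  proof (rule sum_mono)
    fix i assume "i \<in> {..<j}"
    then have i: "real i < real j" by simp
    have n': "real n - real j > 0" "real n - real i > 0" "real n > 0" using n i by linarith+
    have "(real k - real i) / (real n - real i) - real k / real n = - (real i / (real n - real i)) * (1 - real k / real n)"
      using n' by (simp add: field_simps)
    then have "norm ((real k - real i) / (real n - real i) - real k / real n) = (real i / (real n - real i)) * \<bar>1 - real k / real n\<bar>"
      using n' by (simp add: abs_mult)
    also have "\<dots> \<le> (real i / (real n - real i)) * 1"
      using n' k by (intro mult_left_mono) (auto simp: abs_le_iff divide_simps)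
    also have "\<dots> \<le> real j / (real n - real j)"
      using n' i by (simp add: frac_le)
    finally show "norm ((real k - real i) / (real n - real i) - real k / real n) \<le> real j / (real n - real j)" .
  qed
  finally show ?thesis by (simp add: ratio pw del: prod_constant)
qed

text \<open>Multiply \<open>X ^ j\<close> by (X + Y)^(n - j) = 1 and expand; the coefficients are
  rearranged by \<open>choose_mult\<close>.\<close>

lemma monom_Bernstein_expansion:
  fixes X Y :: "real poly"
  assumes XY: "X + Y = 1" and j: "j \<le> n"
  shows "X ^ j = (\<Sum>k\<le>n. smult (real (k choose j) / real (n choose j)) (smult (real (n choose k)) (X ^ k * Y ^ (n - k))))"
proof -
  have "(\<Sum>k\<le>n. smult (real (k choose j) / real (n choose j)) (smult (real (n choose k)) (X ^ k * Y ^ (n - k))))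
      = (\<Sum>k\<in>{j..n}. smult (real (k choose j) / real (n choose j)) (smult (real (n choose k)) (X ^ k * Y ^ (n - k))))"
    by (rule sum.mono_neutral_right) (auto simp: not_le)
  also have "\<dots> = (\<Sum>i\<le>n - j. X ^ j * (of_nat ((n - j) choose i) * X ^ i * Y ^ (n - j - i)))"
  proof (rule sum.reindex_bij_witness [of _ "\<lambda>i. i + j" "\<lambda>k. k - j"])
    fix k assume k: "k \<in> {j..n}"
    then have "(n choose k) * (k choose j) = (n choose j) * ((n - j) choose (k - j))"
      by (intro choose_mult) auto
    then have "real (k choose j) / real (n choose j) * real (n choose k) = real ((n - j) choose (k - j))"
      using j by (simp add: field_simps flip: of_nat_mult)
    then show "X ^ j * (of_nat ((n - j) choose (k - j)) * X ^ (k - j) * Y ^ (n - j - (k - j)))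
      = smult (real (k choose j) / real (n choose j)) (smult (real (n choose k)) (X ^ k * Y ^ (n - k)))"
      using k power_add [of X j "k - j"] by (simp add: of_nat_poly mult_ac)
  qed (use j in auto)
  also have "\<dots> = X ^ j * (X + Y) ^ (n - j)"
    by (simp add: binomial_ring sum_distrib_left)
  finally show ?thesis using XY by simp
qed

lemma binomial_measure_exists:
  fixes w :: "nat \<Rightarrow> real"
  assumes n: "0 < n" and w: "\<And>k. 0 \<le> w k" "(\<Sum>k\<le>n. w k) = 1"
  obtains \<mu> where "real_distribution \<mu>" "AE t in \<mu>. t \<in> {0..1}"
    "\<And>f::real\<Rightarrow>real. f \<in> borel_measurable borel \<Longrightarrow> (\<integral>t. f t \<partial>\<mu>) = (\<Sum>k\<le>n. f (real k / real n) * w k)"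
proof -
  define v where "v k = (if k \<le> n then w k else 0)" for k
  define P where "P = embed_pmf v"
  have "(\<integral>\<^sup>+ k. ennreal (v k) \<partial>count_space UNIV) = (\<Sum>k\<le>n. ennreal (v k))"
    by (subst nn_integral_count_space' [of "{..n}"]) (auto simp: v_def)
  also have "\<dots> = ennreal (\<Sum>k\<le>n. w k)"
    by (subst sum_ennreal) (auto simp: v_def w intro!: arg_cong [where f = ennreal] sum.cong)
  finally have v1: "(\<integral>\<^sup>+ k. ennreal (v k) \<partial>count_space UNIV) = 1" using w by simp
  have pmf: "pmf P k = v k" for k
    unfolding P_def using v1 w by (intro pmf_embed_pmf) (auto simp: v_def)
  define \<mu> where "\<mu> = distr (measure_pmf P) borel (\<lambda>k. real k / real n)"
  have setP: "set_pmf P \<subseteq> {..n}" by (auto simp: set_pmf_eq pmf v_def split: if_splits)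
  show ?thesis
  proof
    show "real_distribution \<mu>"
      unfolding \<mu>_def by (rule prob_space.real_distribution_distr [OF measure_pmf.prob_space_axioms]) simp
    show "AE t in \<mu>. t \<in> {0..1}"
      unfolding \<mu>_def using setP n by (subst AE_distr_iff) (auto simp: AE_measure_pmf_iff field_simps)
    fix f :: "real \<Rightarrow> real" assume [measurable]: "f \<in> borel_measurable borel"
    have "(\<integral>t. f t \<partial>\<mu>) = (\<integral>k. f (real k / real n) \<partial>measure_pmf P)"
      unfolding \<mu>_def by (rule integral_distr) auto
    also have "\<dots> = (\<Sum>k\<le>n. f (real k / real n) * pmf P k)"
      by (rule integral_measure_pmf_real) (use setP in auto)
    finally show "(\<integral>t. f t \<partial>\<mu>) = (\<Sum>k\<le>n. f (real k / real n) * w k)"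
      by (simp add: pmf v_def)
  qed
qed

text \<open>The solution is a weak limit, by Helly's theorem, of the measures with mass
  \<open>(n choose k) L(X\<^sup>k (1 - X)\<^bsup>n-k\<^esup>)\<close> at \<open>k/n\<close>.\<close>

lemma Hausdorff_moment_unit:
  fixes L :: "real poly \<Rightarrow> real"
  assumes add: "\<And>p q. L (p + q) = L p + L q" and smult: "\<And>c p. L (smult c p) = c * L p"
    and one: "L 1 = 1" and pos: "\<And>k m. 0 \<le> L ([:0, 1:] ^ k * [:1, -1:] ^ m)"
  shows "\<exists>M. real_distribution M \<and> (AE t in M. t \<in> {0..1}) \<and> (\<forall>p. (\<integral>t. poly p t \<partial>M) = L p)"
proof -
  define X Y where "X = [:0, 1::real:]" and "Y = [:1, -1::real:]"
  have XY: "X + Y = 1" by (simp add: X_def Y_def one_pCons)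
  define w where "w n k = real (n choose k) * L (X ^ k * Y ^ (n - k))" for n k
  have w0: "0 \<le> w n k" for n k using pos by (simp add: w_def X_def Y_def)
  have L0: "L 0 = 0" using smult [of 0 0] by simp
  have Lsum: "L (sum g I) = (\<Sum>i\<in>I. L (g i))" if "finite I" for g and I :: "nat set"
    using that by (induction I) (auto simp: add L0)
  have LX: "L (X ^ j) = (\<Sum>k\<le>n. real (k choose j) / real (n choose j) * w n k)" if "j \<le> n" for j n
    by (subst monom_Bernstein_expansion [OF XY that]) (simp add: Lsum smult w_def mult.assoc)
  have w1: "(\<Sum>k\<le>n. w n k) = 1" for n using LX [of 0 n] one by simp
  have "\<exists>\<mu>. real_distribution \<mu> \<and> (AE t in \<mu>. t \<in> {0..1}) \<and> 
      (\<forall>f::real\<Rightarrow>real. f \<in> borel_measurable borel \<longrightarrow> (\<integral>t. f t \<partial>\<mu>) = (\<Sum>k\<le>Suc n. f (real k / real (Suc n)) * w (Suc n) k))" for n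
    using binomial_measure_exists [of "Suc n" "w (Suc n)"] w0 w1 by (metis zero_less_Suc)
  then obtain \<mu> where \<mu>: "\<And>n. real_distribution (\<mu> n)" "\<And>n. AE t in \<mu> n. t \<in> {0..1}"
    "\<And>n f. f \<in> borel_measurable borel \<Longrightarrow> (\<integral>t. f t \<partial>\<mu> n) = (\<Sum>k\<le>Suc n. f (real k / real (Suc n)) * w (Suc n) k)"
    by metis
  interpret \<mu>: real_distribution "\<mu> n" for n by (rule \<mu>)
  have "tight \<mu>"
    unfolding tight_def
  proof (intro conjI allI impI \<mu>(1))
    fix e :: real assume "0 < e"
    \<comment> \<open>Tightness uses intervals open on the left, which must start below 0 to catch
      an atom at 0.\<close>
    have "measure (\<mu> n) {-1<..1} = 1" for n
      using \<mu>(2) [of n] by (subst \<mu>.prob_eq_1) auto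
    then show "\<exists>a b. a < b \<and> (\<forall>n. 1 - e < measure (\<mu> n) {a<..b})"
      using \<open>0 < e\<close> by (intro exI [of _ "-1"] exI [of _ 1]) auto
  qed
  from tight_imp_convergent_subsubsequence [OF this, of id]
  obtain s M where s: "strict_mono s" and M: "real_distribution M" and wc: "weak_conv_m (\<mu> \<circ> s) M"
    by (auto simp: strict_mono_id)
  interpret M: real_distribution M by fact
  have lim: "(\<lambda>n. \<integral>t. f t \<partial>\<mu> (s n)) \<longlonglongrightarrow> (\<integral>t. f t \<partial>M)"
    if "continuous_on UNIV f" "\<And>t. \<bar>f t\<bar> \<le> B" for f :: "real \<Rightarrow> real" and B
    using weak_conv_imp_integral_bdd_continuous_conv [of "\<mu> \<circ> s" M f B] wc M \<mu>(1) that
    by (auto simp: continuous_on_eq_continuous_at)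
  \<comment> \<open>Weak convergence tests bounded functions only; clipping bounds the powers and
    leaves them unchanged on [0, 1].\<close>
  define c :: "real \<Rightarrow> real" where "c t = max 0 (min 1 t)" for t
  have c01: "0 \<le> c t" "c t \<le> 1" for t by (auto simp: c_def)
  have ccont: "continuous_on UNIV c" unfolding c_def by (intro continuous_intros)
  \<comment> \<open>Bounded, continuous and zero exactly on [0, 1]: its integral vanishes along the
    sequence, hence for the limit, whose mass therefore stays in [0, 1].\<close>
  define g :: "real \<Rightarrow> real" where "g t = min 1 \<bar>t - c t\<bar>" for t
  have gcont: "continuous_on UNIV g" unfolding g_def by (intro continuous_intros ccont)
  have cid: "c t = t" if "t \<in> {0..1}" for t using that by (auto simp: c_def)
  have g01: "0 \<le> g t" "g t \<le> 1" for t by (auto simp: g_def)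
  have gm [measurable]: "g \<in> borel_measurable borel" using gcont by (rule borel_measurable_continuous_onI)
  have cm [measurable]: "c \<in> borel_measurable borel" using ccont by (rule borel_measurable_continuous_onI)
  have g0: "(\<integral>t. g t \<partial>\<mu> n) = 0" for n
    using \<mu>(2) [of n] by (intro integral_eq_zero_AE) (auto simp: g_def cid)
  have "(\<lambda>n. \<integral>t. g t \<partial>\<mu> (s n)) \<longlonglongrightarrow> (\<integral>t. g t \<partial>M)"
    using g01 by (intro lim [OF gcont, of 1]) simp
  then have "(\<integral>t. g t \<partial>M) = 0"
    by (simp add: g0 LIMSEQ_const_iff)
  moreover have "integrable M g"
    by (rule M.integrable_const_bound [of _ 1]) (auto simp: g01)
  ultimately have "AE t in M. g t = 0"
    using g01 by (simp add: integral_nonneg_eq_0_iff_AE)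
  then have AE: "AE t in M. t \<in> {0..1}"
    by eventually_elim (auto simp: g_def c_def)
  have mom: "(\<integral>t. (c t) ^ j \<partial>M) = L (X ^ j)" for j
  proof -
    have "(\<lambda>n. \<integral>t. (c t) ^ j \<partial>\<mu> (s n)) \<longlonglongrightarrow> (\<integral>t. (c t) ^ j \<partial>M)"
      by (rule lim [of _ 1]) (auto intro!: continuous_intros ccont simp: c01 power_le_one power_abs)
    moreover have "(\<lambda>n. \<integral>t. (c t) ^ j \<partial>\<mu> (s n)) \<longlonglongrightarrow> L (X ^ j)"
    proof -
      \<comment> \<open>Both quantities are sums against the same weights; only the values at the
        nodes differ.\<close>
      have bound: "\<bar>(\<integral>t. (c t) ^ j \<partial>\<mu> n) - L (X ^ j)\<bar> \<le> real j * (real j / (real (Suc n) - real j))" if n: "2 * j < Suc n" for n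
      proof -
        have "(\<integral>t. (c t) ^ j \<partial>\<mu> n) = (\<Sum>k\<le>Suc n. (real k / real (Suc n)) ^ j * w (Suc n) k)"
          by (subst \<mu>(3), simp, intro sum.cong refl, subst cid) auto
        moreover have "L (X ^ j) = (\<Sum>k\<le>Suc n. real (k choose j) / real (Suc n choose j) * w (Suc n) k)"
          using n by (intro LX) simp
        ultimately have "\<bar>(\<integral>t. (c t) ^ j \<partial>\<mu> n) - L (X ^ j)\<bar> = 
          \<bar>\<Sum>k\<le>Suc n. - (real (k choose j) / real (Suc n choose j) - (real k / real (Suc n)) ^ j) * w (Suc n) k\<bar>"
          by (simp only: sum_subtractf [symmetric] left_diff_distrib minus_diff_eq)
        also have "\<dots> \<le> (\<Sum>k\<le>Suc n. \<bar>- (real (k choose j) / real (Suc n choose j) - (real k / real (Suc n)) ^ j) * w (Suc n) k\<bar>)"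
          by (rule sum_abs)
        also have "\<dots> \<le> (\<Sum>k\<le>Suc n. real j * (real j / (real (Suc n) - real j)) * w (Suc n) k)"
          unfolding abs_mult abs_minus_cancel using falling_ratio_power_diff [OF _ n] w0 n
          by (intro sum_mono mult_mono) (auto simp del: of_nat_Suc intro!: divide_nonneg_nonneg)
        also have "\<dots> = real j * (real j / (real (Suc n) - real j))"
          by (simp only: sum_distrib_left [symmetric] w1 mult_1_right)
        finally show ?thesis .
      qed
      have "(\<lambda>n. real j * (real j / (real (Suc n) - real j))) \<longlonglongrightarrow> 0"
        by real_asymp
      then have z: "(\<lambda>n. real j * (real j / (real (Suc (s n)) - real j))) \<longlonglongrightarrow> 0"
        using LIMSEQ_subseq_LIMSEQ [OF _ s] by (fastforce simp: o_def)
      have "(\<lambda>n. (\<integral>t. (c t) ^ j \<partial>\<mu> (s n)) - L (X ^ j)) \<longlonglongrightarrow> 0"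
      proof (rule Lim_null_comparison [OF _ z])
        have "2 * j < Suc (s n)" if "n \<ge> 2 * j" for n
          using seq_suble [OF s, of n] that by simp
        then show "\<forall>\<^sub>F n in sequentially. norm ((\<integral>t. (c t) ^ j \<partial>\<mu> (s n)) - L (X ^ j))
            \<le> real j * (real j / (real (Suc (s n)) - real j))"
          using bound by (intro eventually_sequentiallyI [of "2 * j"]) (auto simp del: of_nat_Suc)
      qed
      then show ?thesis by (simp add: LIM_zero_iff)
    qed
    ultimately show ?thesis by (rule LIMSEQ_unique)
  qed
  have "(\<integral>t. poly p t \<partial>M) = L p" for p
  proof -
    have "(\<integral>t. poly p t \<partial>M) = (\<integral>t. (\<Sum>i\<le>degree p. coeff p i * c t ^ i) \<partial>M)"
      using AE by (intro integral_cong_AE) (auto simp: poly_altdef cid)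
    also have "\<dots> = (\<Sum>i\<le>degree p. coeff p i * L (X ^ i))"
    proof -
      have "integrable M (\<lambda>t. c t ^ i)" for i
        by (rule M.integrable_const_bound [of _ 1]) (auto simp: c01 power_le_one power_abs)
      then show ?thesis by (simp add: mom)
    qed
    also have "\<dots> = L (\<Sum>i\<le>degree p. smult (coeff p i) (X ^ i))"
      by (simp add: Lsum smult)
    also have "(\<Sum>i\<le>degree p. smult (coeff p i) (X ^ i)) = p"
      by (simp add: X_def poly_as_sum_of_monoms flip: monom_altdef)
    finally show ?thesis .
  qed
  with M AE show ?thesis by blast
qed

text \<open>Rescaling t to t / r multiplies the Bernstein products by positive constants, so
  positivity carries over from the unit interval.\<close>

lemma Hausdorff_moment:
  fixes L :: "real poly \<Rightarrow> real"
  assumes r: "0 < r"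
    and add: "\<And>p q. L (p + q) = L p + L q" and smult: "\<And>c p. L (smult c p) = c * L p"
    and one: "L 1 = 1" and pos: "\<And>k m. 0 \<le> L ([:0, 1:] ^ k * [:r, -1:] ^ m)"
  obtains M where "real_distribution M" "AE t in M. t \<in> {0..r}" "\<And>p. (\<integral>t. poly p t \<partial>M) = L p"
proof -
  have pp: "pcompose (p ^ k) q = pcompose p q ^ k" for p q :: "real poly" and k
  proof (induction k)
    case 0
    show ?case by (simp add: one_pCons)
  qed (simp add: pcompose_mult)
  have "\<exists>M. real_distribution M \<and> (AE t in M. t \<in> {0..1}) \<and> (\<forall>p. (\<integral>t. poly p t \<partial>M) = L (pcompose p [:0, 1/r:]))"
  proof (rule Hausdorff_moment_unit)
    fix k m
    have "pcompose ([:0, 1:] ^ k * [:1, -1:] ^ m) [:0, 1/r:] = [:0, 1/r:] ^ k * [:1, -1/r:] ^ m"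
      by (simp add: pcompose_mult pp pcompose_pCons)
    also have "\<dots> = (smult (1/r) [:0, 1:]) ^ k * (smult (1/r) [:r, -1:]) ^ m" using r by simp
    also have "\<dots> = smult ((1/r) ^ k * (1/r) ^ m) ([:0, 1:] ^ k * [:r, -1:] ^ m)"
      by (simp only: smult_power mult_smult_left mult_smult_right smult_smult mult.commute)
    finally have "pcompose ([:0, 1:] ^ k * [:1, -1:] ^ m) [:0, 1/r:] = smult ((1/r) ^ k * (1/r) ^ m) ([:0, 1:] ^ k * [:r, -1:] ^ m)" .
    then show "0 \<le> L (pcompose ([:0, 1:] ^ k * [:1, -1:] ^ m) [:0, 1/r:])"
      using pos r by (simp add: smult)
  qed (simp_all add: pcompose_add pcompose_smult add smult one pcompose_1)
  then obtain M where M: "real_distribution M" "AE t in M. t \<in> {0..1}" "\<And>p. (\<integral>t. poly p t \<partial>M) = L (pcompose p [:0, 1/r:])"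
    by blast
  interpret real_distribution M by fact
  show ?thesis
  proof
    show "real_distribution (distr M borel (\<lambda>t. r * t))"
      by (rule real_distribution_distr) simp
    show "AE t in distr M borel (\<lambda>t. r * t). t \<in> {0..r}"
      using M(2) r by (subst AE_distr_iff) (auto simp: mult_le_cancel_left1 elim!: eventually_mono)
    fix p
    have "(\<integral>t. poly p t \<partial>distr M borel (\<lambda>t. r * t)) = (\<integral>t. poly p (r * t) \<partial>M)"
      by (rule integral_distr) (auto intro!: borel_measurable_continuous_onI continuous_intros)
    also have "\<dots> = (\<integral>t. poly (pcompose p [:0, r:]) t \<partial>M)"
      by (simp add: poly_pcompose mult.commute)
    also have "\<dots> = L (pcompose (pcompose p [:0, r:]) [:0, 1/r:])" by (rule M)
    also have "pcompose (pcompose p [:0, r:]) [:0, 1/r:] = p"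
      using r by (simp add: pcompose_assoc [symmetric] pcompose_pCons pcompose_idR)
    finally show "(\<integral>t. poly p t \<partial>distr M borel (\<lambda>t. r * t)) = L p" .
  qed
qed

subsection \<open>Weak limits of self-adjoint operators\<close>

lemma sa_polarization:
  fixes F :: "'h::chilbert_space op"
  assumes "sa F"
  shows "Re (cinner (F x) y) = (Re (cinner (F (x + y)) (x + y)) - Re (cinner (F (x - y)) (x - y))) / 4"
proof -
  have "Re (cinner (F y) x) = Re (cinner (F x) y)"
    using sa_cinner [OF assms, of y x] Re_cinner_commute [of y "F x"] by simp
  then show ?thesis
    by (simp add: blinfun.add_right blinfun.diff_right cinner.add_left cinner.add_right
        cinner.diff_left cinner.diff_right)
qed

lemma sa_norm_le:
  fixes F :: "'h::chilbert_space op"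
  assumes F: "sa F" and C: "0 \<le> C" and le: "\<And>x. \<bar>Re (cinner (F x) x)\<bar> \<le> C * (norm x)\<^sup>2"
  shows "norm F \<le> C"
proof (rule norm_blinfun_bound [OF C])
  fix x :: 'h
  show "norm (F x) \<le> C * norm x"
  proof (cases "x = 0 \<or> F x = 0")
    case False
    \<comment> \<open>This direction makes the pairing with \<open>F x\<close> largest, and the
      equal lengths of \<open>x\<close> and \<open>y\<close> let the parallelogram law return the
      constant C without loss.\<close>
    define y where "y = (norm x / norm (F x)) *\<^sub>R F x"
    have y: "norm y = norm x" using False by (simp add: y_def)
    have "Re (cinner (F x) y) \<le> (C * (norm (x + y))\<^sup>2 + C * (norm (x - y))\<^sup>2) / 4"
      using sa_polarization [OF F, of x y] le [of "x + y"] le [of "x - y"] by (simp add: abs_le_iff)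
    also have "\<dots> = C * (norm x)\<^sup>2"
      using y by (simp add: norm_add_square norm_diff_square algebra_simps)
    finally have "norm (F x) * norm x \<le> C * norm x * norm x"
      using False by (simp add: y_def cinner.scaleR_right Re_cinner_self power2_eq_square mult.assoc)
    then show ?thesis using False by simp
  qed (use C in auto)
qed

text \<open>Polarisation spreads convergence from the quadratic forms to the sesquilinear ones, and
  the uniform bound makes the limit a bounded form, to which \<open>bounded_form_operator\<close>
  applies.\<close>

lemma weak_limit_exists:
  fixes F :: "nat \<Rightarrow> 'h::chilbert_space op"
  assumes F: "\<And>n. sa (F n)" and C: "0 \<le> C" "\<And>n x. \<bar>Re (cinner (F n x) x)\<bar> \<le> C * (norm x)\<^sup>2"
    and conv: "\<And>x. convergent (\<lambda>n. Re (cinner (F n x) x))"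
  obtains G where "sa G" "\<And>x y. (\<lambda>n. cinner (F n x) y) \<longlonglongrightarrow> cinner (G x) y"
proof -
  define \<Phi> where "\<Phi> x y = lim (\<lambda>n. Re (cinner (F n x) y))" for x y
  have lim: "(\<lambda>n. Re (cinner (F n x) y)) \<longlonglongrightarrow> \<Phi> x y" for x y
  proof -
    have "convergent (\<lambda>n. (Re (cinner (F n (x + y)) (x + y)) - Re (cinner (F n (x - y)) (x - y))) / 4)"
    proof -
      obtain a b where "(\<lambda>n. Re (cinner (F n (x + y)) (x + y))) \<longlonglongrightarrow> a"
        "(\<lambda>n. Re (cinner (F n (x - y)) (x - y))) \<longlonglongrightarrow> b"
        using conv convergentD by metis
      then have "(\<lambda>n. (Re (cinner (F n (x + y)) (x + y)) - Re (cinner (F n (x - y)) (x - y))) / 4) \<longlonglongrightarrow> (a - b) / 4"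
        by (intro tendsto_intros) auto
      then show ?thesis by (rule convergentI)
    qed
    then show ?thesis
      unfolding \<Phi>_def convergent_LIMSEQ_iff [symmetric] by (simp add: sa_polarization [OF F, of _ x y])
  qed
  have F_i: "F n (\<i> *\<^sub>C x) = \<i> *\<^sub>C F n x" for n x
    using F [of n] by (simp add: sa_def bounded_op_def)
  have "bounded_bilinear \<Phi>"
  proof (standard, goal_cases)
    case (1 a a' b)
    show ?case
      using LIMSEQ_unique [OF lim [of "a + a'" b]] tendsto_add [OF lim [of a b] lim [of a' b]]
      by (simp add: blinfun.add_right cinner.add_left)
  next
    case (2 a b b')
    show ?case
      using LIMSEQ_unique [OF lim [of a "b + b'"]] tendsto_add [OF lim [of a b] lim [of a b']]
      by (simp add: cinner.add_right)
  next
    case (3 r a b)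
    show ?case
      using LIMSEQ_unique [OF lim [of "r *\<^sub>R a" b]] tendsto_scaleR [OF tendsto_const lim [of a b], of r]
      by (simp add: blinfun.scaleR_right cinner.scaleR_left)
  next
    case (4 a r b)
    show ?case
      using LIMSEQ_unique [OF lim [of a "r *\<^sub>R b"]] tendsto_scaleR [OF tendsto_const lim [of a b], of r]
      by (simp add: cinner.scaleR_right)
  next
    case 5
    have "\<bar>\<Phi> x y\<bar> \<le> norm x * norm y * C" for x y
    proof (rule LIMSEQ_le_const2 [OF tendsto_rabs [OF lim]])
      have "\<bar>Re (cinner (F n x) y)\<bar> \<le> norm x * norm y * C" for n
      proof -
        have "\<bar>Re (cinner (F n x) y)\<bar> \<le> norm (F n x) * norm y"
          using abs_Re_le_cmod cinner_Cauchy_Schwarz order_trans by blast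
        also have "\<dots> \<le> (norm (F n) * norm x) * norm y"
          by (intro mult_right_mono norm_blinfun) simp
        also have "\<dots> \<le> (C * norm x) * norm y"
          using sa_norm_le [OF F C(1) C(2)] by (intro mult_right_mono) auto
        finally show ?thesis by (simp add: mult_ac)
      qed
      then show "\<exists>N. \<forall>n\<ge>N. \<bar>Re (cinner (F n x) y)\<bar> \<le> norm x * norm y * C" by blast
    qed
    then show ?case by auto
  qed
  moreover have "\<Phi> (\<i> *\<^sub>C x) (\<i> *\<^sub>C y) = \<Phi> x y" for x y
    unfolding \<Phi>_def by (simp add: F_i cinner_scaleC_left cinner_scaleC_right)
  ultimately obtain G where G: "bounded_op G" "\<And>x y. \<Phi> x y = Re (cinner x (G y))"
    using bounded_form_operator by blast
  have lim': "(\<lambda>n. cinner (F n x) y) \<longlonglongrightarrow> cinner x (G y)" for x y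
  proof -
    have "(\<lambda>n. complex_of_real (Re (cinner (F n x) y)) - \<i> * complex_of_real (Re (cinner (F n (\<i> *\<^sub>C x)) y)))
        \<longlonglongrightarrow> complex_of_real (\<Phi> x y) - \<i> * complex_of_real (\<Phi> (\<i> *\<^sub>C x) y)"
      by (intro tendsto_intros lim)
    then show ?thesis
      by (simp only: F_i G(2) cinner_scaleC_imaginary [symmetric])
  qed
  have "cinner (G x) y = cinner x (G y)" for x y
  proof (rule LIMSEQ_unique [OF _ lim'])
    have "(\<lambda>n. cnj (cinner (F n y) x)) \<longlonglongrightarrow> cnj (cinner y (G x))"
      by (intro tendsto_cnj lim')
    then show "(\<lambda>n. cinner (F n x) y) \<longlonglongrightarrow> cinner (G x) y"
      by (simp add: cinner_commute [symmetric] sa_cinner [OF F])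
  qed
  then show ?thesis using that [of G] G(1) lim' by (simp add: sa_def)
qed

subsection \<open>Bounded Borel functions as iterated limits of polynomials\<close>

definition clip :: "real \<Rightarrow> real \<Rightarrow> real" where "clip r t = max 0 (min r t)"

text \<open>Clipping to \<open>[0, r]\<close> makes every member of \<open>bclass r\<close> a bounded function on the whole line.\<close>

inductive bclass :: "real \<Rightarrow> (real \<Rightarrow> real) \<Rightarrow> bool" for r where
  poly: "bclass r (\<lambda>t. poly p (clip r t))"
| lim: "(\<And>n. bclass r (f n)) \<Longrightarrow> (\<And>n t. \<bar>f n t\<bar> \<le> C) \<Longrightarrow> (\<And>t. (\<lambda>n. f n t) \<longlonglongrightarrow> g t) \<Longrightarrow> bclass r g"

lemma clip_bounds: "0 < r \<Longrightarrow> 0 \<le> clip r t \<and> clip r t \<le> r"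
  by (auto simp: clip_def)
lemma clip_id: "t \<in> {0..r} \<Longrightarrow> clip r t = t"
  by (auto simp: clip_def)
lemma continuous_clip [continuous_intros]: "continuous_on S (clip r)"
  unfolding clip_def by (intro continuous_intros)
lemma clip_measurable [measurable]: "clip r \<in> borel_measurable borel"
  by (intro borel_measurable_continuous_onI continuous_clip)
lemma poly_measurable [measurable]: "poly p \<in> borel_measurable borel" for p :: "real poly"
  by (intro borel_measurable_continuous_onI continuous_intros)
lemma bclass_measurable: "bclass r f \<Longrightarrow> f \<in> borel_measurable borel"
proof (induction rule: bclass.induct)
  case (lim f C g)
  show ?case by (rule borel_measurable_LIMSEQ_real [where u = f]) (rule lim(3), rule lim(4))
qed measurable

lemma bclass_bounded: 
  assumes r: "0 < r" and f: "bclass r f"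
  shows "\<exists>C. (\<forall>t. \<bar>f t\<bar> \<le> C) \<and> 0 \<le> C"
proof -
  have "\<exists>C. \<forall>t. \<bar>f t\<bar> \<le> C"
    using f
  proof (induction rule: bclass.induct)
    case (poly p)
    have "compact (poly p ` {0..r})"
      by (intro compact_continuous_image continuous_intros compact_Icc)
    then obtain C where "\<forall>y\<in>poly p ` {0..r}. norm y \<le> C"
      using compact_imp_bounded [of "poly p ` {0..r}"] unfolding bounded_iff by blast
    then have "\<forall>t\<in>{0..r}. \<bar>poly p t\<bar> \<le> C" by simp
    then show ?case using clip_bounds [OF r] by (intro exI [of _ C]) auto
  next
    case (lim f C g)
    have "\<bar>g t\<bar> \<le> C" for t
      using lim(2) by (intro LIMSEQ_le_const2 [OF tendsto_rabs [OF lim(3)]]) auto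
    then show ?case by blast
  qed
  then obtain C where "\<forall>t. \<bar>f t\<bar> \<le> C" by blast
  moreover from this have "0 \<le> C" by (meson abs_ge_zero order_trans)
  ultimately show ?thesis by blast
qed

lemma bclass_const: "bclass r (\<lambda>t. a)"
  using bclass.poly [of r "[:a:]"] by simp

text \<open>Induction on one argument at a time: first against a polynomial, then against an
  arbitrary member of the class. \<open>bclass_mult\<close> and \<open>Fc_mult\<close> follow the
  same pattern.\<close>

lemma bclass_add:
  assumes r: "0 < r" and f: "bclass r f" and g: "bclass r g"
  shows "bclass r (\<lambda>t. f t + g t)"
proof -
  have *: "bclass r (\<lambda>t. f t + poly p (clip r t))" for p
    using f
  proof (induction rule: bclass.induct)
    case (poly q)
    show ?case using bclass.poly [of r "q + p"] by simp
  next
    case (lim f C g)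
    obtain D where D: "\<And>t. \<bar>poly p (clip r t)\<bar> \<le> D" using bclass_bounded [OF r bclass.poly] by blast
    have "\<bar>f n t + poly p (clip r t)\<bar> \<le> C + D" for n t
      using lim(2) [of n t] D [of t] by linarith
    then show ?case
      by (rule bclass.lim [of r "\<lambda>n t. f n t + poly p (clip r t)" "C + D", OF lim(4)]) (intro tendsto_intros lim(3))
  qed
  show ?thesis
    using g
  proof (induction rule: bclass.induct)
    case (poly q)
    show ?case by (rule *)
  next
    case (lim h C g)
    obtain D where D: "\<And>t. \<bar>f t\<bar> \<le> D" using bclass_bounded [OF r f] by blast
    have "\<bar>f t + h n t\<bar> \<le> D + C" for n t
      using lim(2) [of n t] D [of t] by linarith
    then show ?case
      by (rule bclass.lim [of r "\<lambda>n t. f t + h n t" "D + C", OF lim(4)]) (intro tendsto_intros lim(3))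
  qed
qed

lemma bclass_mult:
  assumes r: "0 < r" and f: "bclass r f" and g: "bclass r g"
  shows "bclass r (\<lambda>t. f t * g t)"
proof -
  have *: "bclass r (\<lambda>t. f t * poly p (clip r t))" for p
    using f
  proof (induction rule: bclass.induct)
    case (poly q)
    show ?case using bclass.poly [of r "q * p"] by simp
  next
    case (lim f C g)
    obtain D where D: "\<And>t. \<bar>poly p (clip r t)\<bar> \<le> D" "0 \<le> D" using bclass_bounded [OF r bclass.poly] by blast
    have "\<bar>f n t * poly p (clip r t)\<bar> \<le> C * D" for n t
      unfolding abs_mult using lim(2) [of n t] D(1) [of t] D(2) abs_ge_zero [of "f n t"] by (intro mult_mono) auto
    then show ?case
      by (rule bclass.lim [of r "\<lambda>n t. f n t * poly p (clip r t)" "C * D", OF lim(4)]) (intro tendsto_intros lim(3))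
  qed
  show ?thesis
    using g
  proof (induction rule: bclass.induct)
    case (poly q)
    show ?case by (rule *)
  next
    case (lim h C g)
    obtain D where D: "\<And>t. \<bar>f t\<bar> \<le> D" "0 \<le> D" using bclass_bounded [OF r f] by blast
    have "\<bar>f t * h n t\<bar> \<le> D * C" for n t
      unfolding abs_mult using lim(2) [of n t] D(1) [of t] D(2) by (intro mult_mono) auto
    then show ?case
      by (rule bclass.lim [of r "\<lambda>n t. f t * h n t" "D * C", OF lim(4)]) (intro tendsto_intros lim(3))
  qed
qed

lemma bclass_cmult: "0 < r \<Longrightarrow> bclass r f \<Longrightarrow> bclass r (\<lambda>t. a * f t)"
  using bclass_mult [OF _ bclass_const] .

lemma bclass_diff: "0 < r \<Longrightarrow> bclass r f \<Longrightarrow> bclass r g \<Longrightarrow> bclass r (\<lambda>t. f t - g t)"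
  using bclass_add [of r f "\<lambda>t. -1 * g t"] bclass_cmult [of r g "-1"] by simp

lemma bclass_sum:
  assumes "0 < r" "finite I" "\<And>i. i \<in> I \<Longrightarrow> bclass r (f i)"
  shows "bclass r (\<lambda>t. \<Sum>i\<in>I. f i t)"
  using assms(2,3) assms(1) by (induction I rule: finite_induct) (auto intro: bclass_const bclass_add)

lemma Weierstrass_poly:
  fixes f :: "real \<Rightarrow> real"
  assumes "continuous_on {a..b} f" "0 < e"
  obtains p where "\<And>t. t \<in> {a..b} \<Longrightarrow> \<bar>f t - poly p t\<bar> < e"
proof -
  obtain g where g: "real_polynomial_function g" "\<And>t. t \<in> {a..b} \<Longrightarrow> \<bar>f t - g t\<bar> < e"
    using Stone_Weierstrass_real_polynomial_function [of "{a..b}" f e] assms by auto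
  then obtain c n where "g = (\<lambda>x. \<Sum>i\<le>n. c i * x ^ i)"
    by (auto simp: real_polynomial_function_iff_sum)
  then have "g = poly (\<Sum>i\<le>n. monom (c i) i)"
    by (auto simp: poly_sum poly_monom)
  with g that show ?thesis by metis
qed

lemma bclass_continuous:
  assumes r: "0 < r" and f: "continuous_on {0..r} f"
  shows "bclass r (\<lambda>t. f (clip r t))"
proof -
  have "\<exists>p. \<forall>t\<in>{0..r}. \<bar>f t - poly p t\<bar> < 1 / Suc n" for n
    by (rule Weierstrass_poly [OF f, of "1 / Suc n"]) (simp, blast)
  then obtain p where p: "\<And>n t. t \<in> {0..r} \<Longrightarrow> \<bar>f t - poly (p n) t\<bar> < 1 / Suc n" by metis
  have cl: "clip r t \<in> {0..r}" for t using clip_bounds [OF r] by auto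
  have "compact (f ` {0..r})"
    by (intro compact_continuous_image f compact_Icc)
  then obtain C where "\<forall>y\<in>f ` {0..r}. norm y \<le> C"
    using compact_imp_bounded [of "f ` {0..r}"] unfolding bounded_iff by blast
  then have C: "\<bar>f t\<bar> \<le> C" if "t \<in> {0..r}" for t using that by simp
  show ?thesis
  proof (rule bclass.lim [of r "\<lambda>n t. poly (p n) (clip r t)" "C + 1"])
    show "bclass r (\<lambda>t. poly (p n) (clip r t))" for n by (rule bclass.poly)
    show "\<bar>poly (p n) (clip r t)\<bar> \<le> C + 1" for n t
    proof -
      have "1 / real (Suc n) \<le> 1" by simp
      then show ?thesis using p [OF cl, of t n] C [OF cl, of t] by linarith
    qed
    show "(\<lambda>n. poly (p n) (clip r t)) \<longlonglongrightarrow> f (clip r t)" for t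
    proof (rule LIM_zero_cancel, rule Lim_null_comparison [OF _ LIMSEQ_inverse_real_of_nat])
      show "\<forall>\<^sub>F n in sequentially. norm (poly (p n) (clip r t) - f (clip r t)) \<le> inverse (real (Suc n))"
        using p [OF cl, of t] by (intro always_eventually allI)
          (simp add: abs_minus_commute inverse_eq_divide less_imp_le del: of_nat_Suc)
    qed
  qed
qed

lemma ramp_indicator:
  fixes t a :: real
  shows "(\<lambda>n. max 0 (min 1 (1 - real n * (t - a)))) \<longlonglongrightarrow> indicator {..a} t"
proof (cases "t \<le> a")
  case True
  then have "max 0 (min 1 (1 - real n * (t - a))) = 1" for n
    by (auto simp: mult_nonneg_nonpos)
  then show ?thesis using True by simp
next
  case False
  then obtain m :: nat where m: "1 / (t - a) < real m" using reals_Archimedean2 by blast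
  have "max 0 (min 1 (1 - real n * (t - a))) = 0" if "n \<ge> m" for n
  proof -
    have "1 < real m * (t - a)" using m False by (simp add: field_simps)
    also have "\<dots> \<le> real n * (t - a)" using that False by (intro mult_right_mono) auto
    finally show ?thesis by simp
  qed
  then have "eventually (\<lambda>n. max 0 (min 1 (1 - real n * (t - a))) = 0) sequentially"
    by (auto simp: eventually_sequentially)
  then show ?thesis using False by (simp add: tendsto_eventually)
qed

text \<open>The half-lines generate the Borel sets and are closed under intersection, so a
  Dynkin-class induction suffices; the half-lines themselves are limits of continuous ramps.\<close>

lemma bclass_indicator:
  assumes r: "0 < r" and S: "S \<in> sets borel"
  shows "bclass r (\<lambda>t. indicator S (clip r t))"
proof -
  have "Int_stable (range (\<lambda>a::real. {..a}))"
    by (auto simp: Int_stable_def)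
  moreover have "range (\<lambda>a::real. {..a}) \<subseteq> Pow UNIV" by simp
  moreover have "S \<in> sigma_sets UNIV (range (\<lambda>a::real. {..a}))"
    using S by (simp add: borel_eq_atMost)
  ultimately show ?thesis
  proof (induction S rule: sigma_sets_induct_disjoint)
    case (basic A)
    then obtain a where A: "A = {..a}" by auto
    show ?case
      unfolding A
    proof (rule bclass.lim [of r "\<lambda>n t. max 0 (min 1 (1 - real n * (clip r t - a)))" 1])
      show "bclass r (\<lambda>t. max 0 (min 1 (1 - real n * (clip r t - a))))" for n
        by (rule bclass_continuous [OF r]) (intro continuous_intros)
    qed (auto intro: ramp_indicator)
  next
    case (compl A)
    have "bclass r (\<lambda>t. 1 - indicator A (clip r t))"
      by (intro bclass_diff r bclass_const compl)
    then show ?case by (simp add: indicator_diff)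
  next
    case (union A)
    have eq: "(\<Sum>i<n. indicator (A i) t) = (indicator (\<Union>i<n. A i) t :: real)" for n t
      using union(1) by (subst indicator_UN_disjoint) (auto intro: disjoint_family_on_mono)
    show ?case
    proof (rule bclass.lim [of r "\<lambda>n t. \<Sum>i<n. indicator (A i) (clip r t)" 1])
      show "bclass r (\<lambda>t. \<Sum>i<n. indicator (A i) (clip r t))" for n
        by (intro bclass_sum r union) auto
      show "(\<lambda>n. \<Sum>i<n. indicator (A i) (clip r t) :: real) \<longlonglongrightarrow> indicator (\<Union> (range A)) (clip r t)" for t
      proof -
        have "(\<lambda>n. indicator (\<Union>i<n. A i) (clip r t) :: real) \<longlonglongrightarrow> indicator (\<Union> (range A)) (clip r t)"
          by (rule LIMSEQ_indicator_UN)
        then show ?thesis by (simp only: eq)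
      qed
    qed (auto simp: eq)
  qed (auto intro: bclass_const)
qed

subsection \<open>Borel functional calculus of a positive operator\<close>

text \<open>\<open>r\<close> is any upper bound rather than the norm, so that an estimate of the
  quadratic form is enough to enter the locale.\<close>

locale positive_bounded =
  fixes T :: "'h::chilbert_space op" and r :: real
  assumes r: "0 < r" and T: "positive_op T" and Tr: "positive_op (r *\<^sub>R id_blinfun - T)"
begin

lemma saT: "sa T" using T by (rule positive_op_sa)

text \<open>Dividing by the squared norm makes the moment functional take the value 1 at the
  constant 1, as \<open>Hausdorff_moment\<close> requires; the factor reappears on the left. At x =
  0, where this is impossible, evaluation at 0 supplies a law.\<close>

lemma vector_measure_exists:
  "\<exists>M. real_distribution M \<and> (AE t in M. t \<in> {0..r}) \<and>
    (\<forall>p. (norm x)\<^sup>2 * (\<integral>t. poly p t \<partial>M) = Re (cinner (op_poly p T x) x))"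
proof (cases "x = 0")
  case True
  obtain M where "real_distribution M" "AE t in M. t \<in> {0..r}" "\<And>p. (\<integral>t. poly p t \<partial>M) = poly p 0"
    by (rule Hausdorff_moment [OF r, of "\<lambda>p. poly p 0"]) (use r in auto)
  then show ?thesis using True by (auto simp: cinner.zero_left)
next
  case False
  define L where "L p = Re (cinner (op_poly p T x) x) / (norm x)\<^sup>2" for p
  obtain M where "real_distribution M" "AE t in M. t \<in> {0..r}" "\<And>p. (\<integral>t. poly p t \<partial>M) = L p"
  proof (rule Hausdorff_moment [OF r, of L])
    show "0 \<le> L ([:0, 1:] ^ k * [:r, - 1:] ^ m)" for k m
      unfolding L_def using op_poly_Bernstein_positive [OF r T Tr]
      by (intro divide_nonneg_nonneg positive_op_Re) auto
    show "L 1 = 1" using False by (simp add: L_def Re_cinner_self)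
  qed (auto simp: L_def blinfun.add_left blinfun.scaleR_left cinner.add_left cinner.scaleR_left add_divide_distrib)
  then show ?thesis using False by (auto simp: L_def)
qed

definition N :: "'h \<Rightarrow> real measure" where
  "N x = (SOME M. real_distribution M \<and> (AE t in M. t \<in> {0..r}) \<and>
    (\<forall>p. (norm x)\<^sup>2 * (\<integral>t. poly p t \<partial>M) = Re (cinner (op_poly p T x) x)))"

lemma N: "real_distribution (N x)" "AE t in N x. t \<in> {0..r}"
  "(norm x)\<^sup>2 * (\<integral>t. poly p t \<partial>N x) = Re (cinner (op_poly p T x) x)"
  unfolding N_def using someI_ex [OF vector_measure_exists [of x]] by blast+

sublocale N: real_distribution "N x" for x by (rule N)

lemma N_clip:
  fixes f :: "real \<Rightarrow> real"
  assumes [measurable]: "f \<in> borel_measurable borel"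
  shows "(\<integral>t. f (clip r t) \<partial>N x) = (\<integral>t. f t \<partial>N x)"
proof (rule integral_cong_AE)
  show "AE t in N x. f (clip r t) = f t"
    using N(2) [of x] by (rule eventually_mono) (simp add: clip_id)
qed simp_all

lemma N_UNIV [simp]: "measure (N x) UNIV = 1"
  using N.prob_space [of x] by simp

lemma N_integrable:
  assumes f: "bclass r f" shows "integrable (N x) f"
proof -
  obtain C where "\<forall>t. \<bar>f t\<bar> \<le> C" using bclass_bounded [OF r f] by blast
  then show ?thesis
    using bclass_measurable [OF f] by (intro N.integrable_const_bound [of _ C]) auto
qed

lemma N_integral_le:
  assumes f: "bclass r f" and C: "\<And>t. \<bar>f t\<bar> \<le> C"
  shows "\<bar>\<integral>t. f t \<partial>N x\<bar> \<le> C"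
proof -
  have "\<bar>\<integral>t. f t \<partial>N x\<bar> \<le> (\<integral>t. \<bar>f t\<bar> \<partial>N x)"
    using integral_abs_bound by blast
  also have "\<dots> \<le> (\<integral>t. C \<partial>N x)"
    using N_integrable [OF f] by (intro integral_mono) (auto simp: C)
  finally show ?thesis by simp
qed

text \<open>\<open>F\<close> stands for f(T), described by its quadratic form. As a relation it can
  be propagated through the induction on \<open>bclass\<close> before \<open>Fc\<close>
  exists.\<close>

definition rep :: "(real \<Rightarrow> real) \<Rightarrow> 'h op \<Rightarrow> bool" where
  "rep f F \<longleftrightarrow> bounded_op F \<and> (\<forall>x. cinner (F x) x = complex_of_real ((norm x)\<^sup>2 * (\<integral>t. f t \<partial>N x)))"

lemma rep_unique: "rep f F \<Longrightarrow> rep f G \<Longrightarrow> F = G"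
  by (auto simp: rep_def intro: bounded_op_ext)

lemma rep_sa: "rep f F \<Longrightarrow> sa F"
  by (auto simp: rep_def intro!: saI)

lemma rep_poly: "rep (\<lambda>t. poly p (clip r t)) (op_poly p T)"
proof -
  have p: "poly p \<in> borel_measurable borel"
    by (intro borel_measurable_continuous_onI continuous_intros)
  have "sa (op_poly p T)" by (intro bop saT)
  then show ?thesis
    unfolding rep_def N_clip [OF p] N(3) using sa_bounded_op sa_of_real by blast
qed

text \<open>Dominated convergence under every \<open>N x\<close> is convergence of the quadratic
  forms, and \<open>weak_limit_exists\<close> turns this into an operator.\<close>

lemma rep_lim:
  assumes F: "\<And>n. rep (f n) (F n)" and f: "\<And>n. bclass r (f n)" and C: "\<And>n t. \<bar>f n t\<bar> \<le> C"
    and lim: "\<And>t. (\<lambda>n. f n t) \<longlonglongrightarrow> g t"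
  obtains G where "rep g G" "\<And>x y. (\<lambda>n. cinner (F n x) y) \<longlonglongrightarrow> cinner (G x) y"
proof -
  have [measurable]: "f n \<in> borel_measurable borel" for n using f by (rule bclass_measurable)
  have [measurable]: "g \<in> borel_measurable borel"
    by (rule bclass_measurable, rule bclass.lim [OF f C lim])
  have C0: "0 \<le> C" using C [of 0 0] by linarith
  have conv: "(\<lambda>n. (norm x)\<^sup>2 * (\<integral>t. f n t \<partial>N x)) \<longlonglongrightarrow> (norm x)\<^sup>2 * (\<integral>t. g t \<partial>N x)" for x
    by (intro tendsto_mult_left integral_dominated_convergence [where w = "\<lambda>_. C"]) (auto simp: lim C)
  have Re: "Re (cinner (F n x) x) = (norm x)\<^sup>2 * (\<integral>t. f n t \<partial>N x)" for n x
    using F [of n] by (simp add: rep_def del: of_real_mult)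
  obtain G where G: "sa G" "\<And>x y. (\<lambda>n. cinner (F n x) y) \<longlonglongrightarrow> cinner (G x) y"
  proof (rule weak_limit_exists [of F C])
    show "convergent (\<lambda>n. Re (cinner (F n x) x))" for x
      unfolding Re using conv convergentI by blast
    fix n x
    have "(norm x)\<^sup>2 * \<bar>\<integral>t. f n t \<partial>N x\<bar> \<le> (norm x)\<^sup>2 * C"
      by (rule mult_left_mono [OF N_integral_le [OF f C]]) simp
    then show "\<bar>Re (cinner (F n x) x)\<bar> \<le> C * (norm x)\<^sup>2"
      unfolding Re abs_mult by (simp add: mult.commute [of C])
  qed (use F rep_sa C0 in auto)
  have "cinner (G x) x = complex_of_real ((norm x)\<^sup>2 * (\<integral>t. g t \<partial>N x))" for x
  proof (rule LIMSEQ_unique [OF G(2)])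
    show "(\<lambda>n. cinner (F n x) x) \<longlonglongrightarrow> complex_of_real ((norm x)\<^sup>2 * (\<integral>t. g t \<partial>N x))"
      using tendsto_of_real [OF conv, of x] F by (simp add: rep_def del: of_real_mult)
  qed
  then have "rep g G" using G by (simp add: rep_def sa_bounded_op)
  with G that show ?thesis by blast
qed

lemma rep_exists: "bclass r f \<Longrightarrow> \<exists>F. rep f F"
proof (induction rule: bclass.induct)
  case (poly p)
  show ?case using rep_poly by blast
next
  case (lim f C g)
  then obtain F where F: "\<And>n. rep (f n) (F n)" by metis
  show ?case by (rule rep_lim [of f F C g, OF F lim(1) lim(2) lim(3)]) blast
qed

text \<open>The functional calculus f(T), meaningful for f in \<open>bclass r\<close>.\<close>

definition Fc :: "(real \<Rightarrow> real) \<Rightarrow> 'h op" where "Fc f = (THE F. rep f F)"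

lemma rep_Fc: "bclass r f \<Longrightarrow> rep f (Fc f)"
  unfolding Fc_def using rep_exists [of f] rep_unique [of f] theI [of "rep f"] by blast

lemma Fc_eqI: "rep f F \<Longrightarrow> Fc f = F"
  unfolding Fc_def using rep_unique by blast

lemma Fc_sa: "bclass r f \<Longrightarrow> sa (Fc f)"
  using rep_Fc rep_sa by blast

lemma Fc_cinner: "bclass r f \<Longrightarrow> cinner (Fc f x) x = complex_of_real ((norm x)\<^sup>2 * (\<integral>t. f t \<partial>N x))"
  using rep_Fc by (simp add: rep_def)

lemma Fc_poly: "Fc (\<lambda>t. poly p (clip r t)) = op_poly p T"
  using Fc_eqI rep_poly by blast

lemma Fc_lim:
  assumes f: "\<And>n. bclass r (f n)" and C: "\<And>n t. \<bar>f n t\<bar> \<le> C" and lim: "\<And>t. (\<lambda>n. f n t) \<longlonglongrightarrow> g t"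
  shows "(\<lambda>n. cinner (Fc (f n) x) y) \<longlonglongrightarrow> cinner (Fc g x) y"
proof (rule rep_lim [of f "\<lambda>n. Fc (f n)" C g, OF rep_Fc [OF f] f C lim])
  fix G assume "rep g G" "\<And>x y. (\<lambda>n. cinner (Fc (f n) x) y) \<longlonglongrightarrow> cinner (G x) y"
  then show ?thesis using Fc_eqI [of g G] by simp
qed

lemma Fc_add: "bclass r f \<Longrightarrow> bclass r g \<Longrightarrow> Fc (\<lambda>t. f t + g t) = Fc f + Fc g"
  by (rule Fc_eqI) (auto simp: rep_def Fc_cinner blinfun.add_left cinner.add_left N_integrable
      algebra_simps intro!: bop sa_bounded_op Fc_sa)

lemma Fc_const: "Fc (\<lambda>t. a) = a *\<^sub>R id_blinfun"
  using Fc_poly [of "[:a:]"] by simp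

lemma Fc_diff: "bclass r f \<Longrightarrow> bclass r g \<Longrightarrow> Fc (\<lambda>t. f t - g t) = Fc f - Fc g"
  by (rule Fc_eqI) (auto simp: rep_def Fc_cinner blinfun.diff_left cinner.diff_left N_integrable
      algebra_simps intro!: bop sa_bounded_op Fc_sa)

lemma Fc_commute:
  assumes C: "bounded_op C" "C o\<^sub>L T = T o\<^sub>L C" and f: "bclass r f"
  shows "C o\<^sub>L Fc f = Fc f o\<^sub>L C"
  using f
proof (induction rule: bclass.induct)
  case (poly p)
  show ?case unfolding Fc_poly using C(2) by (rule op_poly_commute)
next
  case (lim f D g)
  have "cinner (C (Fc g x)) y = cinner (Fc g (C x)) y" for x y
  proof (rule LIMSEQ_unique)
    \<comment> \<open>The weak limit is available for \<open>Fc (f n)\<close> alone, so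
      \<open>C\<close> is first moved to the other slot as its adjoint.\<close>
    have "(\<lambda>n. cinner (Fc (f n) x) (adj C y)) \<longlonglongrightarrow> cinner (Fc g x) (adj C y)"
      by (rule Fc_lim [OF lim(1-3)])
    then have "(\<lambda>n. cinner ((C o\<^sub>L Fc (f n)) x) y) \<longlonglongrightarrow> cinner (C (Fc g x)) y"
      by (simp add: cinner_adj C)
    then show "(\<lambda>n. cinner (Fc (f n) (C x)) y) \<longlonglongrightarrow> cinner (C (Fc g x)) y"
      unfolding lim(4) by simp
    show "(\<lambda>n. cinner (Fc (f n) (C x)) y) \<longlonglongrightarrow> cinner (Fc g (C x)) y"
      by (rule Fc_lim [OF lim(1-3)])
  qed
  then show ?case by (intro blinfun_eqI cinner_ext) simp
qed

text \<open>Composition is not jointly continuous for weak limits, so each limit involves one factor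
  only. In the first induction the polynomial acts on the vector beforehand; in the second,
  self-adjointness moves the fixed \<open>Fc f\<close> across the inner product.\<close>

lemma Fc_mult:
  assumes f: "bclass r f" and g: "bclass r g"
  shows "Fc (\<lambda>t. f t * g t) = Fc f o\<^sub>L Fc g"
proof -
  have *: "Fc (\<lambda>t. f t * poly p (clip r t)) = Fc f o\<^sub>L op_poly p T" if "bclass r f" for f p
    using that
  proof (induction rule: bclass.induct)
    case (poly q)
    show ?case using Fc_poly [of "q * p"] by (simp add: Fc_poly)
  next
    case (lim f C g)
    obtain D where D: "\<And>t. \<bar>poly p (clip r t)\<bar> \<le> D" "0 \<le> D" using bclass_bounded [OF r bclass.poly] by blast
    have B: "\<bar>f n t * poly p (clip r t)\<bar> \<le> C * D" for n t
      unfolding abs_mult using lim(2) [of n t] D(1) [of t] D(2) abs_ge_zero [of "f n t"] by (intro mult_mono) auto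
    have "cinner (Fc (\<lambda>t. g t * poly p (clip r t)) x) y = cinner (Fc g (op_poly p T x)) y" for x y
    proof (rule LIMSEQ_unique)
      show "(\<lambda>n. cinner (Fc (\<lambda>t. f n t * poly p (clip r t)) x) y) \<longlonglongrightarrow> cinner (Fc (\<lambda>t. g t * poly p (clip r t)) x) y"
        by (intro Fc_lim [OF _ B] bclass_mult r lim tendsto_intros bclass.poly)
      show "(\<lambda>n. cinner (Fc (\<lambda>t. f n t * poly p (clip r t)) x) y) \<longlonglongrightarrow> cinner (Fc g (op_poly p T x)) y"
        unfolding lim(4) by (simp add: Fc_lim [OF lim(1-3)])
    qed
    then show ?case by (intro blinfun_eqI cinner_ext) simp
  qed
  show ?thesis
    using g
  proof (induction rule: bclass.induct)
    case (poly q)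
    show ?case using * [OF f] by (simp add: Fc_poly)
  next
    case (lim h C g)
    obtain D where D: "\<And>t. \<bar>f t\<bar> \<le> D" "0 \<le> D" using bclass_bounded [OF r f] by blast
    have B: "\<bar>f t * h n t\<bar> \<le> D * C" for n t
      unfolding abs_mult using lim(2) [of n t] D(1) [of t] D(2) by (intro mult_mono) auto
    have "cinner (Fc (\<lambda>t. f t * g t) x) y = cinner (Fc f (Fc g x)) y" for x y
    proof (rule LIMSEQ_unique)
      show "(\<lambda>n. cinner (Fc (\<lambda>t. f t * h n t) x) y) \<longlonglongrightarrow> cinner (Fc (\<lambda>t. f t * g t) x) y"
        by (intro Fc_lim [OF _ B] bclass_mult r lim tendsto_intros f)
      show "(\<lambda>n. cinner (Fc (\<lambda>t. f t * h n t) x) y) \<longlonglongrightarrow> cinner (Fc f (Fc g x)) y"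
        unfolding lim(4) using Fc_lim [OF lim(1-3), of x "Fc f y"] by (simp add: sa_cinner [OF Fc_sa [OF f]])
    qed
    then show ?case by (intro blinfun_eqI cinner_ext) simp
  qed
qed

lemma Fc_positive:
  assumes f: "bclass r f" and pos: "\<And>t. 0 \<le> f t"
  shows "positive_op (Fc f)"
  using f pos by (auto simp: positive_op_iff Fc_sa Fc_cinner simp del: of_real_mult)

lemma Fc_norm_le:
  assumes f: "bclass r f" and C: "\<And>t. \<bar>f t\<bar> \<le> C"
  shows "norm (Fc f) \<le> C"
proof (rule sa_norm_le [OF Fc_sa [OF f]])
  show "0 \<le> C" using C [of 0] by linarith
  fix x
  have "(norm x)\<^sup>2 * \<bar>\<integral>t. f t \<partial>N x\<bar> \<le> (norm x)\<^sup>2 * C"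
    by (rule mult_left_mono [OF N_integral_le [OF f C]]) simp
  then show "\<bar>Re (cinner (Fc f x) x)\<bar> \<le> C * (norm x)\<^sup>2"
    by (simp add: Fc_cinner f abs_mult mult.commute [of C] del: of_real_mult)
qed

text \<open>For continuous functions the approximation holds in norm and not just weakly, which is
  the convergence that the trace respects.\<close>

lemma Fc_continuous_limit:
  assumes f: "continuous_on {0..r} f" and p: "\<And>n t. t \<in> {0..r} \<Longrightarrow> \<bar>f t - poly (p n) t\<bar> \<le> e n" and e: "e \<longlonglongrightarrow> 0"
  shows "(\<lambda>n. op_poly (p n) T) \<longlonglongrightarrow> Fc (\<lambda>t. f (clip r t))"
proof (rule LIM_zero_cancel, rule Lim_null_comparison [OF _ e], rule always_eventually, rule allI)
  fix n
  have bf: "bclass r (\<lambda>t. f (clip r t))" by (rule bclass_continuous [OF r f])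
  have "norm (Fc (\<lambda>t. poly (p n) (clip r t) - f (clip r t))) \<le> e n"
    using p clip_bounds [OF r] by (intro Fc_norm_le bclass_diff r bclass.poly bf) (auto simp: abs_minus_commute)
  then show "norm (op_poly (p n) T - Fc (\<lambda>t. f (clip r t))) \<le> e n"
    by (simp add: Fc_diff bf bclass.poly Fc_poly)
qed

end

lemma positive_boundedI:
  assumes "positive_op T" "norm T \<le> r" "0 < r"
  shows "positive_bounded T r"
  using assms by unfold_locales (auto intro: norm_id_diff_positive positive_op_sa)

subsection \<open>Square roots\<close>

text \<open>The commutation clause serves twice: for the uniqueness of square roots and for their
  membership in a von Neumann algebra.\<close>

lemma square_root_exists:
  assumes T: "positive_op T"
  obtains S where "positive_op S" "S o\<^sub>L S = T"
    "\<And>C. bounded_op C \<Longrightarrow> C o\<^sub>L T = T o\<^sub>L C \<Longrightarrow> C o\<^sub>L S = S o\<^sub>L C"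
proof -
  \<comment> \<open>The bound has to be positive even for T = 0.\<close>
  interpret positive_bounded T "norm T + 1"
    using T by (intro positive_boundedI) (auto simp: add_nonneg_pos)
  let ?r = "norm T + 1"
  let ?f = "\<lambda>t. sqrt (clip ?r t)"
  have b: "bclass ?r ?f" by (intro bclass_continuous r continuous_intros)
  show ?thesis
  proof
    show "positive_op (Fc ?f)" by (rule Fc_positive [OF b]) (use clip_bounds [OF r] in auto)
    have "Fc ?f o\<^sub>L Fc ?f = Fc (\<lambda>t. poly [:0, 1:] (clip ?r t))"
      unfolding Fc_mult [OF b b, symmetric] using clip_bounds [OF r] by (simp add: real_sqrt_mult_self)
    then show "Fc ?f o\<^sub>L Fc ?f = T" unfolding Fc_poly by simp
  qed (use Fc_commute b in blast)
qed

lemma sa_compose_self_0: 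
  assumes "sa V" "V o\<^sub>L V = 0"
  shows "V = 0"
proof (rule blinfun_eqI)
  fix x
  have "(norm (V x))\<^sup>2 = Re (cinner ((V o\<^sub>L V) x) x)"
    by (simp add: Re_cinner_self [symmetric] sa_cinner [OF assms(1)])
  then show "blinfun_apply V x = blinfun_apply 0 x" by (simp add: assms(2) cinner.zero_left)
qed

text \<open>With V = P - S, commutation gives (P + S) V = 0. On the range of V the forms of P and S
  are nonnegative with sum 0, so both operators vanish there and V composed with itself is
  0.\<close>

lemma commuting_square_root_unique:
  assumes P: "positive_op P" and S: "positive_op S" and sq: "P o\<^sub>L P = S o\<^sub>L S" and comm: "P o\<^sub>L S = S o\<^sub>L P"
  shows "P = S"
proof -
  define V where "V = P - S"
  have V: "sa V" unfolding V_def by (intro bop positive_op_sa P S)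
  have VV: "V (V x) = 0" for x
  proof -
    have PS: "(P + S) o\<^sub>L (P - S) = 0"
      by (simp add: compose.add_left compose.diff_right sq comm)
    have "P (V x) + S (V x) = ((P + S) o\<^sub>L (P - S)) x"
      by (simp add: V_def blinfun.add_left)
    then have sum0: "P (V x) + S (V x) = 0" by (simp add: PS)
    have "Re (cinner (P (V x)) (V x)) + Re (cinner (S (V x)) (V x)) = 0"
      unfolding plus_complex.sel(1) [symmetric] cinner.add_left [symmetric] sum0
      by (simp add: cinner.zero_left)
    then have "Re (cinner (P (V x)) (V x)) = 0" "Re (cinner (S (V x)) (V x)) = 0"
      using positive_op_Re [OF P, of "V x"] positive_op_Re [OF S, of "V x"] by auto
    then have "P (V x) = 0" "S (V x) = 0"
      using P S positive_op_zeroD by blast+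
    then show ?thesis by (simp add: V_def blinfun.diff_left)
  qed
  then have "V o\<^sub>L V = 0" by (intro blinfun_eqI) simp
  then have "V = 0" by (rule sa_compose_self_0 [OF V])
  then show ?thesis by (simp add: V_def)
qed

text \<open>P and Q are not known to commute with each other, but both commute with their common
  square and hence with the root S built from it.\<close>

lemma positive_square_unique:
  assumes P: "positive_op P" and Q: "positive_op Q" and sq: "P o\<^sub>L P = Q o\<^sub>L Q"
  shows "P = Q"
proof -
  obtain S where S: "positive_op S" "S o\<^sub>L S = Q o\<^sub>L Q"
    "\<And>C. bounded_op C \<Longrightarrow> C o\<^sub>L (Q o\<^sub>L Q) = (Q o\<^sub>L Q) o\<^sub>L C \<Longrightarrow> C o\<^sub>L S = S o\<^sub>L C"
    using square_root_exists [OF positive_op_square [OF positive_op_sa [OF Q]]] by blast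
  have "P = S"
  proof (rule commuting_square_root_unique [OF P S(1)])
    show "P o\<^sub>L P = S o\<^sub>L S" using S(2) sq by simp
    show "P o\<^sub>L S = S o\<^sub>L P"
      using P by (intro S(3)) (auto simp: sa_bounded_op positive_op_sa compose_assoc simp flip: sq)
  qed
  moreover have "Q = S"
  proof (rule commuting_square_root_unique [OF Q S(1)])
    show "Q o\<^sub>L S = S o\<^sub>L Q"
      using Q by (intro S(3)) (auto simp: sa_bounded_op positive_op_sa compose_assoc)
  qed (simp add: S(2))
  ultimately show ?thesis by simp
qed

lemma abs_op_positive:
  assumes A: "positive_op A"
  shows "abs_op A = A"
  unfolding abs_op_def
  using A positive_square_unique by (intro the_equality) (auto simp: sa_adj positive_op_sa)

subsection \<open>Invertible operators and the spectrum\<close>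

definition opow :: "'h::chilbert_space op \<Rightarrow> nat \<Rightarrow> 'h op" where
  "opow K n = op_poly (monom 1 n) K"

lemma opow_0 [simp]: "opow K 0 = id_blinfun"
  by (simp add: opow_def)

lemma opow_Suc: "opow K (Suc n) = K o\<^sub>L opow K n"
  by (simp add: opow_def monom_Suc)

lemma opow_commute: "C o\<^sub>L K = K o\<^sub>L C \<Longrightarrow> C o\<^sub>L opow K n = opow K n o\<^sub>L C"
  unfolding opow_def by (rule op_poly_commute)

lemma opow_Suc2: "opow K (Suc n) = opow K n o\<^sub>L K"
  using opow_commute [of K K n] by (simp add: opow_Suc)

lemma norm_opow_le: "norm (opow K n) \<le> norm K ^ n"
proof (induction n)
  case 0
  show ?case by (simp add: norm_blinfun_id_le)
next
  case (Suc n)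
  have "norm (opow K (Suc n)) \<le> norm K * norm (opow K n)"
    unfolding opow_Suc by (rule norm_blinfun_compose)
  also have "\<dots> \<le> norm K * norm K ^ n" by (intro mult_left_mono Suc) simp
  finally show ?case by simp
qed

lemma bounded_op_opow [bop]: "bounded_op K \<Longrightarrow> bounded_op (opow K n)"
  by (induction n) (simp_all add: opow_Suc bop)

lemma bounded_op_limit:
  assumes F: "\<And>n. bounded_op (F n)" and lim: "F \<longlonglongrightarrow> B"
  shows "bounded_op B"
  unfolding bounded_op_def
proof (intro allI)
  fix c x
  have "(\<lambda>n. F n (c *\<^sub>C x)) \<longlonglongrightarrow> B (c *\<^sub>C x)"
    by (intro blinfun.tendsto lim tendsto_const)
  moreover have "(\<lambda>n. c *\<^sub>C F n x) \<longlonglongrightarrow> c *\<^sub>C B x"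
    by (intro scaleC.tendsto blinfun.tendsto lim tendsto_const)
  ultimately show "B (c *\<^sub>C x) = c *\<^sub>C B x"
    using F by (simp add: bounded_op_def LIMSEQ_unique)
qed

lemma Neumann_series:
  fixes K :: "'h::chilbert_space op"
  assumes K: "bounded_op K" "norm K < 1"
  obtains B where "bounded_op B" "(id_blinfun - K) o\<^sub>L B = id_blinfun" "B o\<^sub>L (id_blinfun - K) = id_blinfun"
    "opow K sums B"
proof -
  have "summable (\<lambda>n. norm K ^ n)" using K by (intro summable_geometric) simp
  then have "summable (opow K)"
    by (rule summable_comparison_test') (rule norm_opow_le)
  then obtain B where B: "opow K sums B" by (auto simp: summable_def)
  have "(\<lambda>n. opow K (Suc n)) sums (B - id_blinfun)"
    using B sums_Suc_iff [of "opow K" "B - id_blinfun"] by simp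
  moreover have "(\<lambda>n. opow K (Suc n)) sums (K o\<^sub>L B)"
    unfolding opow_Suc by (rule bounded_linear.sums [OF compose.bounded_linear_right B])
  moreover have "(\<lambda>n. opow K (Suc n)) sums (B o\<^sub>L K)"
    unfolding opow_Suc2 by (rule bounded_linear.sums [OF compose.bounded_linear_left B])
  ultimately have "K o\<^sub>L B = B - id_blinfun" "B o\<^sub>L K = B - id_blinfun"
    using sums_unique2 by blast+
  moreover have "bounded_op B"
  proof (rule bounded_op_limit)
    show "(\<lambda>n. \<Sum>i<n. opow K i) \<longlonglongrightarrow> B" using B by (simp add: sums_def)
    show "bounded_op (\<Sum>i<n. opow K i)" for n
      by (induction n) (auto intro!: bop K)
  qed
  ultimately show ?thesis
    using that [of B] B by (simp add: compose.diff_left compose.diff_right)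
qed

lemma invertible_opI:
  "bounded_op B \<Longrightarrow> A o\<^sub>L B = id_blinfun \<Longrightarrow> B o\<^sub>L A = id_blinfun \<Longrightarrow> invertible_op A"
  by (auto simp: invertible_op_def)

lemma invertible_op_compose:
  assumes "invertible_op A" "invertible_op B"
  shows "invertible_op (A o\<^sub>L B)"
proof -
  obtain A' B' where *: "bounded_op A'" "A o\<^sub>L A' = id_blinfun" "A' o\<^sub>L A = id_blinfun"
    "bounded_op B'" "B o\<^sub>L B' = id_blinfun" "B' o\<^sub>L B = id_blinfun"
    using assms by (auto simp: invertible_op_def)
  show ?thesis
  proof (rule invertible_opI [of "B' o\<^sub>L A'"])
    show "(A o\<^sub>L B) o\<^sub>L (B' o\<^sub>L A') = id_blinfun"
      by (metis *(2,5) compose_assoc compose_id(1))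
    show "(B' o\<^sub>L A') o\<^sub>L (A o\<^sub>L B) = id_blinfun"
      by (metis *(3,6) compose_assoc compose_id(1))
  qed (intro bop *)
qed

lemma invertible_op_perturb:
  fixes A :: "'h::chilbert_space op"
  assumes A: "invertible_op A"
  obtains d where "0 < d" "\<And>D. bounded_op D \<Longrightarrow> norm D < d \<Longrightarrow> invertible_op (A + D)"
proof -
  obtain B where B: "bounded_op B" "A o\<^sub>L B = id_blinfun" "B o\<^sub>L A = id_blinfun"
    using A by (auto simp: invertible_op_def)
  show ?thesis
  proof
    show "0 < 1 / (norm B + 1)" by (simp add: add_nonneg_pos)
    fix D :: "'h op" assume D: "bounded_op D" "norm D < 1 / (norm B + 1)"
    \<comment> \<open>A + D = A (1 - K), and a Neumann series inverts 1 - K.\<close>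
    define K where "K = - (B o\<^sub>L D)"
    have "norm K \<le> norm B * norm D" unfolding K_def norm_minus_cancel by (rule norm_blinfun_compose)
    also have "\<dots> \<le> norm B * (1 / (norm B + 1))" using D by (intro mult_left_mono) auto
    also have "\<dots> < 1" by (simp add: divide_less_eq add_nonneg_pos)
    finally have "norm K < 1" .
    moreover have "bounded_op K" unfolding K_def by (intro bop B D)
    ultimately have "invertible_op (id_blinfun - K)"
      by (meson Neumann_series invertible_opI)
    then have "invertible_op (A o\<^sub>L (id_blinfun - K))"
      by (rule invertible_op_compose [OF A])
    also have "A o\<^sub>L (id_blinfun - K) = A + ((A o\<^sub>L B) o\<^sub>L D)"
      by (simp add: K_def compose.add_right compose_assoc)
    finally show "invertible_op (A + D)" by (simp add: B)
  qed
qed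

lemma real_spectrum_iff:
  fixes T :: "'h::chilbert_space op"
  shows "t \<in> real_spectrum T \<longleftrightarrow> \<not> invertible_op (T - t *\<^sub>R id_blinfun)"
proof -
  have "scaleC_op (complex_of_real t) id_blinfun = t *\<^sub>R (id_blinfun :: 'h op)"
    by (rule blinfun_eqI) (simp add: scaleC_op.rep_eq scaleC_of_real blinfun.scaleR_left)
  then show ?thesis by (simp add: real_spectrum_def spectrum_def)
qed

lemma closed_real_spectrum: "closed (real_spectrum T)"
  unfolding closed_def open_dist
proof (intro ballI)
  fix t assume "t \<in> - real_spectrum T"
  then have "invertible_op (T - t *\<^sub>R id_blinfun)" by (simp add: real_spectrum_iff)
  then obtain d where d: "0 < d" "\<And>D. bounded_op D \<Longrightarrow> norm D < d \<Longrightarrow> invertible_op (T - t *\<^sub>R id_blinfun + D)"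
    using invertible_op_perturb by blast
  have "s \<in> - real_spectrum T" if "dist s t < d" for s
  proof -
    have "norm ((t - s) *\<^sub>R (id_blinfun :: 'a op)) \<le> \<bar>t - s\<bar> * 1"
      unfolding norm_scaleR by (intro mult_left_mono norm_blinfun_id_le) simp
    then have "invertible_op (T - t *\<^sub>R id_blinfun + (t - s) *\<^sub>R id_blinfun)"
      using that by (intro d bop) (auto simp: dist_real_def)
    moreover have "T - t *\<^sub>R id_blinfun + (t - s) *\<^sub>R id_blinfun = T - s *\<^sub>R id_blinfun"
      by (simp add: scaleR_diff_left)
    ultimately show ?thesis by (simp add: real_spectrum_iff)
  qed
  then show "\<exists>e>0. \<forall>s. dist s t < e \<longrightarrow> s \<in> - real_spectrum T" using d by blast
qed

lemma real_spectrum_borel [measurable]: "real_spectrum T \<in> sets borel"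
  by (rule borel_closed [OF closed_real_spectrum])

subsection \<open>Projection-valued measures\<close>

locale pvm =
  fixes E :: "real set \<Rightarrow> 'h::chilbert_space op"
  assumes pvm: "projection_valued_measure E"
begin

lemma E_sa: "S \<in> sets borel \<Longrightarrow> sa (E S)"
  using pvm by (simp add: projection_valued_measure_def sa_iff_adj)

lemma E_off: "S \<notin> sets borel \<Longrightarrow> E S = 0"
  using pvm by (simp add: projection_valued_measure_def)

lemma E_UNIV: "E UNIV = id_blinfun"
  using pvm by (simp add: projection_valued_measure_def)

lemma E_Int: "S \<in> sets borel \<Longrightarrow> S' \<in> sets borel \<Longrightarrow> E S (E S' x) = E (S \<inter> S') x"
  using pvm by (simp add: projection_valued_measure_def)

lemma E_sums: "range F \<subseteq> sets borel \<Longrightarrow> disjoint_family F \<Longrightarrow> (\<lambda>n. E (F n) x) sums E (\<Union>n. F n) x"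
  for F :: "nat \<Rightarrow> real set"
  using pvm by (simp add: projection_valued_measure_def)

lemma E_empty [simp]: "E {} = 0"
proof (rule blinfun_eqI)
  fix x
  have "(\<lambda>n::nat. E {} x) sums E (\<Union>n::nat. {}) x"
    by (rule E_sums) (auto simp: disjoint_family_on_def)
  then have "(\<lambda>n::nat. E {} x) \<longlonglongrightarrow> 0"
    by (intro summable_LIMSEQ_zero sums_summable)
  then show "blinfun_apply (E {}) x = blinfun_apply 0 x"
    by (simp add: LIMSEQ_const_iff)
qed

lemma E_norm: "S \<in> sets borel \<Longrightarrow> (norm (E S x))\<^sup>2 = Re (cinner (E S x) x)"
  using E_Int [of S S x] sa_cinner [OF E_sa, of S "E S x" x] by (simp add: Re_cinner_self)

lemma E_scalar:
  shows sets_scalar [simp, measurable_cong]: "sets (scalar_measure E x) = sets borel"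
    and space_scalar [simp]: "space (scalar_measure E x) = UNIV"
    and emeasure_scalar: "S \<in> sets borel \<Longrightarrow> emeasure (scalar_measure E x) S = ennreal ((norm (E S x))\<^sup>2)"
proof -
  have sig: "sigma_algebra (UNIV :: real set) (sets borel)"
    using sets.sigma_algebra_axioms [of borel] by simp
  show "sets (scalar_measure E x) = sets borel"
    unfolding scalar_measure_def using sets.sigma_sets_eq [of borel] by (subst sets_measure_of) auto
  show "space (scalar_measure E x) = UNIV"
    unfolding scalar_measure_def by (subst space_measure_of) auto
  assume S: "S \<in> sets borel"
  show "emeasure (scalar_measure E x) S = ennreal ((norm (E S x))\<^sup>2)"
    unfolding scalar_measure_def
  proof (rule emeasure_measure_of_sigma [OF sig _ _ S])
    show "positive (sets borel) (\<lambda>S. ennreal ((norm (E S x))\<^sup>2))"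
      by (simp add: positive_def)
    show "countably_additive (sets borel) (\<lambda>S. ennreal ((norm (E S x))\<^sup>2))"
      unfolding countably_additive_def
    proof (intro allI impI)
      fix A :: "nat \<Rightarrow> real set"
      assume A: "range A \<subseteq> sets borel" "disjoint_family A" "\<Union> (range A) \<in> sets borel"
      have "bounded_linear (\<lambda>v. Re (cinner v x))"
        by (rule bounded_linear_compose [OF bounded_linear_Re cinner.bounded_linear_left])
      from bounded_linear.sums [OF this E_sums [OF A(1,2), of x]]
      have "(\<lambda>n. (norm (E (A n) x))\<^sup>2) sums (norm (E (\<Union> (range A)) x))\<^sup>2"
        using A by (simp add: E_norm range_subsetD)
      then show "(\<Sum>n. ennreal ((norm (E (A n) x))\<^sup>2)) = ennreal ((norm (E (\<Union> (range A)) x))\<^sup>2)"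
        by (intro suminf_ennreal_eq) auto
    qed
  qed
qed

lemma measure_scalar: "S \<in> sets borel \<Longrightarrow> measure (scalar_measure E x) S = (norm (E S x))\<^sup>2"
  by (simp add: measure_def emeasure_scalar)

lemma finite_scalar: "finite_measure (scalar_measure E x)"
  by standard (simp add: emeasure_scalar)

sublocale scalar: finite_measure "scalar_measure E x" for x by (rule finite_scalar)

lemma AE_scalar_iff: "S \<in> sets borel \<Longrightarrow> (AE t in scalar_measure E x. t \<in> S) \<longleftrightarrow> E (- S) x = 0"
proof -
  assume S: "S \<in> sets borel"
  have "(AE t in scalar_measure E x. t \<in> S) \<longleftrightarrow> emeasure (scalar_measure E x) (- S) = 0"
    using S by (subst AE_iff_measurable [of "- S"]) auto
  then show ?thesis using S by (simp add: emeasure_scalar ennreal_eq_0_iff)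
qed

end

section \<open>Uniqueness of the spectral measure of a self-adjoint operator\<close>

text \<open>An arbitrary candidate for the description in \<open>spectral_projection\<close>. The
  bound \<open>b\<close> on the carrier makes the identity function integrable.\<close>

locale pvm_op = pvm E for E :: "real set \<Rightarrow> 'h::chilbert_space op" +
  fixes T :: "'h op" and K :: "real set" and b :: real
  assumes K: "K \<in> sets borel" "E K = id_blinfun" "\<And>t. t \<in> K \<Longrightarrow> \<bar>t\<bar> \<le> b"
    and T: "sa T" "\<And>x. cinner (T x) x = complex_of_real (LINT t|scalar_measure E x. t)"
begin

lemma AE_K: "AE t in scalar_measure E x. t \<in> K"
proof -
  have "E (- K) x = E (- K) (E K x)" by (simp add: K)
  also have "\<dots> = E (- K \<inter> K) x" using K by (intro E_Int) auto
  finally have "E (- K) x = 0" by simp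
  then show ?thesis using K by (simp add: AE_scalar_iff)
qed

lemma integrable_id: "integrable (scalar_measure E x) (\<lambda>t. t)"
  using AE_K [of x] by (intro scalar.integrable_const_bound [of _ b]) (auto elim!: eventually_mono dest: K(3))

lemma Re_T: "Re (cinner (T x) x) = (LINT t|scalar_measure E x. t)"
  by (simp add: T)

lemma Re_T_le:
  assumes P: "E {..a} x = x"
  shows "Re (cinner (T x) x) \<le> a * (norm x)\<^sup>2"
proof -
  have "E (- {..a}) x = E (- {..a}) (E {..a} x)" by (simp add: P)
  also have "\<dots> = E (- {..a} \<inter> {..a}) x" by (intro E_Int) auto
  also have "- {..a} \<inter> {..a} = {}" by auto
  finally have "E (- {..a}) x = 0" by simp
  then have "AE t in scalar_measure E x. t \<in> {..a}" by (subst AE_scalar_iff) auto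
  then have "(LINT t|scalar_measure E x. t) \<le> (LINT t|scalar_measure E x. a)"
    by (intro integral_mono_AE integrable_id) auto
  also have "\<dots> = a * (norm x)\<^sup>2" by (simp add: measure_scalar E_UNIV mult.commute)
  finally show ?thesis by (simp add: Re_T)
qed

text \<open>The strict inequality is the point: with \<open>Re_T_le\<close> it shows that the range
  of one candidate's half-line projection meets the kernel of another's only in 0.\<close>

lemma Re_T_gt:
  assumes P: "E {..a} x = 0" and x: "x \<noteq> 0"
  shows "a * (norm x)\<^sup>2 < Re (cinner (T x) x)"
proof (rule ccontr)
  assume not: "\<not> ?thesis"
  have "AE t in scalar_measure E x. t \<in> {a<..}"
    using P by (subst AE_scalar_iff) (auto simp: Compl_greaterThan)
  then have gt: "AE t in scalar_measure E x. a < t" by simp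
  have int: "integrable (scalar_measure E x) (\<lambda>t. t - a)"
    by (intro Bochner_Integration.integrable_diff integrable_id) simp
  have "(LINT t|scalar_measure E x. t - a) = Re (cinner (T x) x) - a * (norm x)\<^sup>2"
    using integrable_id by (simp add: Re_T measure_scalar E_UNIV mult.commute)
  then have "(LINT t|scalar_measure E x. t - a) \<le> 0" using not by simp
  moreover have "0 \<le> (LINT t|scalar_measure E x. t - a)"
    using gt by (intro integral_nonneg_AE) auto
  ultimately have "AE t in scalar_measure E x. t - a = 0"
    using gt int by (subst integral_nonneg_eq_0_iff_AE [symmetric]) auto
  with gt have "AE t in scalar_measure E x. t \<in> {}" by eventually_elim simp
  then have "E (- {}) x = 0" by (subst (asm) AE_scalar_iff) auto
  then show False using x by (simp add: E_UNIV)
qed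

text \<open>If \<open>P u = u\<close> and \<open>P v = 0\<close> then the scalar measures of \<open>u + v\<close> and \<open>u - v\<close> agree,
  so that the polar form of \<open>T\<close> vanishes on \<open>(u, v)\<close>.\<close>

lemma T_orthogonal:
  assumes S: "S \<in> sets borel" and u: "E S u = u" and v: "E S v = 0"
  shows "Re (cinner (T u) v) = 0"
proof -
  have cross: "Re (cinner (E S' u) (E S' v)) = 0" if S': "S' \<in> sets borel" for S'
  proof -
    have "cinner (E S' u) (E S' v) = cinner (E S' (E S' (E S u))) v"
      by (simp add: sa_cinner [OF E_sa [OF S']] u)
    also have "E S' (E S' (E S u)) = E S (E S' u)"
      using S S' by (simp add: E_Int) (simp only: Int_commute)
    also have "cinner (E S (E S' u)) v = 0"
      by (simp add: sa_cinner [OF E_sa [OF S]] v cinner.zero_right)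
    finally show ?thesis by simp
  qed
  have "scalar_measure E (u + v) = scalar_measure E (u - v)"
  proof (rule measure_eqI)
    fix S' assume "S' \<in> sets (scalar_measure E (u + v))"
    then have "S' \<in> sets borel" by simp
    then show "emeasure (scalar_measure E (u + v)) S' = emeasure (scalar_measure E (u - v)) S'"
      by (simp add: emeasure_scalar blinfun.add_right blinfun.diff_right norm_add_square norm_diff_square cross)
  qed simp
  then show ?thesis using sa_polarization [OF T(1), of u v] by (simp add: Re_T)
qed

text \<open>The part of T (E S x) lying in the kernel of E S is orthogonal to T (E S x) by
  \<open>T_orthogonal\<close>, hence to itself. So T leaves the range of E S invariant, and
  self-adjointness turns invariance into commutation.\<close>

lemma T_commute:
  assumes S: "S \<in> sets borel"
  shows "T o\<^sub>L E S = E S o\<^sub>L T"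
proof -
  have *: "T (E S x) = E S (T (E S x))" for x
  proof -
    define v where "v = T (E S x) - E S (T (E S x))"
    have Ev: "E S v = 0" using S by (simp add: v_def blinfun.diff_right E_Int)
    have "Re (cinner (T (E S x)) v) = 0"
      using S by (intro T_orthogonal [OF S] Ev) (simp add: E_Int)
    moreover have "cinner (E S (T (E S x))) v = 0"
      by (simp add: sa_cinner [OF E_sa [OF S]] Ev cinner.zero_right)
    ultimately have "Re (cinner v v) = 0" by (subst v_def) (simp add: cinner.diff_left)
    then show ?thesis by (simp add: Re_cinner_self v_def)
  qed
  have "cinner (T (E S x)) y = cinner (E S (T x)) y" for x y
  proof -
    have "cinner (T (E S x)) y = cinner (T (E S x)) (E S y)"
      using * [of x] sa_cinner [OF E_sa [OF S]] by metis
    also have "\<dots> = cinner x (E S (T (E S y)))"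
      by (simp add: sa_cinner [OF E_sa [OF S]] sa_cinner [OF T(1)])
    also have "\<dots> = cinner x (T (E S y))" using * [of y] by simp
    also have "\<dots> = cinner (E S (T x)) y"
      by (simp add: sa_cinner [OF E_sa [OF S]] sa_cinner [OF T(1)])
    finally show ?thesis .
  qed
  then show ?thesis by (intro blinfun_eqI cinner_ext) simp
qed

end

text \<open>A vector in the range of one half-line projection and in the kernel of the other would
  have its form both at most and above a times its squared norm. Commutation makes the discrepancy
  of the two projections such a vector. Half-lines then determine the scalar measures, and these
  determine the operators.\<close>

lemma pvm_op_unique:
  assumes E: "pvm_op E T K b" and F: "pvm_op F T K b"
    and comm: "\<And>C S. bounded_op C \<Longrightarrow> C o\<^sub>L T = T o\<^sub>L C \<Longrightarrow> S \<in> sets borel \<Longrightarrow> C o\<^sub>L F S = F S o\<^sub>L C"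
  shows "E = F"
proof -
  interpret E: pvm_op E T K b by fact
  interpret F: pvm_op F T K b by fact
  have le: "G {..a} (H {..a} x) = H {..a} x"
    if G: "pvm_op G T K b" and H: "pvm_op H T K b" and GH: "\<And>x. G {..a} (H {..a} x) = H {..a} (G {..a} x)" for G H a x
  proof -
    interpret G: pvm_op G T K b by fact
    interpret H: pvm_op H T K b by fact
    define y where "y = H {..a} x - G {..a} (H {..a} x)"
    have 1: "G {..a} y = 0" by (simp add: y_def blinfun.diff_right G.E_Int)
    have 2: "H {..a} y = y" by (simp add: y_def blinfun.diff_right GH H.E_Int)
    have "y = 0" using G.Re_T_gt [OF 1] H.Re_T_le [OF 2] by force
    then show ?thesis by (simp add: y_def)
  qed
  \<comment> \<open>\<open>E\<close> commutes with \<open>T\<close>, and \<open>F\<close> commutes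
    with whatever commutes with \<open>T\<close>.\<close>
  have EF: "E {..a} (F {..a} x) = F {..a} (E {..a} x)" for a x
    using comm [of "E {..a}" "{..a}"] E.T_commute [of "{..a}"] sa_bounded_op [OF E.E_sa, of "{..a}"]
    by (metis atMost_borel blinfun_apply_blinfun_compose)
  have Iic: "E {..a} = F {..a}" for a
    using le [OF E F EF] le [OF F E EF [symmetric]] EF by (intro blinfun_eqI) metis
  have sc: "scalar_measure E x = scalar_measure F x" for x
  proof (rule measure_eqI_generator_eq [where E = "range (\<lambda>a::real. {..a})" and \<Omega> = UNIV and A = "\<lambda>n. {..real n}"])
    show "Int_stable (range (\<lambda>a::real. {..a}))" by (auto simp: Int_stable_def)
    show "(\<Union>n. {..real n}) = UNIV" using real_arch_simple by auto
    show "sets (scalar_measure E x) = sigma_sets UNIV (range (\<lambda>a::real. {..a}))"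
      "sets (scalar_measure F x) = sigma_sets UNIV (range (\<lambda>a::real. {..a}))"
      unfolding E.sets_scalar F.sets_scalar by (subst borel_eq_atMost, simp)+
  qed (auto simp: E.emeasure_scalar F.emeasure_scalar Iic)
  show ?thesis
  proof
    fix S
    show "E S = F S"
    proof (cases "S \<in> sets borel")
      case True
      have "norm (E S x) = norm (F S x)" for x
        using E.measure_scalar [OF True, of x] F.measure_scalar [OF True, of x] sc [of x] by simp
      then show ?thesis
        by (intro sa_ext E.E_sa F.E_sa True) (simp add: E.E_norm [OF True, symmetric] F.E_norm [OF True, symmetric])
    qed (simp add: E.E_off F.E_off)
  qed
qed

subsection \<open>The spectral measure of a positive operator\<close>

context positive_bounded begin

definition E :: "real set \<Rightarrow> 'h op" where
  "E S = (if S \<in> sets borel then Fc (\<lambda>t. indicator S (clip r t)) else 0)"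

lemmas b_ind = bclass_indicator [OF r]

lemma E_sa: "S \<in> sets borel \<Longrightarrow> sa (E S)"
  by (simp add: E_def Fc_sa b_ind)

lemma E_compose: "S \<in> sets borel \<Longrightarrow> S' \<in> sets borel \<Longrightarrow> E S o\<^sub>L E S' = E (S \<inter> S')"
  by (simp add: E_def Fc_mult [OF b_ind b_ind, symmetric] indicator_inter_arith)

lemma E_cinner:
  assumes S: "S \<in> sets borel"
  shows "cinner (E S x) x = complex_of_real ((norm x)\<^sup>2 * measure (N x) S)"
proof -
  have "(\<integral>t. indicator S (clip r t) \<partial>N x) = (\<integral>t. indicat_real S t \<partial>N x)"
    using N_clip [OF borel_measurable_indicator [OF S]] .
  then show ?thesis using S by (simp add: E_def Fc_cinner b_ind)
qed

lemma E_norm: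
  assumes S: "S \<in> sets borel"
  shows "(norm (E S x))\<^sup>2 = (norm x)\<^sup>2 * measure (N x) S"
proof -
  have "(norm (E S x))\<^sup>2 = Re (cinner ((E S o\<^sub>L E S) x) x)"
    by (simp add: Re_cinner_self [symmetric] sa_cinner [OF E_sa [OF S]])
  then show ?thesis using S by (simp add: E_compose E_cinner del: of_real_mult)
qed

lemma E_commute: "bounded_op C \<Longrightarrow> C o\<^sub>L T = T o\<^sub>L C \<Longrightarrow> S \<in> sets borel \<Longrightarrow> C o\<^sub>L E S = E S o\<^sub>L C"
  by (simp add: E_def Fc_commute b_ind)

lemma E_UNIV: "E UNIV = id_blinfun"
  using Fc_const [of 1] by (simp add: E_def)

lemma E_disjoint_Un:
  assumes "S \<in> sets borel" "S' \<in> sets borel" "S \<inter> S' = {}"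
  shows "E (S \<union> S') = E S + E S'"
proof -
  have "indicat_real (S \<union> S') t = indicator S t + indicator S' t" for t
    using assms by (intro indicator_disj_union) 
  then show ?thesis using assms by (simp add: E_def Fc_add [symmetric] b_ind)
qed

lemma E_off: "S \<notin> sets borel \<Longrightarrow> E S = 0"
  by (simp add: E_def)

lemma projection_valued_measure_E: "projection_valued_measure E"
  unfolding projection_valued_measure_def
proof (intro conjI allI impI ballI)
  fix F :: "nat \<Rightarrow> real set" and x
  assume F: "range F \<subseteq> sets borel" "disjoint_family F"
  have Fn: "F n \<in> sets borel" for n using F by auto
  have finite: "(\<Sum>i<n. E (F i) x) = E (\<Union>i<n. F i) x" for n
  proof (induction n)
    case 0
    show ?case using E_norm [of "{}" x] by simp
  next
    case (Suc n)
    have "(\<Union>i<n. F i) \<inter> F n = {}"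
    proof -
      have "F i \<inter> F n = {}" if "i < n" for i
        using that by (intro disjoint_family_onD [OF F(2)]) auto
      then show ?thesis by blast
    qed
    then have "E ((\<Union>i<n. F i) \<union> F n) = E (\<Union>i<n. F i) + E (F n)"
      using Fn by (intro E_disjoint_Un) auto
    moreover have "(\<Union>i<Suc n. F i) = (\<Union>i<n. F i) \<union> F n" by (auto simp: less_Suc_eq)
    ultimately show ?case by (simp add: Suc blinfun.add_left)
  qed
  \<comment> \<open>The tail of the union. Its mass under \<open>N x\<close> tends to 0, and by
    \<open>E_norm\<close> this is strong convergence of the partial sums.\<close>
  define R where "R n = (\<Union>n. F n) - (\<Union>i<n. F i)" for n
  have Rb: "R n \<in> sets borel" for n unfolding R_def using Fn by auto
  have split: "E (\<Union>n. F n) = E (\<Union>i<n. F i) + E (R n)" for n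
  proof -
    have "(\<Union>n. F n) = (\<Union>i<n. F i) \<union> R n" by (auto simp: R_def)
    moreover have "E ((\<Union>i<n. F i) \<union> R n) = E (\<Union>i<n. F i) + E (R n)"
      using Fn Rb by (intro E_disjoint_Un) (auto simp: R_def)
    ultimately show ?thesis by metis
  qed
  have "(\<lambda>n. measure (N x) (R n)) \<longlonglongrightarrow> measure (N x) (\<Inter>n. R n)"
    by (intro N.finite_Lim_measure_decseq) (use Rb in \<open>auto simp: decseq_def R_def\<close>)
  also have "(\<Inter>n. R n) = {}" by (auto simp: R_def)
  finally have "(\<lambda>n. sqrt ((norm x)\<^sup>2 * measure (N x) (R n))) \<longlonglongrightarrow> sqrt ((norm x)\<^sup>2 * 0)"
    by (intro tendsto_real_sqrt tendsto_mult_left) simp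
  then have "(\<lambda>n. norm (E (R n) x)) \<longlonglongrightarrow> 0"
    by (simp only: E_norm [OF Rb, symmetric]) simp
  then have "(\<lambda>n. E (\<Union>n. F n) x - E (R n) x) \<longlonglongrightarrow> E (\<Union>n. F n) x - 0"
    by (intro tendsto_diff tendsto_const) (simp add: tendsto_norm_zero_iff)
  moreover have "E (\<Union>n. F n) x - E (R n) x = (\<Sum>i<n. E (F i) x)" for n
    using split [of n] by (simp add: finite blinfun.add_left)
  ultimately show "(\<lambda>n. E (F n) x) sums E (\<Union>n. F n) x" by (simp add: sums_def)
qed (auto simp: E_UNIV E_off E_compose sa_adj E_sa sa_bounded_op)

sublocale E: pvm E by standard (rule projection_valued_measure_E)

lemma scalar_measure_E: "scalar_measure E x = density (N x) (\<lambda>_. ennreal ((norm x)\<^sup>2))"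
proof (rule measure_eqI)
  fix S assume "S \<in> sets (scalar_measure E x)"
  then have S [measurable]: "S \<in> sets borel" by simp
  have "emeasure (density (N x) (\<lambda>_. ennreal ((norm x)\<^sup>2))) S = ennreal ((norm x)\<^sup>2) * emeasure (N x) S"
    using S by (intro emeasure_density_const) simp
  then show "emeasure (scalar_measure E x) S = emeasure (density (N x) (\<lambda>_. ennreal ((norm x)\<^sup>2))) S"
    using S by (simp only: E.emeasure_scalar E_norm N.emeasure_eq_measure) (simp add: ennreal_mult)
qed simp

lemma integral_scalar_measure_E:
  fixes f :: "real \<Rightarrow> real"
  assumes "f \<in> borel_measurable borel"
  shows "(LINT t|scalar_measure E x. f t) = (norm x)\<^sup>2 * (\<integral>t. f t \<partial>N x)"
  unfolding scalar_measure_E using assms by (subst integral_density) auto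

lemma T_integral: "cinner (T x) x = complex_of_real (LINT t|scalar_measure E x. t)"
proof -
  have "Re (cinner (T x) x) = (LINT t|scalar_measure E x. t)"
    using N(3) [of x "[:0, 1:]"] by (simp add: integral_scalar_measure_E)
  then show ?thesis using sa_of_real [OF saT, of x] by simp
qed

text \<open>On the range of this projection T - t0 shrinks vectors by the factor c/2 at least;
  taking radius c/2 instead of c makes the conflict with the lower bound strict.\<close>

lemma E_null_ball:
  assumes c: "0 < c" and bound: "\<And>x. c * norm x \<le> norm (T x - t0 *\<^sub>R x)"
  shows "E {t0 - c/2<..<t0 + c/2} = 0"
proof (rule blinfun_eqI)
  fix x
  define U where "U = {t0 - c/2<..<t0 + c/2}"
  have U: "U \<in> sets borel" by (simp add: U_def)
  define y where "y = E U x"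
  have "y = 0"
  proof (rule ccontr)
    assume y: "y \<noteq> 0"
    have "E U y = y" using U by (simp add: y_def E.E_Int)
    then have "measure (N y) U = 1"
      using E_norm [OF U, of y] y by simp
    then have AE: "AE t in N y. t \<in> U" using U by (subst (asm) N.prob_eq_1) auto
    define p where "p = [:- t0, 1:]"
    have p: "op_poly p T z = T z - t0 *\<^sub>R z" for z
      by (simp add: p_def blinfun.add_left blinfun.scaleR_left blinfun.diff_left)
    have sap: "sa (op_poly p T)" by (intro bop saT)
    have "(norm (T y - t0 *\<^sub>R y))\<^sup>2 = Re (cinner (op_poly p T y) (op_poly p T y))"
      by (simp only: p Re_cinner_self)
    also have "\<dots> = Re (cinner (op_poly (p * p) T y) y)"
      unfolding op_poly_mult blinfun_apply_blinfun_compose by (simp only: sa_cinner [OF sap, of "op_poly p T y" y])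
    also have "\<dots> = (norm y)\<^sup>2 * (\<integral>t. poly (p * p) t \<partial>N y)" by (rule N(3) [symmetric])
    also have "\<dots> \<le> (norm y)\<^sup>2 * (\<integral>t. (c/2)\<^sup>2 \<partial>N y)"
    proof (intro mult_left_mono)
      have b: "bclass r (\<lambda>t. poly (p * p) (clip r t))" by (rule bclass.poly)
      have "(\<integral>t. poly (p * p) t \<partial>N y) = (\<integral>t. poly (p * p) (clip r t) \<partial>N y)"
        by (rule N_clip [symmetric]) (intro borel_measurable_continuous_onI continuous_intros)
      also have "\<dots> \<le> (\<integral>t. (c/2)\<^sup>2 \<partial>N y)"
      proof (intro integral_mono_AE N_integrable [OF b])
        show "AE t in N y. poly (p * p) (clip r t) \<le> (c/2)\<^sup>2"
          using AE N(2) [of y]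
        proof eventually_elim
          case (elim t)
          then have "t0 - c/2 < t" "t < t0 + c/2" by (auto simp: U_def)
          then have "\<bar>t - t0\<bar> \<le> c/2" by linarith
          then have "\<bar>t - t0\<bar>\<^sup>2 \<le> (c/2)\<^sup>2" by (intro power_mono) auto
          then show ?case using elim by (simp add: clip_id p_def power2_eq_square algebra_simps)
        qed
      qed simp
      finally show "(\<integral>t. poly (p * p) t \<partial>N y) \<le> (\<integral>t. (c/2)\<^sup>2 \<partial>N y)" .
    qed simp
    also have "\<dots> = (c/2 * norm y)\<^sup>2" by (simp add: power_mult_distrib power_divide mult.commute)
    finally have "norm (T y - t0 *\<^sub>R y) \<le> c/2 * norm y"
      by (rule power2_le_imp_le) (use c in simp)
    moreover have "c/2 * norm y < c * norm y" using c y by (intro mult_strict_right_mono) auto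
    ultimately show False using bound [of y] by linarith
  qed
  then show "blinfun_apply (E {t0 - c/2<..<t0 + c/2}) x = blinfun_apply 0 x" by (simp add: y_def U_def)
qed

lemma E_spectrum: "E (real_spectrum T) = id_blinfun"
proof -
  have "\<exists>U. open U \<and> t \<in> U \<and> E U = 0" if t: "t \<in> - real_spectrum T" for t
  proof -
    obtain B where B: "B o\<^sub>L (T - t *\<^sub>R id_blinfun) = id_blinfun"
      using t by (auto simp: real_spectrum_iff invertible_op_def)
    have bound: "1 / (norm B + 1) * norm x \<le> norm (T x - t *\<^sub>R x)" for x
    proof -
      have "B (T x - t *\<^sub>R x) = (B o\<^sub>L (T - t *\<^sub>R id_blinfun)) x"
        by (simp add: blinfun.diff_left blinfun.scaleR_left)
      then have "norm x = norm (B (T x - t *\<^sub>R x))" by (simp add: B)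
      also have "\<dots> \<le> norm B * norm (T x - t *\<^sub>R x)" by (rule norm_blinfun)
      also have "\<dots> \<le> (norm B + 1) * norm (T x - t *\<^sub>R x)" by (intro mult_right_mono) auto
      finally show ?thesis by (simp add: pos_divide_le_eq add_nonneg_pos mult.commute)
    qed
    have c: "0 < 1 / (norm B + 1)" by (simp add: add_nonneg_pos)
    show ?thesis
      using E_null_ball [OF c bound] c by (intro exI [of _ "{t - 1 / (norm B + 1) / 2<..<t + 1 / (norm B + 1) / 2}"]) auto
  qed
  then obtain U where U: "\<And>t. t \<in> - real_spectrum T \<Longrightarrow> open (U t) \<and> t \<in> U t \<and> E (U t) = 0" by metis
  \<comment> \<open>Null sets are closed under countable unions only, so the cover of the resolvent
    set by null balls is first thinned out.\<close>
  obtain \<F> where \<F>: "\<F> \<subseteq> U ` (- real_spectrum T)" "countable \<F>" "\<Union>\<F> = \<Union> (U ` (- real_spectrum T))"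
    using Lindelof [of "U ` (- real_spectrum T)"] U by (metis imageE)
  have "E (- real_spectrum T) x = 0" for x
  proof -
    have "(\<Union>V\<in>\<F>. V) \<in> null_sets (scalar_measure E x)"
    proof (rule null_sets_UN' [OF \<F>(2)])
      fix V assume "V \<in> \<F>"
      then obtain t where "t \<in> - real_spectrum T" "V = U t" using \<F>(1) by blast
      then have "open V" "E V = 0" using U by auto
      then show "V \<in> null_sets (scalar_measure E x)"
        by (auto simp: null_sets_def E.emeasure_scalar borel_open)
    qed
    then have "\<Union>\<F> \<in> null_sets (scalar_measure E x)" by simp
    moreover have "- real_spectrum T \<subseteq> \<Union>\<F>" using U \<F>(3) by blast
    ultimately have "- real_spectrum T \<in> null_sets (scalar_measure E x)"
      using real_spectrum_borel [of T] null_sets_subset [of "\<Union>\<F>" "scalar_measure E x" "- real_spectrum T"] by auto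
    then show ?thesis using real_spectrum_borel [of T] by (simp add: null_sets_def E.emeasure_scalar ennreal_eq_0_iff)
  qed
  then have "E (- real_spectrum T) = 0" by (intro blinfun_eqI) simp
  moreover have "E (real_spectrum T \<union> - real_spectrum T) = E (real_spectrum T) + E (- real_spectrum T)"
    using real_spectrum_borel [of T] by (intro E_disjoint_Un) auto
  ultimately show ?thesis by (simp add: E_UNIV)
qed

text \<open>Supplies the constant \<open>b\<close> of \<open>pvm_op\<close> for every candidate
  measure carried by the spectrum.\<close>

lemma real_spectrum_bounded: "\<exists>b. \<forall>t\<in>real_spectrum T. \<bar>t\<bar> \<le> b"
proof (intro exI ballI, rule ccontr)
  fix t assume t: "t \<in> real_spectrum T" and "\<not> \<bar>t\<bar> \<le> norm T"
  then have tT: "norm T < \<bar>t\<bar>" by simp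
  have "norm ((1/t) *\<^sub>R T) < 1"
    using tT norm_ge_zero [of T] by (simp add: divide_less_eq)
  then have "invertible_op (id_blinfun - (1/t) *\<^sub>R T)"
    using sa_bounded_op [OF saT] by (meson Neumann_series invertible_opI bounded_op_scaleR)
  moreover have "invertible_op ((- t) *\<^sub>R id_blinfun :: 'h op)"
    using tT norm_ge_zero [of T]
    by (intro invertible_opI [of "(- 1/t) *\<^sub>R id_blinfun"] bop) (auto simp: compose.scaleR_left compose.scaleR_right compose.minus_left compose.minus_right)
  ultimately have "invertible_op (((- t) *\<^sub>R id_blinfun) o\<^sub>L (id_blinfun - (1/t) *\<^sub>R T))"
    by (intro invertible_op_compose)
  also have "((- t) *\<^sub>R id_blinfun) o\<^sub>L (id_blinfun - (1/t) *\<^sub>R T) = T - t *\<^sub>R id_blinfun"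
    using tT norm_ge_zero [of T] by (auto simp: compose.scaleR_left compose.scaleR_right compose.minus_left compose.diff_right scaleR_diff_right)
  finally show False using t by (simp add: real_spectrum_iff)
qed

theorem spectral_projection_eq: "spectral_projection T = E"
proof -
  obtain b where b: "\<And>t. t \<in> real_spectrum T \<Longrightarrow> \<bar>t\<bar> \<le> b" using real_spectrum_bounded by blast
  have pvm_op: "pvm_op F T (real_spectrum T) b"
    if "projection_valued_measure F" "F (real_spectrum T) = id_blinfun"
      "\<And>x. cinner (T x) x = complex_of_real (LINT t|scalar_measure F x. t)" for F
    using that b saT by unfold_locales auto
  show ?thesis
    unfolding spectral_projection_def
  proof (rule the_equality)
    show "projection_valued_measure E \<and> E (real_spectrum T) = id_blinfun \<and>
      (\<forall>x. cinner (T x) x = complex_of_real (LINT t|scalar_measure E x. t))"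
      using projection_valued_measure_E E_spectrum T_integral by blast
    fix F assume "projection_valued_measure F \<and> F (real_spectrum T) = id_blinfun \<and>
      (\<forall>x. cinner (T x) x = complex_of_real (LINT t|scalar_measure F x. t))"
    then show "F = E"
      using pvm_op_unique [of F T "real_spectrum T" b E] pvm_op [of F] pvm_op [of E]
        projection_valued_measure_E E_spectrum T_integral E_commute by blast
  qed
qed

end

subsection \<open>Tracial states\<close>

locale tracial_algebra =
  fixes R :: "'h::chilbert_space op set" and \<tau> :: "'h op \<Rightarrow> complex"
  assumes vN: "von_neumann_algebra R" and state: "faithful_tracial_state R \<tau>"
begin

lemma R_bounded: "A \<in> R \<Longrightarrow> bounded_op A"
  using vN by (simp add: von_neumann_algebra_def)

lemma R_adj: "A \<in> R \<Longrightarrow> adj A \<in> R"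
  using vN by (simp add: von_neumann_algebra_def)

text \<open>The double commutant condition as a membership test. Every object constructed from
  elements of \<open>R\<close> enters \<open>R\<close> by commuting with all that commutes with
  them.\<close>

lemma R_I:
  assumes "bounded_op A" "\<And>C. C \<in> commutant R \<Longrightarrow> bounded_op C \<Longrightarrow> C o\<^sub>L A = A o\<^sub>L C"
  shows "A \<in> R"
proof -
  have "A \<in> commutant (commutant R)"
    using assms by (simp add: commutant_def [of "commutant R"]) (metis (no_types, lifting) commutant_def mem_Collect_eq)
  then show ?thesis using vN by (simp add: von_neumann_algebra_def)
qed

lemma R_D: "A \<in> R \<Longrightarrow> C \<in> commutant R \<Longrightarrow> C o\<^sub>L A = A o\<^sub>L C"
  by (simp add: commutant_def)

named_theorems inR

lemma R_id [inR, simp]: "id_blinfun \<in> R"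
  by (rule R_I) auto
lemma R_0 [inR, simp]: "0 \<in> R"
  by (rule R_I) auto
lemma R_add [inR]: "A \<in> R \<Longrightarrow> B \<in> R \<Longrightarrow> A + B \<in> R"
  by (rule R_I) (simp add: bounded_op_add R_bounded, simp add: compose.add_left compose.add_right, metis R_D)
lemma R_diff [inR]: "A \<in> R \<Longrightarrow> B \<in> R \<Longrightarrow> A - B \<in> R"
  by (rule R_I) (simp add: bounded_op_diff R_bounded, simp add: compose.diff_left compose.diff_right, metis R_D)
lemma R_minus [inR]: "A \<in> R \<Longrightarrow> - A \<in> R"
  by (rule R_I) (simp add: bounded_op_minus R_bounded, simp only: compose.minus_left compose.minus_right, metis R_D)
lemma R_scaleR [inR]: "A \<in> R \<Longrightarrow> c *\<^sub>R A \<in> R"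
  by (rule R_I) (simp add: bounded_op_scaleR R_bounded, simp only: compose.scaleR_left compose.scaleR_right, metis R_D)
lemma R_compose [inR]: "A \<in> R \<Longrightarrow> B \<in> R \<Longrightarrow> A o\<^sub>L B \<in> R"
proof (rule R_I)
  fix C assume *: "A \<in> R" "B \<in> R" "C \<in> commutant R"
  show "C o\<^sub>L (A o\<^sub>L B) = (A o\<^sub>L B) o\<^sub>L C"
    by (metis * R_D compose_assoc)
qed (intro bounded_op_compose R_bounded)
lemma R_scaleC_op [inR]: "A \<in> R \<Longrightarrow> scaleC_op c A \<in> R"
proof (rule R_I)
  fix C assume *: "A \<in> R" "C \<in> commutant R" "bounded_op C"
  have "C (A x) = A (C x)" for x
    using R_D [OF *(1,2)] by (metis blinfun_apply_blinfun_compose)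
  then show "C o\<^sub>L scaleC_op c A = scaleC_op c A o\<^sub>L C"
    using *(3) by (intro blinfun_eqI) (simp add: scaleC_op.rep_eq bounded_op_def)
qed (intro bop R_bounded)
lemma R_op_poly [inR]: "A \<in> R \<Longrightarrow> op_poly p A \<in> R"
  by (induction p) (auto intro!: inR)
lemma R_opow [inR]: "A \<in> R \<Longrightarrow> opow A n \<in> R"
  unfolding opow_def by (rule R_op_poly)

lemma R_limit:
  assumes F: "\<And>n. F n \<in> R" and lim: "F \<longlonglongrightarrow> B"
  shows "B \<in> R"
proof (rule R_I)
  show "bounded_op B" by (rule bounded_op_limit [OF R_bounded [OF F] lim])
  fix C assume C: "C \<in> commutant R"
  have "(\<lambda>n. C o\<^sub>L F n) \<longlonglongrightarrow> (C o\<^sub>L B)" "(\<lambda>n. F n o\<^sub>L C) \<longlonglongrightarrow> (B o\<^sub>L C)"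
    by (intro compose.tendsto lim tendsto_const)+
  then show "C o\<^sub>L B = B o\<^sub>L C"
    using R_D [OF F C] LIMSEQ_unique by fastforce
qed

lemma R_inverse:
  assumes A: "A \<in> R" and B: "bounded_op B" "A o\<^sub>L B = id_blinfun" "B o\<^sub>L A = id_blinfun"
  shows "B \<in> R"
proof (rule R_I)
  fix C assume C: "C \<in> commutant R"
  have "C o\<^sub>L B = (B o\<^sub>L A) o\<^sub>L (C o\<^sub>L B)" by (simp add: B)
  also have "\<dots> = B o\<^sub>L ((A o\<^sub>L C) o\<^sub>L B)" by (simp add: compose_assoc)
  also have "\<dots> = B o\<^sub>L (C o\<^sub>L (A o\<^sub>L B))" by (simp add: R_D [OF A C, symmetric] compose_assoc)
  finally show "C o\<^sub>L B = B o\<^sub>L C" by (simp add: B)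
qed (rule B)

lemma R_Fc:
  assumes "positive_bounded A r" "A \<in> R" "bclass r f"
  shows "positive_bounded.Fc A r f \<in> R"
proof -
  interpret positive_bounded A r by fact
  show ?thesis
  proof (rule R_I)
    show "bounded_op (Fc f)" by (intro sa_bounded_op Fc_sa assms)
    show "C o\<^sub>L Fc f = Fc f o\<^sub>L C" if "C \<in> commutant R" "bounded_op C" for C
      using that by (intro Fc_commute R_D assms)
  qed
qed

lemma R_square_root:
  assumes A: "positive_op A" "A \<in> R"
  obtains S where "positive_op S" "S o\<^sub>L S = A" "S \<in> R"
proof -
  obtain S where S: "positive_op S" "S o\<^sub>L S = A"
    "\<And>C. bounded_op C \<Longrightarrow> C o\<^sub>L A = A o\<^sub>L C \<Longrightarrow> C o\<^sub>L S = S o\<^sub>L C"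
    using square_root_exists [OF A(1)] by blast
  have "S \<in> R"
  proof (rule R_I)
    show "bounded_op S" by (intro sa_bounded_op positive_op_sa S)
    show "C o\<^sub>L S = S o\<^sub>L C" if "C \<in> commutant R" "bounded_op C" for C
      using that by (intro S(3) R_D A)
  qed
  with S that show ?thesis by blast
qed

lemma tau_add: "A \<in> R \<Longrightarrow> B \<in> R \<Longrightarrow> \<tau> (A + B) = \<tau> A + \<tau> B"
  using state by (simp add: faithful_tracial_state_def)
lemma tau_scaleC_op: "A \<in> R \<Longrightarrow> \<tau> (scaleC_op c A) = c * \<tau> A"
  using state by (simp add: faithful_tracial_state_def)
lemma tau_commute: "A \<in> R \<Longrightarrow> B \<in> R \<Longrightarrow> \<tau> (A o\<^sub>L B) = \<tau> (B o\<^sub>L A)"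
  using state by (simp add: faithful_tracial_state_def)
lemma tau_id: "\<tau> id_blinfun = 1"
  using state by (simp add: faithful_tracial_state_def)

lemma scaleC_op_of_real: "scaleC_op (complex_of_real c) A = c *\<^sub>R A" for A :: "'h op"
  by (rule blinfun_eqI) (simp add: scaleC_op.rep_eq scaleC_of_real blinfun.scaleR_left)

lemma tau_scaleR: "A \<in> R \<Longrightarrow> \<tau> (c *\<^sub>R A) = complex_of_real c * \<tau> A"
  using tau_scaleC_op [of A "complex_of_real c"] by (simp add: scaleC_op_of_real)
lemma tau_diff: "A \<in> R \<Longrightarrow> B \<in> R \<Longrightarrow> \<tau> (A - B) = \<tau> A - \<tau> B"
  using tau_add [of A "(-1) *\<^sub>R B"] tau_scaleR [of B "-1"] by (simp add: inR)

text \<open>Positivity and faithfulness are postulated for products \<open>adj A\<close> with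
  \<open>A\<close>; the square root inside \<open>R\<close> brings a positive operator into this
  form.\<close>

lemma tau_positive:
  assumes A: "positive_op A" "A \<in> R"
  shows "\<tau> A \<in> \<real>\<^sub>\<ge>\<^sub>0" "\<tau> A = 0 \<Longrightarrow> A = 0"
proof -
  obtain S where S: "positive_op S" "S o\<^sub>L S = A" "S \<in> R" using R_square_root [OF A] .
  have "adj S o\<^sub>L S = A" using S by (simp add: sa_adj positive_op_sa)
  then have "\<tau> A \<in> \<real>\<^sub>\<ge>\<^sub>0 \<and> (\<tau> A = 0 \<longrightarrow> S = 0)"
    using state S(3) unfolding faithful_tracial_state_def by metis
  then show "\<tau> A \<in> \<real>\<^sub>\<ge>\<^sub>0" "\<tau> A = 0 \<Longrightarrow> A = 0" using S(2) by auto
qed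

lemma norm_id_add_positive: "sa A \<Longrightarrow> positive_op (A + norm A *\<^sub>R id_blinfun)" for A :: "'h op"
  using norm_id_diff_positive [OF sa_minus, of A "norm A"] by (simp add: add.commute)

text \<open>Adding a multiple of the identity makes \<open>A\<close> positive and changes the trace
  by a real number.\<close>

lemma tau_sa:
  assumes A: "sa A" "A \<in> R"
  shows "Im (\<tau> A) = 0"
proof -
  have "\<tau> (A + norm A *\<^sub>R id_blinfun) \<in> \<real>\<^sub>\<ge>\<^sub>0"
    using A by (intro tau_positive norm_id_add_positive inR) auto
  moreover have "\<tau> (A + norm A *\<^sub>R id_blinfun) = \<tau> A + complex_of_real (norm A)"
    using A by (simp add: tau_add tau_scaleR tau_id inR)
  ultimately show ?thesis by (simp add: complex_nonneg_Reals_iff)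
qed

text \<open>Equal to \<open>\<tau>\<close> on self-adjoint elements. Taking the real part keeps it
  additive, cyclic and real-valued on products such as \<open>iv X o\<^sub>L Y\<close>, which need
  not be self-adjoint.\<close>

definition tr :: "'h op \<Rightarrow> real" where "tr A = Re (\<tau> A)"

lemma tr_add: "A \<in> R \<Longrightarrow> B \<in> R \<Longrightarrow> tr (A + B) = tr A + tr B"
  by (simp add: tr_def tau_add)
lemma tr_diff: "A \<in> R \<Longrightarrow> B \<in> R \<Longrightarrow> tr (A - B) = tr A - tr B"
  by (simp add: tr_def tau_diff)
lemma tr_scaleR: "A \<in> R \<Longrightarrow> tr (c *\<^sub>R A) = c * tr A"
  by (simp add: tr_def tau_scaleR)
lemma tr_0 [simp]: "tr 0 = 0"
  using tr_scaleR [of 0 0] by simp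
lemma tr_minus: "A \<in> R \<Longrightarrow> tr (- A) = - tr A"
  using tr_diff [of 0 A] by simp
lemma tr_commute: "A \<in> R \<Longrightarrow> B \<in> R \<Longrightarrow> tr (A o\<^sub>L B) = tr (B o\<^sub>L A)"
  by (simp add: tr_def tau_commute)
lemma tr_id [simp]: "tr id_blinfun = 1"
  by (simp add: tr_def tau_id)
lemma tr_nonneg: "positive_op A \<Longrightarrow> A \<in> R \<Longrightarrow> 0 \<le> tr A"
  using tau_positive(1) by (simp add: tr_def complex_nonneg_Reals_iff)
lemma tau_eq_tr: "sa A \<Longrightarrow> A \<in> R \<Longrightarrow> \<tau> A = complex_of_real (tr A)"
  by (simp add: tr_def tau_sa complex_eq_iff)
lemma tr_faithful: "positive_op A \<Longrightarrow> A \<in> R \<Longrightarrow> tr A = 0 \<Longrightarrow> A = 0"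
  using tau_positive(2) tau_eq_tr positive_op_sa by fastforce
lemma tr_mono: "positive_op (B - A) \<Longrightarrow> A \<in> R \<Longrightarrow> B \<in> R \<Longrightarrow> tr A \<le> tr B"
  using tr_nonneg [of "B - A"] by (simp add: tr_diff inR)
lemma R_sum [inR]: "(\<And>i. i \<in> I \<Longrightarrow> F i \<in> R) \<Longrightarrow> sum F I \<in> R"
  by (induction I rule: infinite_finite_induct) (auto intro!: inR)
lemma tr_sum: "(\<And>i. i \<in> I \<Longrightarrow> F i \<in> R) \<Longrightarrow> tr (sum F I) = (\<Sum>i\<in>I. tr (F i))"
  by (induction I rule: infinite_finite_induct) (auto simp: tr_add inR)

lemma tr_sa_le:
  assumes A: "sa A" "A \<in> R" and C: "norm A \<le> C"
  shows "\<bar>tr A\<bar> \<le> C"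
proof -
  have "positive_op (C *\<^sub>R id_blinfun - A)" "positive_op (C *\<^sub>R id_blinfun - (- A))"
    using A C by (intro norm_id_diff_positive sa_minus; simp)+
  then have "tr A \<le> tr (C *\<^sub>R id_blinfun)" "tr (- A) \<le> tr (C *\<^sub>R id_blinfun)"
    using A by (intro tr_mono inR; simp)+
  then show ?thesis using A by (simp add: tr_minus tr_scaleR abs_le_iff)
qed

text \<open>Reduces to the self-adjoint part H of A. Its trace has the same real part because \<i>
  (A - adj A) is self-adjoint and so has a real trace.\<close>

lemma tr_le_norm:
  assumes A: "A \<in> R"
  shows "\<bar>tr A\<bar> \<le> norm A"
proof -
  note bA = R_bounded [OF A]
  have re: "Re (cinner (adj A x) x) = Re (cinner (A x) x)" for x
    using cinner_adj [OF bA, of x x] Re_cinner_commute [of x "adj A x"] by simp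
  define H where "H = (1/2) *\<^sub>R (A + adj A)"
  have saH: "sa H"
    unfolding H_def sa_iff_adj using bA
    by (auto intro!: bop adj_eqI simp: blinfun.scaleR_left blinfun.add_left cinner.scaleR_left cinner.scaleR_right
        cinner.add_left cinner.add_right cinner_adj) (metis adj_adj bounded_op_adj cinner_adj add.commute)
  have "norm H \<le> norm A"
    using saH
  proof (rule sa_norm_le)
    show "\<bar>Re (cinner (H x) x)\<bar> \<le> norm A * (norm x)\<^sup>2" for x
      using cinner_le_norm [of A x]
      by (simp add: H_def blinfun.scaleR_left blinfun.add_left cinner.scaleR_left cinner.add_left re)
  qed simp
  moreover have "tr H = tr A"
  proof -
    define D where "D = scaleC_op \<i> (A - adj A)"
    have bD: "bounded_op D" unfolding D_def by (intro bop bA)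
    have "sa D"
    proof (rule saI [OF bD])
      show "Im (cinner (D x) x) = 0" for x
        by (simp add: D_def scaleC_op.rep_eq cinner_scaleC_left blinfun.diff_left cinner.diff_left re)
    qed
    moreover have "D \<in> R" unfolding D_def using A by (intro inR R_adj)
    ultimately have "Im (\<tau> D) = 0" by (rule tau_sa)
    then have "tr (adj A) = tr A"
      using A by (simp add: D_def tau_scaleC_op tau_diff inR R_adj tr_def)
    then show ?thesis using A by (simp add: H_def tr_scaleR tr_add inR R_adj)
  qed
  moreover have "H \<in> R" unfolding H_def using A by (intro inR R_adj)
  ultimately show ?thesis using tr_sa_le [OF saH] by metis
qed

lemma tr_tendsto:
  assumes F: "\<forall>\<^sub>F n in G. F n \<in> R" and B: "B \<in> R" and lim: "(F \<longlongrightarrow> B) G"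
  shows "((\<lambda>n. tr (F n)) \<longlongrightarrow> tr B) G"
proof (rule LIM_zero_cancel, rule Lim_null_comparison)
  show "\<forall>\<^sub>F n in G. norm (tr (F n) - tr B) \<le> norm (F n - B)"
    using F
  proof eventually_elim
    case (elim n)
    then show ?case using tr_le_norm [of "F n - B"] B by (simp add: tr_diff inR)
  qed
  show "((\<lambda>n. norm (F n - B)) \<longlongrightarrow> 0) G"
    using lim by (intro tendsto_norm_zero) (simp add: LIM_zero)
qed

lemma tr_sums:
  assumes F: "\<And>n. F n \<in> R" and lim: "F sums B"
  shows "B \<in> R" "(\<lambda>n. tr (F n)) sums tr B"
proof -
  have l: "(\<lambda>n. \<Sum>i<n. F i) \<longlonglongrightarrow> B" using lim by (simp add: sums_def)
  show B: "B \<in> R" by (rule R_limit [OF _ l]) (intro inR F)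
  have "(\<lambda>n. tr (\<Sum>i<n. F i)) \<longlonglongrightarrow> tr B"
    by (rule tr_tendsto [OF _ B l]) (intro always_eventually allI inR F)
  then show "(\<lambda>n. tr (F n)) sums tr B"
    using F by (simp add: sums_def tr_sum)
qed

text \<open>The product need not be positive, but writing A as the square of S and moving one S
  around cyclically gives the trace of the positive operator S B S.\<close>

lemma tr_product_nonneg:
  assumes A: "positive_op A" "A \<in> R" and B: "positive_op B" "B \<in> R"
  shows "0 \<le> tr (A o\<^sub>L B)"
proof -
  obtain S where S: "positive_op S" "S o\<^sub>L S = A" "S \<in> R" using R_square_root [OF A] .
  have "tr (A o\<^sub>L B) = tr (S o\<^sub>L (S o\<^sub>L B))" unfolding S(2) [symmetric] by (simp add: compose_assoc)
  also have "\<dots> = tr ((S o\<^sub>L B) o\<^sub>L S)" using S B by (intro tr_commute inR)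
  also have "0 \<le> \<dots>" using S B by (intro tr_nonneg inR positive_op_sandwich positive_op_sa)
  finally show ?thesis .
qed

subsection \<open>The distribution of a positive operator under the trace\<close>

text \<open>The distribution of \<open>A\<close> under the trace, described by its moments, which
  make sense without any countable additivity of the trace on projections.\<close>

definition law :: "'h op \<Rightarrow> real \<Rightarrow> real measure \<Rightarrow> bool" where
  "law A r M \<longleftrightarrow> real_distribution M \<and> (AE t in M. t \<in> {0..r}) \<and> (\<forall>p. (\<integral>t. poly p t \<partial>M) = tr (op_poly p A))"

lemma law_exists:
  assumes A: "positive_bounded A r" "A \<in> R"
  obtains M where "law A r M"
proof -
  interpret positive_bounded A r by fact
  obtain M where "real_distribution M" "AE t in M. t \<in> {0..r}" "\<And>p. (\<integral>t. poly p t \<partial>M) = tr (op_poly p A)"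
  proof (rule Hausdorff_moment [OF r, of "\<lambda>p. tr (op_poly p A)"])
    show "0 \<le> tr (op_poly ([:0, 1:] ^ k * [:r, - 1:] ^ m) A)" for k m
      by (intro tr_nonneg op_poly_Bernstein_positive r T Tr inR A)
  qed (use A in \<open>auto simp: tr_add tr_scaleR inR\<close>)
  then show ?thesis using that by (auto simp: law_def)
qed

text \<open>Uniform polynomial approximation converges on both sides: as integrals against M, and in
  operator norm under the trace.\<close>

lemma law_continuous:
  assumes A: "positive_bounded A r" "A \<in> R" and M: "law A r M" and f: "continuous_on {0..r} f"
  shows "(\<integral>t. f (clip r t) \<partial>M) = tr (positive_bounded.Fc A r (\<lambda>t. f (clip r t)))"
proof -
  interpret positive_bounded A r by fact
  interpret M: real_distribution M using M by (simp add: law_def)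
  have bf: "bclass r (\<lambda>t. f (clip r t))" by (rule bclass_continuous [OF r f])
  have "\<exists>p. \<forall>t\<in>{0..r}. \<bar>f t - poly p t\<bar> < 1 / Suc n" for n
    by (rule Weierstrass_poly [OF f, of "1 / Suc n"]) (simp, blast)
  then obtain p where p: "\<And>n t. t \<in> {0..r} \<Longrightarrow> \<bar>f t - poly (p n) t\<bar> < 1 / Suc n" by metis
  have lim0: "(\<lambda>n. 1 / real (Suc n)) \<longlonglongrightarrow> 0"
    using LIMSEQ_inverse_real_of_nat by (simp add: inverse_eq_divide)
  have "(\<lambda>n. op_poly (p n) A) \<longlonglongrightarrow> Fc (\<lambda>t. f (clip r t))"
    by (rule Fc_continuous_limit [OF f less_imp_le [OF p] lim0])
  then have lim1: "(\<lambda>n. tr (op_poly (p n) A)) \<longlonglongrightarrow> tr (Fc (\<lambda>t. f (clip r t)))"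
    by (intro tr_tendsto always_eventually allI inR A R_Fc bf)
  have "(\<lambda>n. (\<integral>t. poly (p n) t \<partial>M)) \<longlonglongrightarrow> (\<integral>t. f (clip r t) \<partial>M)"
  proof (rule LIM_zero_cancel, rule Lim_null_comparison [OF _ lim0], rule always_eventually, rule allI)
    fix n
    have int: "integrable M g" if b: "bclass r g" for g
    proof -
      obtain C where "\<forall>t. \<bar>g t\<bar> \<le> C" using bclass_bounded [OF r b] by blast
      then show ?thesis
        using bclass_measurable [OF b] by (intro M.integrable_const_bound [of _ C]) auto
    qed
    have AE: "AE t in M. t \<in> {0..r}" using M by (simp add: law_def)
    have "(\<integral>t. poly (p n) t \<partial>M) = (\<integral>t. poly (p n) (clip r t) \<partial>M)"
    proof (rule integral_cong_AE)
      show "AE t in M. poly (p n) t = poly (p n) (clip r t)"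
        using AE by (rule eventually_mono) (simp add: clip_id)
    qed simp_all
    then have "(\<integral>t. poly (p n) t \<partial>M) - (\<integral>t. f (clip r t) \<partial>M) = (\<integral>t. poly (p n) (clip r t) - f (clip r t) \<partial>M)"
      by (simp add: int bf bclass.poly)
    also have "\<bar>\<dots>\<bar> \<le> (\<integral>t. \<bar>poly (p n) (clip r t) - f (clip r t)\<bar> \<partial>M)"
      using integral_abs_bound by blast
    also have "\<dots> \<le> (\<integral>t. 1 / real (Suc n) \<partial>M)"
    proof (rule integral_mono)
      show "integrable M (\<lambda>t. \<bar>poly (p n) (clip r t) - f (clip r t)\<bar>)"
        by (intro integrable_abs int bclass_diff r bf bclass.poly)
      show "\<bar>poly (p n) (clip r t) - f (clip r t)\<bar> \<le> 1 / real (Suc n)" for t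
        using p [of "clip r t" n] clip_bounds [OF r, of t] by (auto simp: abs_minus_commute)
    qed simp
    also have "\<dots> = 1 / real (Suc n)" using M.prob_space by simp
    finally show "norm ((\<integral>t. poly (p n) t \<partial>M) - (\<integral>t. f (clip r t) \<partial>M)) \<le> 1 / real (Suc n)" by simp
  qed
  then have "(\<lambda>n. tr (op_poly (p n) A)) \<longlonglongrightarrow> (\<integral>t. f (clip r t) \<partial>M)"
    using M by (simp add: law_def)
  then show ?thesis using lim1 LIMSEQ_unique by blast
qed

lemma infdist_indicator_limit:
  fixes C :: "real set"
  assumes C: "closed C" "C \<noteq> {}"
  shows "(\<lambda>n. max 0 (1 - real n * infdist t C)) \<longlonglongrightarrow> indicator C t"
proof (cases "t \<in> C")
  case True
  then show ?thesis by simp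
next
  case False
  then have d: "0 < infdist t C"
    using C in_closed_iff_infdist_zero [of C t] infdist_nonneg [of t C] by fastforce
  then obtain m :: nat where m: "1 / infdist t C < real m" using reals_Archimedean2 by blast
  have "max 0 (1 - real n * infdist t C) = 0" if "n \<ge> m" for n
  proof -
    have "1 < real m * infdist t C" using m d by (simp add: field_simps)
    also have "\<dots> \<le> real n * infdist t C" using that d by (intro mult_right_mono) auto
    finally show ?thesis by simp
  qed
  then have "eventually (\<lambda>n. max 0 (1 - real n * infdist t C) = 0) sequentially"
    by (auto simp: eventually_sequentially)
  then show ?thesis using False by (simp add: tendsto_eventually)
qed

text \<open>The trace need not be normal, so \<open>S \<mapsto> \<tau>(E S)\<close> need not be a measure. Approximating the
  indicator of a closed set from above by continuous functions yields one inequality with \<open>M\<close>;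
  applied to the closures of a continuity set and of its complement it gives equality.\<close>

lemma law_closed:
  assumes A: "positive_bounded A r" "A \<in> R" and M: "law A r M" and C: "closed C"
  shows "tr (positive_bounded.E A r C) \<le> measure M C"
proof (cases "C = {}")
  case True
  interpret positive_bounded A r by fact
  show ?thesis using True by simp
next
  case False
  interpret positive_bounded A r by fact
  interpret M: real_distribution M using M by (simp add: law_def)
  have AE: "AE t in M. t \<in> {0..r}" using M by (simp add: law_def)
  have Cb [measurable]: "C \<in> sets borel" using C by (rule borel_closed)
  define f where "f n t = max 0 (1 - real n * infdist t C)" for n t
  have fc: "continuous_on S (f n)" for n S
    unfolding f_def by (intro continuous_intros)
  have f01: "0 \<le> f n t" "f n t \<le> 1" for n t by (auto simp: f_def infdist_nonneg)
  have bf: "bclass r (\<lambda>t. f n (clip r t))" for n by (rule bclass_continuous [OF r fc])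
  have le: "tr (E C) \<le> (\<integral>t. f n (clip r t) \<partial>M)" for n
  proof -
    have "positive_op (Fc (\<lambda>t. f n (clip r t) - indicator C (clip r t)))"
      by (intro Fc_positive bclass_diff r bf b_ind Cb) (auto simp: f01 f_def split: split_indicator)
    then have "positive_op (Fc (\<lambda>t. f n (clip r t)) - E C)"
      by (simp add: Fc_diff bf b_ind E_def)
    moreover have "E C \<in> R" using A by (simp add: E_def R_Fc b_ind)
    ultimately have "tr (E C) \<le> tr (Fc (\<lambda>t. f n (clip r t)))"
      by (intro tr_mono R_Fc A bf)
    then show ?thesis by (simp add: law_continuous [OF A M fc])
  qed
  have "(\<lambda>n. \<integral>t. f n (clip r t) \<partial>M) \<longlonglongrightarrow> (\<integral>t. indicator C (clip r t) \<partial>M)"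
  proof (rule integral_dominated_convergence [where w = "\<lambda>_. 1"])
    show "AE t in M. (\<lambda>n. f n (clip r t)) \<longlonglongrightarrow> indicator C (clip r t)"
      unfolding f_def using infdist_indicator_limit [OF C False] by simp
    show "(\<lambda>t. f n (clip r t)) \<in> borel_measurable M" for n using bclass_measurable [OF bf] by simp
    show "AE t in M. norm (f n (clip r t)) \<le> 1" for n using f01 by simp
  qed (use bclass_measurable [OF b_ind [OF Cb]] in auto)
  also have "(\<integral>t. indicator C (clip r t) \<partial>M) = (\<integral>t. indicat_real C t \<partial>M)"
  proof (rule integral_cong_AE)
    show "AE t in M. indicat_real C (clip r t) = indicat_real C t"
      using AE by (rule eventually_mono) (simp add: clip_id)
  qed (use bclass_measurable [OF b_ind [OF Cb]] in auto)
  also have "\<dots> = measure M C" by simp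
  finally show ?thesis using le by (intro LIMSEQ_le_const) auto
qed

lemma law_continuity_set:
  assumes A: "positive_bounded A r" "A \<in> R" and M: "law A r M" 
    and S: "S \<in> sets borel" "measure M (frontier S) = 0"
  shows "tr (positive_bounded.E A r S) \<le> measure M S"
proof -
  interpret positive_bounded A r by fact
  interpret M: real_distribution M using M by (simp add: law_def)
  have fb: "frontier S \<in> sets borel" "closure S \<in> sets borel" by (simp_all add: borel_closed)
  have ER: "E S' \<in> R" if "S' \<in> sets borel" for S' using A that by (simp add: E_def R_Fc b_ind)
  have "E S + E (closure S - S) = E (S \<union> (closure S - S))"
    using S fb by (intro E_disjoint_Un [symmetric]) auto
  also have "S \<union> (closure S - S) = closure S" using closure_subset by blast
  finally have "E (closure S) - E S = E (closure S - S)" by (metis add_diff_cancel_left')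
  moreover have "positive_op (E (closure S - S))"
    using S fb by (simp add: E_def Fc_positive b_ind)
  ultimately have "tr (E S) \<le> tr (E (closure S))"
    using S fb by (intro tr_mono ER) auto
  also have "\<dots> \<le> measure M (closure S)" by (rule law_closed [OF A M]) simp
  also have "\<dots> \<le> measure M (S \<union> frontier S)"
    using S fb closure_Un_frontier [of S] by (intro M.finite_measure_mono) auto
  also have "\<dots> \<le> measure M S + measure M (frontier S)"
    using S fb by (intro measure_Un_le) auto
  finally show ?thesis using S by simp
qed

theorem induced_measure_law:
  assumes A: "positive_bounded A r" "A \<in> R" and M: "law A r M"
  shows "induced_measure \<tau> A = M"
proof -
  interpret positive_bounded A r by fact
  interpret M: real_distribution M using M by (simp add: law_def)
  have ER: "E S' \<in> R" if "S' \<in> sets borel" for S' using A that by (simp add: E_def R_Fc b_ind)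
  have eq: "complex_of_real (measure M S) = \<tau> (spectral_projection A S)"
    if S: "S \<in> sets borel" "measure M (frontier S) = 0" for S
  proof -
    have "tr (E S) \<le> measure M S" by (rule law_continuity_set [OF A M S])
    moreover have "tr (E (- S)) \<le> measure M (- S)"
      using S by (intro law_continuity_set [OF A M]) (auto simp: frontier_complement)
    moreover have "tr (E S) + tr (E (- S)) = 1"
    proof -
      have "E (S \<union> - S) = E S + E (- S)" using S by (intro E_disjoint_Un) auto
      then have "E S + E (- S) = id_blinfun" by (simp add: E_UNIV)
      then show ?thesis using S tr_add [OF ER ER, of S "- S"] by simp
    qed
    moreover have "measure M S + measure M (- S) = 1"
      using S M.prob_compl [of S] by (simp add: Compl_eq_Diff_UNIV)
    ultimately have "measure M S = tr (E S)" by linarith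
    then show ?thesis
      using S by (simp add: spectral_projection_eq tau_eq_tr ER E_sa)
  qed
  show ?thesis
    unfolding induced_measure_def
  proof (rule the_equality)
    show "real_distribution M \<and> (\<forall>S\<in>sets borel. measure M (frontier S) = 0 \<longrightarrow>
        complex_of_real (measure M S) = \<tau> (spectral_projection A S))"
      using eq M.real_distribution_axioms by blast
    fix M' assume *: "real_distribution M' \<and> (\<forall>S\<in>sets borel. measure M' (frontier S) = 0 \<longrightarrow>
        complex_of_real (measure M' S) = \<tau> (spectral_projection A S))"
    show "M' = M"
    \<comment> \<open>If x is an atom of neither measure, {..x} is a continuity set of both and the
      two distribution functions agree at x.\<close>
    proof (rule real_distribution_eqI_cocountable)
      fix x :: real assume "measure M' {x} = 0" "measure M {x} = 0"
      then have "complex_of_real (measure M' {..x}) = complex_of_real (measure M {..x})"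
        using * eq [of "{..x}"] by simp
      then show "cdf M' x = cdf M x" by (simp add: cdf_def)
    qed (use * M.real_distribution_axioms in auto)
  qed
qed

text \<open>The spectrum is closed and its spectral projection is the identity, so
  \<open>law_closed\<close> gives it full measure.\<close>

lemma law_spectrum:
  assumes A: "positive_bounded A r" "A \<in> R" and M: "law A r M"
  shows "AE t in M. t \<in> real_spectrum A"
proof -
  interpret positive_bounded A r by fact
  interpret M: real_distribution M using M by (simp add: law_def)
  have "1 \<le> measure M (real_spectrum A)"
    using law_closed [OF A M closed_real_spectrum, of A] by (simp add: E_spectrum)
  then have "measure M (real_spectrum A) = 1" using M.prob_le_1 [of "real_spectrum A"] by linarith
  then show ?thesis by (subst (asm) M.prob_eq_1) auto
qed

end

subsection \<open>Geometric means of distributions on the half-line\<close>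

text \<open>Mass at 0 has to be excluded explicitly because ln 0 = 0 in the library. For laws on a
  bounded interval of the half-line the value 0 means that the logarithm has integral
  -\<infinity>.\<close>

definition geometric_mean :: "real measure \<Rightarrow> real" where
  "geometric_mean M = (if (AE t in M. 0 < t) \<and> integrable M ln then exp (\<integral>t. ln t \<partial>M) else 0)"

lemma elog_measurable [measurable]: "elog \<in> borel_measurable borel"
  unfolding elog_def [abs_def] by measurable

text \<open>Support in [0, r] bounds the positive part of the logarithm, so a failure can only come
  from the negative part.\<close>

lemma nn_integral_neg_log_infinite:
  assumes M: "real_distribution M" and AE: "AE t in M. t \<in> {0..r}" and r: "0 < r"
    and not: "\<not> ((AE t in M. 0 < t) \<and> integrable M ln)"
  shows "(\<integral>\<^sup>+t. e2ennreal (- elog t) \<partial>M) = \<infinity>"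
proof (rule ccontr)
  interpret real_distribution M by fact
  assume fin: "(\<integral>\<^sup>+t. e2ennreal (- elog t) \<partial>M) \<noteq> \<infinity>"
  have "AE t in M. e2ennreal (- elog t) \<noteq> \<infinity>"
    by (rule nn_integral_noteq_infinite [OF _ fin]) measurable
  then have pos: "AE t in M. 0 < t"
    by eventually_elim (auto simp: elog_def split: if_splits)
  have "(\<integral>\<^sup>+t. ennreal (ln t) \<partial>M) \<le> (\<integral>\<^sup>+t. ennreal \<bar>ln r\<bar> \<partial>M)"
  proof (rule nn_integral_mono_AE)
    show "AE t in M. ennreal (ln t) \<le> ennreal \<bar>ln r\<bar>"
      using AE pos
    proof eventually_elim
      case (elim t)
      then have "ln t \<le> ln r" by (subst ln_le_cancel_iff) (use r in auto)
      then show ?case by (intro ennreal_leI) linarith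
    qed
  qed
  also have "\<dots> < \<infinity>" using emeasure_space_1 by simp
  finally have 1: "(\<integral>\<^sup>+t. ennreal (ln t) \<partial>M) \<noteq> \<infinity>" by simp
  have "(\<integral>\<^sup>+t. ennreal (- ln t) \<partial>M) = (\<integral>\<^sup>+t. e2ennreal (- elog t) \<partial>M)"
    by (rule nn_integral_cong_AE) (use pos in \<open>eventually_elim, simp add: elog_def\<close>)
  then have 2: "(\<integral>\<^sup>+t. ennreal (- ln t) \<partial>M) \<noteq> \<infinity>" using fin by simp
  have "integrable M ln" using 1 2 by (simp add: real_integrable_def)
  with pos not show False by simp
qed

lemma log_integral_geometric_mean:
  assumes M: "real_distribution M" and AE: "AE t in M. t \<in> {0..r}" and r: "0 < r" 
    and K: "AE t in M. t \<in> K"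
  shows "(let L = log_integral M K in if L = -\<infinity> then 0 else exp (real_of_ereal L)) = geometric_mean M"
proof -
  interpret real_distribution M by fact
  have onK: "(\<integral>\<^sup>+t\<in>K. g t \<partial>M) = (\<integral>\<^sup>+t. g t \<partial>M)" for g :: "real \<Rightarrow> ennreal"
    by (rule nn_integral_cong_AE) (use K in \<open>eventually_elim, simp\<close>)
  have L: "log_integral M K = enn2ereal (\<integral>\<^sup>+t. e2ennreal (elog t) \<partial>M) - enn2ereal (\<integral>\<^sup>+t. e2ennreal (- elog t) \<partial>M)"
    unfolding log_integral_def onK ..
  have "(\<integral>\<^sup>+t. e2ennreal (elog t) \<partial>M) \<le> (\<integral>\<^sup>+t. ennreal \<bar>ln r\<bar> \<partial>M)"
  proof (rule nn_integral_mono_AE)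
    show "AE t in M. e2ennreal (elog t) \<le> ennreal \<bar>ln r\<bar>"
      using AE
    proof eventually_elim
      case (elim t)
      show ?case
      proof (cases "0 < t")
        case True
        then have "ln t \<le> ln r" by (subst ln_le_cancel_iff) (use r elim in auto)
        then show ?thesis using True by (simp add: elog_def)
      qed (simp add: elog_def e2ennreal_neg)
    qed
  qed
  also have "\<dots> < \<infinity>" using emeasure_space_1 by simp
  finally obtain p where p: "(\<integral>\<^sup>+t. e2ennreal (elog t) \<partial>M) = ennreal p" "0 \<le> p"
    by (cases "\<integral>\<^sup>+t. e2ennreal (elog t) \<partial>M") auto
  show ?thesis
  proof (cases "(AE t in M. 0 < t) \<and> integrable M ln")
    case False
    then have "log_integral M K = -\<infinity>"
      unfolding L nn_integral_neg_log_infinite [OF M AE r False] p using p(2) by (simp add: enn2ereal_ennreal)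
    moreover have "geometric_mean M = 0" unfolding geometric_mean_def using False by simp
    ultimately show ?thesis by simp
  next
    case True
    then have pos: "AE t in M. 0 < t" by simp
    have P: "(\<integral>\<^sup>+t. e2ennreal (elog t) \<partial>M) = (\<integral>\<^sup>+t. ennreal (ln t) \<partial>M)"
      by (rule nn_integral_cong_AE) (use pos in \<open>eventually_elim, simp add: elog_def\<close>)
    have Q: "(\<integral>\<^sup>+t. e2ennreal (- elog t) \<partial>M) = (\<integral>\<^sup>+t. ennreal (- ln t) \<partial>M)"
      by (rule nn_integral_cong_AE) (use pos in \<open>eventually_elim, simp add: elog_def\<close>)
    have "(\<integral>\<^sup>+t. ennreal (- ln t) \<partial>M) \<noteq> \<infinity>" using True by (simp add: real_integrable_def)
    then obtain q where q: "(\<integral>\<^sup>+t. ennreal (- ln t) \<partial>M) = ennreal q" "0 \<le> q"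
      by (cases "\<integral>\<^sup>+t. ennreal (- ln t) \<partial>M") auto
    have "(\<integral>t. ln t \<partial>M) = p - q"
      using True p q P by (subst real_lebesgue_integral_def) auto
    moreover have "log_integral M K = ereal (p - q)"
      unfolding L Q q p(1) using p(2) q(2) by (simp add: enn2ereal_ennreal)
    ultimately show ?thesis using True by (simp add: geometric_mean_def)
  qed
qed

text \<open>Dominated convergence if the logarithm is integrable. Otherwise b - ln (t + d n)
  increases to a function of infinite integral, and monotone convergence drives the exponentials to
  0.\<close>

lemma geometric_mean_limit:
  fixes d :: "nat \<Rightarrow> real"
  assumes M: "real_distribution M" and AE: "AE t in M. t \<in> {0..r}" and r: "0 < r"
    and d: "decseq d" "\<And>n. 0 < d n" "d \<longlonglongrightarrow> 0"
  shows "(\<lambda>n. exp (\<integral>t. ln (t + d n) \<partial>M)) \<longlonglongrightarrow> geometric_mean M"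
proof -
  interpret real_distribution M by fact
  \<comment> \<open>An upper bound for all the logarithms at once, so that b minus any of them is
    nonnegative.\<close>
  define b where "b = ln (r + d 0)"
  define f where "f n t = ln (clip r t + d n)" for n t
  have dn: "d n \<le> d 0" for n using d(1) by (simp add: decseqD)
  have [measurable]: "f n \<in> borel_measurable borel" for n unfolding f_def by measurable
  have cl: "0 \<le> clip r t" "clip r t \<le> r" for t using clip_bounds [OF r, of t] by auto
  have fb: "f n t \<le> b" for n t
    unfolding f_def b_def using cl [of t] d(2) [of n] dn [of n] by (subst ln_le_cancel_iff) linarith+
  have fl: "ln (d n) \<le> f n t" for n t
    unfolding f_def using cl [of t] d(2) [of n] by (subst ln_le_cancel_iff) linarith+
  have fint: "integrable M (f n)" for n
  proof (rule integrable_const_bound [of _ "\<bar>b\<bar> + \<bar>ln (d n)\<bar>"])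
    have "\<bar>f n t\<bar> \<le> \<bar>b\<bar> + \<bar>ln (d n)\<bar>" for t using fb [of n t] fl [of n t] by linarith
    then show "AE t in M. norm (f n t) \<le> \<bar>b\<bar> + \<bar>ln (d n)\<bar>" by simp
  qed measurable
  have If: "(\<integral>t. ln (t + d n) \<partial>M) = (\<integral>t. f n t \<partial>M)" for n
  proof (rule integral_cong_AE)
    show "AE t in M. ln (t + d n) = f n t"
      using AE by (rule eventually_mono) (simp add: f_def clip_id)
  qed measurable
  show ?thesis
  proof (cases "(AE t in M. 0 < t) \<and> integrable M ln")
    case True
    have "(\<lambda>n. \<integral>t. f n t \<partial>M) \<longlonglongrightarrow> (\<integral>t. ln t \<partial>M)"
    proof (rule integral_dominated_convergence [where w = "\<lambda>t. \<bar>ln t\<bar> + \<bar>b\<bar>"])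
      show "integrable M (\<lambda>t. \<bar>ln t\<bar> + \<bar>b\<bar>)" using True by auto
      have "AE t in M. 0 < t \<and> t \<in> {0..r}" using AE True by auto
      then show "AE t in M. (\<lambda>n. f n t) \<longlonglongrightarrow> ln t"
      proof (rule eventually_mono)
        fix t assume t: "0 < t \<and> t \<in> {0..r}"
        have "(\<lambda>n. ln (t + d n)) \<longlonglongrightarrow> ln (t + 0)"
          using t by (intro tendsto_intros d(3)) auto
        then show "(\<lambda>n. f n t) \<longlonglongrightarrow> ln t" using t by (simp add: f_def clip_id)
      qed
      fix n
      have "AE t in M. 0 < t \<and> t \<in> {0..r}" using AE True by auto
      then show "AE t in M. norm (f n t) \<le> \<bar>ln t\<bar> + \<bar>b\<bar>"
      proof (rule eventually_mono)
        fix t assume t: "0 < t \<and> t \<in> {0..r}"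
        have "ln t \<le> f n t"
          using t d(2) [of n] by (simp add: f_def clip_id)
        then show "norm (f n t) \<le> \<bar>ln t\<bar> + \<bar>b\<bar>" using fb [of n t] by simp
      qed
    qed (auto simp: borel_measurable_ln)
    then have "(\<lambda>n. exp (\<integral>t. f n t \<partial>M)) \<longlonglongrightarrow> exp (\<integral>t. ln t \<partial>M)" by (rule tendsto_exp)
    then show ?thesis using True by (simp add: If geometric_mean_def)
  next
    case False
    \<comment> \<open>The pointwise limit of b - f n; the value \<infinity> at 0 is spelled out
      because ln 0 = 0.\<close>
    define u where "u t = (if 0 < clip r t then ennreal (b - ln (clip r t)) else \<infinity>)" for t
    have [measurable]: "u \<in> borel_measurable borel" unfolding u_def by measurable
    have lim: "(\<lambda>n. \<integral>\<^sup>+t. ennreal (b - f n t) \<partial>M) \<longlonglongrightarrow> (\<integral>\<^sup>+t. u t \<partial>M)"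
    proof (rule nn_integral_LIMSEQ)
      show "incseq (\<lambda>n t. ennreal (b - f n t))"
      proof (intro incseq_SucI le_funI ennreal_leI)
        fix n t
        have "f (Suc n) t \<le> f n t"
          unfolding f_def using cl [of t] d(2) [of "Suc n"] d(2) [of n] decseqD [OF d(1), of n "Suc n"]
          by (subst ln_le_cancel_iff) auto
        then show "b - f n t \<le> b - f (Suc n) t" by simp
      qed
      show "(\<lambda>n. ennreal (b - f n t)) \<longlonglongrightarrow> u t" for t
      proof (cases "0 < clip r t")
        case True
        have "(\<lambda>n. b - ln (clip r t + d n)) \<longlonglongrightarrow> b - ln (clip r t + 0)"
          using True by (intro tendsto_intros d(3)) auto
        then show ?thesis using True by (simp add: u_def f_def)
      next
        case False
        then have 0: "clip r t = 0" using cl [of t] by simp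
        have "filterlim d (at_right 0) sequentially"
          using d(2,3) less_imp_neq [OF d(2), symmetric] by (simp add: filterlim_at)
        then have "LIM n sequentially. ln (d n) :> at_bot"
          by (rule filterlim_compose [OF ln_at_0])
        then have "LIM n sequentially. - ln (d n) :> at_top"
          by (simp add: filterlim_uminus_at_bot)
        then have "LIM n sequentially. b + - ln (d n) :> at_top"
          by (rule filterlim_tendsto_add_at_top [OF tendsto_const])
        then show ?thesis by (simp add: u_def f_def 0 ennreal_tendsto_top_eq_at_top)
      qed
    qed measurable
    have "(\<integral>\<^sup>+t. e2ennreal (- elog t) \<partial>M) \<le> (\<integral>\<^sup>+t. u t + ennreal \<bar>b\<bar> \<partial>M)"
    proof (rule nn_integral_mono_AE)
      show "AE t in M. e2ennreal (- elog t) \<le> u t + ennreal \<bar>b\<bar>"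
        using AE
      proof (rule eventually_mono)
        fix t assume t: "t \<in> {0..r}"
        show "e2ennreal (- elog t) \<le> u t + ennreal \<bar>b\<bar>"
        proof (cases "0 < t")
          case True
          have "ln t \<le> b"
            unfolding b_def using True t d(2) [of 0] by (subst ln_le_cancel_iff) auto
          then have "ennreal (b - ln t) + ennreal \<bar>b\<bar> = ennreal (b - ln t + \<bar>b\<bar>)"
            by (intro ennreal_plus [symmetric]) auto
          moreover have "ennreal (- ln t) \<le> ennreal (b - ln t + \<bar>b\<bar>)" by (intro ennreal_leI) linarith
          ultimately show ?thesis using True t by (simp add: u_def clip_id elog_def)
        next
          case False
          then show ?thesis using t by (simp add: u_def clip_id)
        qed
      qed
    qed
    also have "\<dots> = (\<integral>\<^sup>+t. u t \<partial>M) + ennreal \<bar>b\<bar>"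
      using emeasure_space_1 by (subst nn_integral_add) auto
    finally have "(\<integral>\<^sup>+t. u t \<partial>M) = \<infinity>"
      unfolding nn_integral_neg_log_infinite [OF M AE r False] by (auto simp: top_unique)
    moreover have "(\<integral>\<^sup>+t. ennreal (b - f n t) \<partial>M) = ennreal (b - (\<integral>t. f n t \<partial>M))" for n
      using fint fb prob_space by (subst nn_integral_eq_integral) auto
    ultimately have "LIM n sequentially. b - (\<integral>t. f n t \<partial>M) :> at_top"
      using lim by (simp add: ennreal_tendsto_top_eq_at_top)
    then have "LIM n sequentially. - b + (b - (\<integral>t. f n t \<partial>M)) :> at_top"
      by (rule filterlim_tendsto_add_at_top [OF tendsto_const])
    then have "LIM n sequentially. (\<integral>t. f n t \<partial>M) :> at_bot"
      by (simp add: filterlim_uminus_at_bot)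
    then have "(\<lambda>n. exp (\<integral>t. f n t \<partial>M)) \<longlonglongrightarrow> 0"
      by (rule filterlim_compose [OF exp_at_bot])
    moreover have "geometric_mean M = 0" unfolding geometric_mean_def using False by simp
    ultimately show ?thesis by (simp add: If)
  qed
qed

text \<open>The tangent line at \<open>ln a\<close> of the strictly convex function \<open>x \<mapsto> ln (1 + exp x)\<close>.\<close>

lemma ln_one_plus_tangent:
  fixes a t :: real
  assumes a: "0 < a" and t: "0 < t"
  shows "ln (1 + a) + a / (1 + a) * (ln t - ln a) \<le> ln (t + 1)"
    and "ln (1 + a) + a / (1 + a) * (ln t - ln a) = ln (t + 1) \<Longrightarrow> t = a"
proof -
  \<comment> \<open>With these weights y = p + w u, and the claim reads p ln (1/y) + w ln (u/y)
    \<le> 0. Applying ln z \<le> z - 1 to each logarithm gives bounds that sum to 0, and equality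
    there forces z = 1.\<close>
  define p w where "p = 1 / (1 + a)" and "w = a / (1 + a)"
  have pw: "0 < p" "0 < w" "p + w = 1"
    using a by (auto simp: p_def w_def simp flip: add_divide_distrib)
  define y where "y = (t + 1) / (1 + a)"
  define u where "u = t / a"
  have pos: "0 < y" "0 < u" using a t by (auto simp: y_def u_def)
  have y: "y = p + w * u" using a by (simp add: y_def u_def p_def w_def add_divide_distrib)
  have l1: "ln (1 / y) \<le> 1 / y - 1" using pos by (intro ln_le_minus_one) auto
  have l2: "ln (u / y) \<le> u / y - 1" using pos by (intro ln_le_minus_one) auto
  have key: "p * (1 / y - 1) + w * (u / y - 1) = 0"
  proof -
    have "p * (1 / y - 1) + w * (u / y - 1) = (p + w * u) / y - (p + w)"
      by (simp add: algebra_simps add_divide_distrib)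
    then show ?thesis unfolding y [symmetric] pw(3) using pos by simp
  qed
  have lhs: "p * ln (1 / y) + w * ln (u / y) = w * (ln t - ln a) - (ln (t + 1) - ln (1 + a))"
  proof -
    have "ln (1 / y) = - (ln (t + 1) - ln (1 + a))" "ln (u / y) = (ln t - ln a) - (ln (t + 1) - ln (1 + a))"
      using a t by (simp_all add: y_def u_def ln_div ln_mult)
    moreover have "p * - z + w * (x - z) = w * x - (p + w) * z" for x z :: real
      by (simp add: algebra_simps)
    ultimately show ?thesis by (simp only: pw(3) mult_1)
  qed
  have m1: "p * ln (1 / y) \<le> p * (1 / y - 1)" using pw l1 by (intro mult_left_mono) auto
  have m2: "w * ln (u / y) \<le> w * (u / y - 1)" using pw l2 by (intro mult_left_mono) auto
  show "ln (1 + a) + a / (1 + a) * (ln t - ln a) \<le> ln (t + 1)"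
    unfolding w_def [symmetric] using m1 m2 key lhs by linarith
  assume "ln (1 + a) + a / (1 + a) * (ln t - ln a) = ln (t + 1)"
  then have "p * ln (1 / y) = p * (1 / y - 1)"
    unfolding w_def [symmetric] using m1 m2 key lhs by linarith
  then have "ln (1 / y) = 1 / y - 1" using pw by (simp only: mult_cancel_left) auto
  then have "1 / y = 1" using pos by (intro ln_eq_minus_one) auto
  then show "t = a" using a by (simp add: y_def)
qed

text \<open>The tangent is taken at the geometric mean itself, where its linear term integrates to
  0. Equality leaves a nonnegative function of integral 0. A mean of 0 admits no tangent and is
  treated through ln (t + 1) \<ge> 0.\<close>

lemma geometric_mean_superadditive:
  assumes M: "real_distribution M" and AE: "AE t in M. t \<in> {0..r}"
  shows "1 + geometric_mean M \<le> exp (\<integral>t. ln (t + 1) \<partial>M)"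
    and "1 + geometric_mean M = exp (\<integral>t. ln (t + 1) \<partial>M) \<Longrightarrow> AE t in M. t = geometric_mean M"
proof -
  interpret real_distribution M by fact
  have nn: "AE t in M. 0 \<le> ln (t + 1)"
    using AE by (rule eventually_mono) auto
  have int: "integrable M (\<lambda>t. ln (t + 1))"
  proof (rule integrable_const_bound [of _ "ln (r + 1)"])
    show "AE t in M. norm (ln (t + 1)) \<le> ln (r + 1)"
      using AE by (rule eventually_mono) auto
  qed measurable
  let ?a = "geometric_mean M"
  show "1 + ?a \<le> exp (\<integral>t. ln (t + 1) \<partial>M)"
  proof (cases "?a = 0")
    case True
    then show ?thesis using integral_nonneg_AE [OF nn] by simp
  next
    case False
    then have *: "AE t in M. 0 < t" "integrable M ln" "?a = exp (\<integral>t. ln t \<partial>M)"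
      by (auto simp: geometric_mean_def split: if_splits)
    then have a: "0 < ?a" by simp
    have "(\<integral>t. ln (1 + ?a) + ?a / (1 + ?a) * (ln t - ln ?a) \<partial>M) \<le> (\<integral>t. ln (t + 1) \<partial>M)"
    proof (rule integral_mono_AE)
      show "AE t in M. ln (1 + ?a) + ?a / (1 + ?a) * (ln t - ln ?a) \<le> ln (t + 1)"
        using *(1) by (rule eventually_mono) (rule ln_one_plus_tangent(1) [OF a])
    qed (use *(2) int in auto)
    moreover have "(\<integral>t. ln (1 + ?a) + ?a / (1 + ?a) * (ln t - ln ?a) \<partial>M) = ln (1 + ?a)"
      using *(2) *(3) prob_space by simp
    ultimately have "exp (ln (1 + ?a)) \<le> exp (\<integral>t. ln (t + 1) \<partial>M)" by simp
    then show ?thesis using a by simp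
  qed
  assume eq: "1 + ?a = exp (\<integral>t. ln (t + 1) \<partial>M)"
  show "AE t in M. t = ?a"
  proof (cases "?a = 0")
    case True
    then have "(\<integral>t. ln (t + 1) \<partial>M) = 0" using eq by simp
    then have "AE t in M. ln (t + 1) = 0"
      using int nn by (simp add: integral_nonneg_eq_0_iff_AE)
    then show ?thesis
      using AE by eventually_elim (simp add: True)
  next
    case False
    then have *: "AE t in M. 0 < t" "integrable M ln" "?a = exp (\<integral>t. ln t \<partial>M)"
      by (auto simp: geometric_mean_def split: if_splits)
    then have a: "0 < ?a" by simp
    define g where "g t = ln (t + 1) - (ln (1 + ?a) + ?a / (1 + ?a) * (ln t - ln ?a))" for t
    have ig: "integrable M g" unfolding g_def using * int by auto
    have g0: "AE t in M. 0 \<le> g t"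
      using *(1) by (rule eventually_mono) (use ln_one_plus_tangent(1) [OF a] in \<open>simp add: g_def\<close>)
    have "(\<integral>t. ln (1 + ?a) + ?a / (1 + ?a) * (ln t - ln ?a) \<partial>M) = ln (1 + ?a)"
      using *(2) *(3) prob_space by simp
    moreover have "(\<integral>t. ln (t + 1) \<partial>M) = ln (1 + ?a)" using eq by simp
    ultimately have "(\<integral>t. g t \<partial>M) = 0" unfolding g_def using int *(2) by simp
    then have "AE t in M. g t = 0" using ig g0 by (simp add: integral_nonneg_eq_0_iff_AE)
    then show ?thesis
      using *(1) by eventually_elim (rule ln_one_plus_tangent(2) [OF a], auto simp: g_def)
  qed
qed

lemma geometric_mean_const:
  assumes M: "real_distribution M" and c: "0 \<le> c" and AE: "AE t in M. t = c"
  shows "geometric_mean M = c" "(\<integral>t. ln (t + d) \<partial>M) = ln (c + d)"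
proof -
  interpret real_distribution M by fact
  have I: "(\<integral>t. ln (t + d) \<partial>M) = ln (c + d)" for d
  proof -
    have "(\<integral>t. ln (t + d) \<partial>M) = (\<integral>t. ln (c + d) \<partial>M)"
      by (rule integral_cong_AE) (use AE in \<open>auto elim!: eventually_mono\<close>)
    then show ?thesis using prob_space by simp
  qed
  show "(\<integral>t. ln (t + d) \<partial>M) = ln (c + d)" by (rule I)
  show "geometric_mean M = c"
  proof (cases "c = 0")
    case True
    have "\<not> (AE t in M. 0 < t)"
    proof
      assume "AE t in M. 0 < t"
      then have "AE t in M. False" using AE by eventually_elim (simp add: True)
      then show False using prob_space by (simp add: AE_False)
    qed
    then show ?thesis using True by (simp add: geometric_mean_def)
  next
    case False
    have "AE t in M. 0 < t" using AE by (rule eventually_mono) (use c False in auto)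
    moreover have "integrable M ln"
    proof (rule integrable_const_bound [of _ "\<bar>ln c\<bar>"])
      show "AE t in M. norm (ln t) \<le> \<bar>ln c\<bar>" using AE by (rule eventually_mono) simp
    qed measurable
    ultimately show ?thesis using I [of 0] c False by (simp add: geometric_mean_def)
  qed
qed

subsection \<open>Operator bounds\<close>

text \<open>The operator inequalities e \<le> X \<le> r. The numbers are recorded because the series
  below converge at the rate 1 - e/r.\<close>

definition op_between :: "real \<Rightarrow> real \<Rightarrow> 'h::chilbert_space op \<Rightarrow> bool" where
  "op_between e r X \<longleftrightarrow> sa X \<and> (\<forall>x. e * (norm x)\<^sup>2 \<le> Re (cinner (X x) x) \<and> Re (cinner (X x) x) \<le> r * (norm x)\<^sup>2)"

lemma op_between_sa: "op_between e r X \<Longrightarrow> sa X"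
  by (simp add: op_between_def)

lemma op_between_positive: "op_between e r X \<Longrightarrow> 0 \<le> e \<Longrightarrow> positive_op X"
  unfolding positive_op_iff op_between_def
  by (metis mult_nonneg_nonneg order_trans zero_le_power2)

lemma op_between_positive_bounded:
  assumes X: "op_between e r X" and e: "0 \<le> e" "0 < r"
  shows "positive_bounded X r"
proof
  show "positive_op X" by (rule op_between_positive [OF X e(1)])
  show "positive_op (r *\<^sub>R id_blinfun - X)"
    using X unfolding positive_op_iff op_between_def
    by (auto simp: blinfun.diff_left blinfun.scaleR_left cinner.diff_left cinner.scaleR_left Re_cinner_self
        intro!: sa_diff sa_scaleR)
qed (rule e)

lemma op_between_norm:
  assumes "positive_op X"
  shows "op_between 0 (norm X) X"
  using assms cinner_le_norm [of X] unfolding op_between_def positive_op_iff by (auto simp: abs_le_iff)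

lemma op_between_shift: "op_between e r X \<Longrightarrow> op_between (e + c) (r + c) (X + c *\<^sub>R id_blinfun)"
  by (auto simp: op_between_def blinfun.add_left blinfun.scaleR_left cinner.add_left cinner.scaleR_left
      Re_cinner_self algebra_simps intro!: sa_add sa_scaleR)

lemma op_between_mono:
  assumes "op_between e r X" "e' \<le> e" "r \<le> r'"
  shows "op_between e' r' X"
proof -
  have "e' * (norm x)\<^sup>2 \<le> e * (norm x)\<^sup>2" "r * (norm x)\<^sup>2 \<le> r' * (norm x)\<^sup>2" for x :: 'a
    using assms by (auto intro: mult_right_mono)
  then show ?thesis using assms(1) unfolding op_between_def by (meson order_trans)
qed

lemma op_between_segment:
  assumes X: "op_between e r X" and Z: "op_between e r Z" and t: "t \<in> {0..1}"
  shows "op_between e r (X + t *\<^sub>R (Z - X))"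
  unfolding op_between_def
proof (intro conjI allI)
  show "sa (X + t *\<^sub>R (Z - X))"
    using X Z by (intro sa_add sa_scaleR sa_diff) (auto simp: op_between_def)
  fix x
  define a where "a = Re (cinner (X x) x)"
  define b where "b = Re (cinner (Z x) x)"
  have eq: "Re (cinner ((X + t *\<^sub>R (Z - X)) x) x) = (1 - t) * a + t * b"
    by (simp add: a_def b_def blinfun.add_left blinfun.scaleR_left blinfun.diff_left cinner.add_left
        cinner.scaleR_left cinner.diff_left algebra_simps)
  have ab: "e * (norm x)\<^sup>2 \<le> a" "a \<le> r * (norm x)\<^sup>2" "e * (norm x)\<^sup>2 \<le> b" "b \<le> r * (norm x)\<^sup>2"
    using X Z by (auto simp: op_between_def a_def b_def)
  have t01: "0 \<le> t" "0 \<le> 1 - t" using t by auto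
  show "e * (norm x)\<^sup>2 \<le> Re (cinner ((X + t *\<^sub>R (Z - X)) x) x)"
    using mult_left_mono [OF ab(1) t01(2)] mult_left_mono [OF ab(3) t01(1)] unfolding eq
    by (simp add: left_diff_distrib)
  show "Re (cinner ((X + t *\<^sub>R (Z - X)) x) x) \<le> r * (norm x)\<^sup>2"
    using mult_left_mono [OF ab(2) t01(2)] mult_left_mono [OF ab(4) t01(1)] unfolding eq
    by (simp add: left_diff_distrib)
qed

text \<open>Unspecified unless \<open>X\<close> is invertible.\<close>

definition iv :: "'h::chilbert_space op \<Rightarrow> 'h op" where
  "iv X = (SOME B. bounded_op B \<and> X o\<^sub>L B = id_blinfun \<and> B o\<^sub>L X = id_blinfun)"

lemma iv:
  assumes "invertible_op X"
  shows "bounded_op (iv X)" "X o\<^sub>L iv X = id_blinfun" "iv X o\<^sub>L X = id_blinfun"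
  using someI_ex [OF assms [unfolded invertible_op_def]] by (simp_all add: iv_def)

lemma iv_eqI:
  assumes B: "bounded_op B" "X o\<^sub>L B = id_blinfun" "B o\<^sub>L X = id_blinfun"
  shows "iv X = B"
proof -
  have "invertible_op X" using B by (rule invertible_opI)
  then have "iv X o\<^sub>L X = id_blinfun" by (rule iv)
  then have "(iv X o\<^sub>L X) o\<^sub>L B = B" by simp
  then show ?thesis unfolding compose_assoc B(2) by simp
qed

text \<open>Scaling by the upper bound puts 1 - X/r between 0 and 1 - e/r, so one expansion point
  serves all operators with the same bounds.\<close>

lemma op_between_contraction:
  assumes X: "op_between e r X" and e: "0 < e" "e < r"
  shows "sa (id_blinfun - (1/r) *\<^sub>R X)" "norm (id_blinfun - (1/r) *\<^sub>R X) \<le> 1 - e/r"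
proof -
  show sa: "sa (id_blinfun - (1/r) *\<^sub>R X)"
    using X by (intro sa_diff sa_scaleR sa_id) (simp add: op_between_def)
  show "norm (id_blinfun - (1/r) *\<^sub>R X) \<le> 1 - e/r"
    using sa
  proof (rule sa_norm_le)
    show "0 \<le> 1 - e/r" using e by simp
    fix x
    have eq: "Re (cinner ((id_blinfun - (1/r) *\<^sub>R X) x) x) = (norm x)\<^sup>2 - Re (cinner (X x) x) / r"
      by (simp add: blinfun.scaleR_left blinfun.diff_left cinner.scaleR_left cinner.diff_left Re_cinner_self)
    have b: "e * (norm x)\<^sup>2 \<le> Re (cinner (X x) x)" "Re (cinner (X x) x) \<le> r * (norm x)\<^sup>2"
      using X by (auto simp: op_between_def)
    have 1: "(e * (norm x)\<^sup>2) / r \<le> Re (cinner (X x) x) / r"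
      by (rule divide_right_mono [OF b(1)]) (use e in simp)
    have "Re (cinner (X x) x) / r \<le> (r * (norm x)\<^sup>2) / r"
      by (rule divide_right_mono [OF b(2)]) (use e in simp)
    then have 2: "Re (cinner (X x) x) / r \<le> (norm x)\<^sup>2" using e by simp
    have 3: "(1 - e/r) * (norm x)\<^sup>2 = (norm x)\<^sup>2 - (e * (norm x)\<^sup>2) / r"
      by (simp add: left_diff_distrib)
    show "\<bar>Re (cinner ((id_blinfun - (1/r) *\<^sub>R X) x) x)\<bar> \<le> (1 - e/r) * (norm x)\<^sup>2"
      unfolding eq 3 using 1 2 by (simp only: abs_of_nonneg diff_ge_0_iff_ge)
  qed
qed

lemma op_between_Neumann:
  assumes X: "op_between e r X" and e: "0 < e" "e < r"
  shows "opow (id_blinfun - (1/r) *\<^sub>R X) sums (r *\<^sub>R iv X)" "invertible_op X"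
proof -
  let ?K = "id_blinfun - (1/r) *\<^sub>R X"
  have "norm ?K \<le> 1 - e/r" by (rule op_between_contraction [OF X e])
  also have "\<dots> < 1" using e by simp
  finally obtain B where B: "bounded_op B" "(id_blinfun - ?K) o\<^sub>L B = id_blinfun" "B o\<^sub>L (id_blinfun - ?K) = id_blinfun" "opow ?K sums B"
    using Neumann_series [of ?K] sa_bounded_op [OF op_between_contraction(1) [OF X e]] by blast
  have *: "bounded_op ((1/r) *\<^sub>R B)" "X o\<^sub>L ((1/r) *\<^sub>R B) = id_blinfun" "((1/r) *\<^sub>R B) o\<^sub>L X = id_blinfun"
    using B(1-3) by (auto intro!: bounded_op_scaleR simp: compose.scaleR_left compose.scaleR_right)
  then have "iv X = (1/r) *\<^sub>R B" by (rule iv_eqI)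
  then show "opow ?K sums (r *\<^sub>R iv X)" using B(4) e by simp
  show "invertible_op X" using * by (rule invertible_opI)
qed

lemma iv_positive:
  assumes X: "op_between e r X" and e: "0 < e" "e < r"
  shows "positive_op (iv X)"
proof -
  note i = iv [OF op_between_Neumann(2) [OF X e]]
  have "cinner (iv X y) y \<in> \<real>\<^sub>\<ge>\<^sub>0" for y
  proof -
    have "X (iv X y) = y" using i(2) by (metis blinfun_apply_blinfun_compose blinfun_apply_id_blinfun id_apply)
    then have "cinner (iv X y) y = cinner (X (iv X y)) (iv X y)"
      using sa_cinner [OF op_between_sa [OF X], of "iv X y" "iv X y"] by simp
    moreover have "positive_op X" using op_between_positive [OF X] e by simp
    ultimately show ?thesis by (simp add: positive_op_def)
  qed
  then show ?thesis using i(1) by (simp add: positive_op_def)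
qed

subsection \<open>Powers along a line\<close>

text \<open>A telescoping sum; A - B stays in the middle of each term since A and B need not
  commute.\<close>

lemma opow_diff: "opow A (Suc n) - opow B (Suc n) = (\<Sum>i\<le>n. opow A i o\<^sub>L (A - B) o\<^sub>L opow B (n - i))"
proof (induction n)
  case 0
  show ?case by (simp add: opow_Suc)
next
  case (Suc n)
  have "opow A (Suc (Suc n)) - opow B (Suc (Suc n)) = (opow A (Suc n) o\<^sub>L (A - B)) + ((opow A (Suc n) - opow B (Suc n)) o\<^sub>L B)"
    unfolding opow_Suc2 [of A "Suc n"] opow_Suc2 [of B "Suc n"] by (simp add: compose.diff_left compose.diff_right)
  also have "(opow A (Suc n) - opow B (Suc n)) o\<^sub>L B = (\<Sum>i\<le>n. opow A i o\<^sub>L (A - B) o\<^sub>L opow B (Suc n - i))"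
    unfolding Suc compose.sum_left
  proof (rule sum.cong [OF refl])
    fix i assume "i \<in> {..n}"
    then have "Suc n - i = Suc (n - i)" by auto
    then show "(opow A i o\<^sub>L (A - B) o\<^sub>L opow B (n - i)) o\<^sub>L B = opow A i o\<^sub>L (A - B) o\<^sub>L opow B (Suc n - i)"
      by (simp add: opow_Suc2 compose_assoc)
  qed
  finally show ?case by (simp add: add.commute)
qed

lemma opow_add: "opow A (m + n) = opow A m o\<^sub>L opow A n"
  by (induction m) (simp_all add: opow_Suc compose_assoc)

lemma opow_tendsto:
  assumes "(F \<longlongrightarrow> K) G"
  shows "((\<lambda>t. opow (F t) n) \<longlongrightarrow> opow K n) G"
  by (induction n) (auto simp: opow_Suc intro!: compose.tendsto assms)

context tracial_algebra begin

lemma iv_in_R: "X \<in> R \<Longrightarrow> invertible_op X \<Longrightarrow> iv X \<in> R"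
  using R_inverse iv by blast

text \<open>In the limit the telescoped difference quotient has n + 1 terms with K1 in different
  positions, and cyclicity of the trace makes them all equal.\<close>

lemma tr_opow_deriv:
  assumes K: "K0 \<in> R" "K1 \<in> R"
  shows "((\<lambda>s. tr (opow (K0 + s *\<^sub>R K1) (Suc n))) has_real_derivative
    real (Suc n) * tr (opow (K0 + t *\<^sub>R K1) n o\<^sub>L K1)) (at t within S)"
  unfolding has_field_derivative_iff
proof -
  define K where "K s = K0 + s *\<^sub>R K1" for s
  have KR: "K s \<in> R" for s unfolding K_def by (intro inR K)
  have eq: "(tr (opow (K s) (Suc n)) - tr (opow (K t) (Suc n))) / (s - t)
      = (\<Sum>i\<le>n. tr (opow (K s) i o\<^sub>L K1 o\<^sub>L opow (K t) (n - i)))" if "s \<noteq> t" for s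
  proof -
    have d: "K s - K t = (s - t) *\<^sub>R K1" by (simp add: K_def scaleR_diff_left)
    have "tr (opow (K s) (Suc n)) - tr (opow (K t) (Suc n)) = tr (opow (K s) (Suc n) - opow (K t) (Suc n))"
      by (intro tr_diff [symmetric] inR KR)
    also have "\<dots> = (\<Sum>i\<le>n. tr ((s - t) *\<^sub>R (opow (K s) i o\<^sub>L K1 o\<^sub>L opow (K t) (n - i))))"
      unfolding opow_diff d compose.scaleR_left compose.scaleR_right by (intro tr_sum inR KR K)
    also have "\<dots> = (s - t) * (\<Sum>i\<le>n. tr (opow (K s) i o\<^sub>L K1 o\<^sub>L opow (K t) (n - i)))"
      unfolding sum_distrib_left by (intro sum.cong refl tr_scaleR inR KR K)
    finally show ?thesis using that by simp
  qed
  have Kt: "(K \<longlongrightarrow> K t) (at t within S)"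
    unfolding K_def by (intro tendsto_intros)
  have "((\<lambda>s. \<Sum>i\<le>n. tr (opow (K s) i o\<^sub>L K1 o\<^sub>L opow (K t) (n - i))) \<longlongrightarrow>
      (\<Sum>i\<le>n. tr (opow (K t) i o\<^sub>L K1 o\<^sub>L opow (K t) (n - i)))) (at t within S)"
    by (intro tendsto_sum tr_tendsto always_eventually allI inR KR K compose.tendsto tendsto_const opow_tendsto Kt)
  also have "(\<Sum>i\<le>n. tr (opow (K t) i o\<^sub>L K1 o\<^sub>L opow (K t) (n - i))) = (\<Sum>i\<le>n. tr (opow (K t) n o\<^sub>L K1))"
  proof (rule sum.cong [OF refl])
    fix i assume i: "i \<in> {..n}"
    have "tr (opow (K t) i o\<^sub>L K1 o\<^sub>L opow (K t) (n - i)) = tr (opow (K t) (n - i) o\<^sub>L (opow (K t) i o\<^sub>L K1))"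
      by (intro tr_commute inR KR K)
    also have "opow (K t) (n - i) o\<^sub>L (opow (K t) i o\<^sub>L K1) = opow (K t) n o\<^sub>L K1"
      using i by (simp add: compose_assoc [symmetric] opow_add [symmetric])
    finally show "tr (opow (K t) i o\<^sub>L K1 o\<^sub>L opow (K t) (n - i)) = tr (opow (K t) n o\<^sub>L K1)" .
  qed
  also have "\<dots> = real (Suc n) * tr (opow (K t) n o\<^sub>L K1)" by simp
  finally have "((\<lambda>s. (tr (opow (K s) (Suc n)) - tr (opow (K t) (Suc n))) / (s - t)) \<longlongrightarrow>
      real (Suc n) * tr (opow (K t) n o\<^sub>L K1)) (at t within S)"
    by (rule Lim_transform_eventually) (auto simp: eventually_at_filter eq)
  then show "((\<lambda>s. (tr (opow (K0 + s *\<^sub>R K1) (Suc n)) - tr (opow (K0 + t *\<^sub>R K1) (Suc n))) / (s - t)) \<longlongrightarrow>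
      real (Suc n) * tr (opow (K0 + t *\<^sub>R K1) n o\<^sub>L K1)) (at t within S)"
    by (simp add: K_def)
qed

subsection \<open>The trace of the logarithm\<close>

text \<open>Meaningful only when \<open>X\<close> is bounded below, because \<open>ln 0 = 0\<close> in the library.\<close>

definition ell :: "'h op \<Rightarrow> real" where "ell X = (\<integral>t. ln t \<partial>induced_measure \<tau> X)"

lemma law_unique:
  assumes "positive_bounded A r" "A \<in> R" "law A r M" "positive_bounded A r'" "law A r' M'"
  shows "M = M'"
  using induced_measure_law [OF assms(1,2,3)] induced_measure_law [OF assms(4,2,5)] by simp

lemma ell_law: "positive_bounded A r \<Longrightarrow> A \<in> R \<Longrightarrow> law A r M \<Longrightarrow> ell A = (\<integral>t. ln t \<partial>M)"
  by (simp add: ell_def induced_measure_law)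

text \<open>A translation acts on polynomials by composition, hence on both kinds of moments
  alike.\<close>

lemma law_shift:
  assumes M: "law X r M" and c: "0 \<le> c"
  shows "law (X + c *\<^sub>R id_blinfun) (r + c) (distr M borel (\<lambda>t. t + c))"
proof -
  interpret M: real_distribution M using M by (simp add: law_def)
  have AE: "AE t in M. t \<in> {0..r}" using M by (simp add: law_def)
  show "law (X + c *\<^sub>R id_blinfun) (r + c) (distr M borel (\<lambda>t. t + c))"
    unfolding law_def
  proof (intro conjI allI)
    show "real_distribution (distr M borel (\<lambda>t. t + c))" by (rule M.real_distribution_distr) simp
    show "AE t in distr M borel (\<lambda>t. t + c). t \<in> {0..r + c}"
      using AE c by (subst AE_distr_iff) (auto elim!: eventually_mono)
    fix p
    have "(\<integral>t. poly p t \<partial>distr M borel (\<lambda>t. t + c)) = (\<integral>t. poly p (t + c) \<partial>M)"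
      by (rule integral_distr) auto
    also have "\<dots> = (\<integral>t. poly (pcompose p [:c, 1:]) t \<partial>M)"
      by (simp add: poly_pcompose add.commute)
    also have "\<dots> = tr (op_poly (pcompose p [:c, 1:]) X)" using M by (simp add: law_def)
    also have "op_poly (pcompose p [:c, 1:]) X = op_poly p (X + c *\<^sub>R id_blinfun)"
      unfolding op_poly_pcompose by (simp add: add.commute)
    finally show "(\<integral>t. poly p t \<partial>distr M borel (\<lambda>t. t + c)) = tr (op_poly p (X + c *\<^sub>R id_blinfun))" .
  qed
qed

text \<open>The moment problem only gives support in [0, r]. Shifting the operator down by e, taking
  its law there and shifting back improves the lower end.\<close>

lemma law_lower:
  assumes X: "op_between e r X" "X \<in> R" and e: "0 \<le> e" "e < r" and M: "law X r M"
  shows "AE t in M. t \<in> {e..r}"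
proof -
  define Y where "Y = X + (- e) *\<^sub>R id_blinfun"
  have Y: "positive_bounded Y (r - e)"
    unfolding Y_def using op_between_shift [OF X(1), of "- e"] e by (intro op_between_positive_bounded [of 0]) auto
  have YR: "Y \<in> R" unfolding Y_def using X by (intro inR)
  obtain L where L: "law Y (r - e) L" using law_exists [OF Y YR] .
  have "Y + e *\<^sub>R id_blinfun = X" by (simp add: Y_def)
  then have "law X r (distr L borel (\<lambda>t. t + e))" using law_shift [OF L e(1)] by simp
  moreover have "positive_bounded X r" using X e by (intro op_between_positive_bounded) auto
  ultimately have M_L: "M = distr L borel (\<lambda>t. t + e)" using law_unique X M by blast
  interpret L: real_distribution L using L by (simp add: law_def)
  have AE: "AE t in L. t \<in> {0..r - e}" using L by (simp add: law_def)
  have "AE t in L. t + e \<in> {e..r}" using AE by (rule eventually_mono) auto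
  then show ?thesis unfolding M_L by (subst AE_distr_iff) simp_all
qed

lemma law_ln_integrable:
  assumes X: "op_between e r X" "X \<in> R" and e: "0 < e" "e < r" and M: "law X r M"
  shows "integrable M ln"
proof -
  interpret M: real_distribution M using M by (simp add: law_def)
  have AE: "AE t in M. t \<in> {e..r}" using law_lower [OF X _ _ M] e by simp
  show ?thesis
  proof (rule M.integrable_const_bound [of _ "\<bar>ln e\<bar> + \<bar>ln r\<bar>"])
    show "AE t in M. norm (ln t) \<le> \<bar>ln e\<bar> + \<bar>ln r\<bar>"
      using AE
    proof (rule eventually_mono)
      fix t assume "t \<in> {e..r}"
      then have "ln e \<le> ln t" "ln t \<le> ln r" using e by auto
      then show "norm (ln t) \<le> \<bar>ln e\<bar> + \<bar>ln r\<bar>" by simp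
    qed
  qed measurable
qed

lemma ell_shift:
  assumes A: "positive_bounded A r" "A \<in> R" and M: "law A r M" and c: "0 \<le> c"
  shows "ell (A + c *\<^sub>R id_blinfun) = (\<integral>t. ln (t + c) \<partial>M)"
proof -
  interpret positive_bounded A r by fact
  have 1: "op_between 0 r A"
    using T Tr unfolding op_between_def positive_op_iff
    by (simp add: blinfun.diff_left blinfun.scaleR_left cinner.diff_left cinner.scaleR_left Re_cinner_self)
  have 2: "positive_bounded (A + c *\<^sub>R id_blinfun) (r + c)"
    using op_between_shift [OF 1, of c] c r by (intro op_between_positive_bounded [of "0 + c"]) auto
  have 3: "law (A + c *\<^sub>R id_blinfun) (r + c) (distr M borel (\<lambda>t. t + c))"
    by (rule law_shift [OF M c])
  have [measurable_cong]: "sets M = sets borel"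
    using M by (auto simp: law_def real_distribution_def real_distribution_axioms_def)
  show ?thesis
    using A by (simp add: ell_law [OF 2 _ 3] inR integral_distr)
qed

section \<open>The determinant on positive operators and the derivative of its logarithm\<close>

lemma fk_det_law:
  assumes A: "positive_bounded A r" "A \<in> R" and M: "law A r M"
  shows "fk_det \<tau> A = geometric_mean M"
proof -
  interpret positive_bounded A r by fact
  show ?thesis
    unfolding fk_det_def abs_op_positive [OF T] induced_measure_law [OF A M]
    by (rule log_integral_geometric_mean [OF _ _ r law_spectrum [OF A M]]) (use M in \<open>auto simp: law_def\<close>)
qed

lemma fk_det_ell:
  assumes X: "op_between e r X" "X \<in> R" and e: "0 < e" "e < r"
  shows "fk_det \<tau> X = exp (ell X)"
proof -
  have pb: "positive_bounded X r" using X e by (intro op_between_positive_bounded) auto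
  obtain M where M: "law X r M" using law_exists [OF pb X(2)] .
  interpret M: real_distribution M using M by (simp add: law_def)
  have AE: "AE t in M. t \<in> {e..r}" using law_lower [OF X _ _ M] e by simp
  have "AE t in M. 0 < t" using AE by (rule eventually_mono) (use e in auto)
  moreover have "integrable M ln" by (rule law_ln_integrable [OF X e M])
  ultimately show ?thesis
    by (simp add: fk_det_law [OF pb X(2) M] geometric_mean_def ell_law [OF pb X(2) M])
qed

lemma fk_det_limit:
  assumes A: "positive_op A" "A \<in> R" and d: "decseq d" "\<And>n. 0 < d n" "d \<longlonglongrightarrow> 0"
  shows "(\<lambda>n. exp (ell (A + d n *\<^sub>R id_blinfun))) \<longlonglongrightarrow> fk_det \<tau> A"
proof -
  have pb: "positive_bounded A (norm A + 1)"
    using A by (intro positive_boundedI) (auto simp: add_nonneg_pos)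
  obtain M where M: "law A (norm A + 1) M" using law_exists [OF pb A(2)] .
  have "(\<lambda>n. exp (\<integral>t. ln (t + d n) \<partial>M)) \<longlonglongrightarrow> geometric_mean M"
    using M by (intro geometric_mean_limit [of M "norm A + 1"] d) (auto simp: law_def add_nonneg_pos)
  then show ?thesis
    using d(2) by (simp add: ell_shift [OF pb A(2) M] fk_det_law [OF pb A(2) M] less_imp_le)
qed

lemma op_poly_power: "op_poly (p ^ n) X = opow (op_poly p X) n"
  by (induction n) (simp_all add: opow_Suc)

text \<open>Expanding ln about r expresses the trace of the logarithm through traces of powers, a
  form that can be differentiated term by term without an operator logarithm.\<close>

lemma ell_series:
  assumes X: "op_between e r X" "X \<in> R" and e: "0 < e" "e < r"
  shows "(\<lambda>k. tr (opow (id_blinfun - (1/r) *\<^sub>R X) (Suc k)) / real (Suc k)) sums (ln r - ell X)"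
proof -
  have pb: "positive_bounded X r" using X e by (intro op_between_positive_bounded) auto
  obtain M where M: "law X r M" using law_exists [OF pb X(2)] .
  interpret M: real_distribution M using M by (simp add: law_def)
  have AE: "AE t in M. t \<in> {e..r}" using law_lower [OF X _ _ M] e by simp
  define q where "q = 1 - e/r"
  have q: "0 < q" "q < 1" using e by (auto simp: q_def)
  define f where "f k t = (1 - t/r) ^ Suc k / real (Suc k)" for k and t :: real
  have [measurable]: "f k \<in> borel_measurable borel" for k unfolding f_def by measurable
  have fle: "AE t in M. \<bar>f k t\<bar> \<le> q ^ k" for k
    using AE
  proof (rule eventually_mono)
    fix t assume t: "t \<in> {e..r}"
    have s: "0 \<le> 1 - t/r" "1 - t/r \<le> q" using t e by (auto simp: q_def divide_right_mono)
    have "\<bar>f k t\<bar> = (1 - t/r) ^ Suc k / real (Suc k)" using s by (simp add: f_def)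
    also have "\<dots> \<le> (1 - t/r) ^ Suc k / 1" using s by (intro divide_left_mono) auto
    also have "\<dots> \<le> q ^ Suc k" using s power_mono [of "1 - t/r" q "Suc k"] by simp
    also have "\<dots> \<le> q ^ k" using q by (simp add: mult_left_le_one_le)
    finally show "\<bar>f k t\<bar> \<le> q ^ k" .
  qed
  have fint: "integrable M (f k)" for k
    by (rule M.integrable_const_bound [of _ "q ^ k"]) (use fle in auto)
  have gs: "summable (\<lambda>k. q ^ k)" using q by (intro summable_geometric) simp
  have fsums: "(\<lambda>k. f k t) sums (ln r - ln t)" if t: "t \<in> {e..r}" for t
  proof -
    have "0 < t / r" "t / r \<le> 1" using t e by auto
    then have "\<bar>t / r - 1\<bar> < 1" by (simp add: abs_less_iff)
    then have "(\<lambda>n. - ((- (t / r - 1)) ^ n) / real n) sums ln (1 + (t / r - 1))"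
      by (rule ln_series')
    then have "(\<lambda>n. - ((1 - t / r) ^ n) / real n) sums ln (t / r)" by simp
    \<comment> \<open>The dropped term at n = 0 is a division by 0, hence 0.\<close>
    then have "(\<lambda>n. - ((1 - t / r) ^ Suc n) / real (Suc n)) sums ln (t / r)"
      by (subst sums_Suc_iff) simp
    then have "(\<lambda>n. - (- ((1 - t / r) ^ Suc n) / real (Suc n))) sums - ln (t / r)"
      by (rule sums_minus)
    then show ?thesis using t e by (simp add: f_def ln_div del: power_Suc of_nat_Suc)
  qed
  have "(\<lambda>k. \<integral>t. f k t \<partial>M) sums (\<integral>t. (\<Sum>k. f k t) \<partial>M)"
  proof (rule sums_integral [OF fint])
    show "AE t in M. summable (\<lambda>k. norm (f k t))"
    proof -
      have "AE t in M. \<forall>k. \<bar>f k t\<bar> \<le> q ^ k" using fle by (simp add: AE_all_countable)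
      then show ?thesis
        by (rule eventually_mono) (auto intro!: summable_comparison_test' [OF gs])
    qed
    show "summable (\<lambda>k. \<integral>t. norm (f k t) \<partial>M)"
    proof (rule summable_comparison_test' [OF gs])
      fix k
      have "(\<integral>t. norm (f k t) \<partial>M) \<le> (\<integral>t. q ^ k \<partial>M)"
        using fint fle [of k] by (intro integral_mono_AE) auto
      then show "norm (\<integral>t. norm (f k t) \<partial>M) \<le> q ^ k" using M.prob_space by simp
    qed
  qed
  also have "(\<integral>t. (\<Sum>k. f k t) \<partial>M) = (\<integral>t. ln r - ln t \<partial>M)"
  proof (rule integral_cong_AE)
    show "AE t in M. (\<Sum>k. f k t) = ln r - ln t"
      using AE by (rule eventually_mono) (use fsums in \<open>auto simp: sums_iff\<close>)
  qed measurable
  also have "\<dots> = ln r - ell X"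
  proof -
    have "integrable M ln" by (rule law_ln_integrable [OF X e M])
    then show ?thesis using M.prob_space by (simp add: ell_law [OF pb X(2) M])
  qed
  finally have series: "(\<lambda>k. \<integral>t. f k t \<partial>M) sums (ln r - ell X)" .
  have moment: "(\<integral>t. f k t \<partial>M) = tr (opow (id_blinfun - (1/r) *\<^sub>R X) (Suc k)) / real (Suc k)" for k
  proof -
    have "(\<integral>t. f k t \<partial>M) = (\<integral>t. poly ([:1, - (1/r):] ^ Suc k) t \<partial>M) / real (Suc k)"
      by (simp add: f_def poly_power del: power_Suc of_nat_Suc)
    also have "(\<integral>t. poly ([:1, - (1/r):] ^ Suc k) t \<partial>M) = tr (op_poly ([:1, - (1/r):] ^ Suc k) X)"
      using M by (simp only: law_def)
    also have "op_poly ([:1, - (1/r):] ^ Suc k) X = opow (id_blinfun - (1/r) *\<^sub>R X) (Suc k)"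
      unfolding op_poly_power by (simp add: compose.minus_right compose.scaleR_right)
    finally show ?thesis .
  qed
  show ?thesis using series unfolding moment .
qed

text \<open>Differentiating \<open>ell_series\<close> cancels the denominators, and what remains is
  the Neumann series of the inverse composed with the direction Y.\<close>

lemma ell_deriv:
  assumes XY: "X \<in> R" "Y \<in> R" and b: "\<And>t. t \<in> {0..1} \<Longrightarrow> op_between e r (X + t *\<^sub>R Y)" and e: "0 < e" "e < r"
    and t: "t \<in> {0..1}"
  shows "((\<lambda>t. ell (X + t *\<^sub>R Y)) has_real_derivative tr (iv (X + t *\<^sub>R Y) o\<^sub>L Y)) (at t within {0..1})"
proof -
  define K0 where "K0 = id_blinfun - (1/r) *\<^sub>R X"
  define K1 where "K1 = - ((1/r) *\<^sub>R Y)"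
  have K01: "K0 \<in> R" "K1 \<in> R" unfolding K0_def K1_def by (intro inR XY)+
  have K: "K0 + s *\<^sub>R K1 = id_blinfun - (1/r) *\<^sub>R (X + s *\<^sub>R Y)" for s
    by (simp add: K0_def K1_def scaleR_add_right)
  define f where "f n s = tr (opow (K0 + s *\<^sub>R K1) (Suc n)) / real (Suc n)" for n s
  define f' where "f' n s = tr (opow (K0 + s *\<^sub>R K1) n o\<^sub>L K1)" for n s
  define q where "q = 1 - e/r"
  have q: "0 < q" "q < 1" using e by (auto simp: q_def)
  have fd: "(f n has_real_derivative f' n s) (at s within {0..1})" for n s
    unfolding f_def f'_def
    by (rule DERIV_cong [OF DERIV_cdivide [OF tr_opow_deriv [OF K01]]]) simp
  have f'le: "norm (f' n s) \<le> q ^ n * norm K1" if s: "s \<in> {0..1}" for n s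
  proof -
    have nK: "norm (K0 + s *\<^sub>R K1) \<le> q"
      unfolding K q_def by (rule op_between_contraction(2) [OF b [OF s] e])
    have "norm (f' n s) \<le> norm (opow (K0 + s *\<^sub>R K1) n o\<^sub>L K1)"
      unfolding f'_def real_norm_def by (intro tr_le_norm inR K01)
    also have "\<dots> \<le> norm (opow (K0 + s *\<^sub>R K1) n) * norm K1" by (rule norm_blinfun_compose)
    also have "\<dots> \<le> norm (K0 + s *\<^sub>R K1) ^ n * norm K1" by (intro mult_right_mono norm_opow_le) simp
    also have "\<dots> \<le> q ^ n * norm K1"
      by (intro mult_right_mono power_mono nK) auto
    finally show ?thesis .
  qed
  \<comment> \<open>The M-test needs one ratio q for the whole segment, which the common bounds e
    and r provide.\<close>
  have ul: "uniform_limit {0..1} (\<lambda>n s. \<Sum>i<n. f' i s) (\<lambda>s. \<Sum>i. f' i s) sequentially"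
    by (rule Weierstrass_m_test [OF f'le]) (use q in \<open>auto intro!: summable_mult2 summable_geometric\<close>)
  have fs: "(\<lambda>n. f n s) sums (ln r - ell (X + s *\<^sub>R Y))" if s: "s \<in> {0..1}" for s
    unfolding f_def K by (rule ell_series [OF b [OF s] _ e]) (intro inR XY)
  obtain g where g: "\<And>s. s \<in> {0..1} \<Longrightarrow> (\<lambda>n. f n s) sums g s"
    "\<And>s. s \<in> {0..1} \<Longrightarrow> (g has_field_derivative (\<Sum>i. f' i s)) (at s within {0..1})"
    using has_field_derivative_series [OF _ fd ul t] fs [OF t] by (auto simp: sums_iff)
  have geq: "g s = ln r - ell (X + s *\<^sub>R Y)" if "s \<in> {0..1}" for s
    using g(1) [OF that] fs [OF that] sums_unique2 by blast
  have "opow (K0 + t *\<^sub>R K1) sums (r *\<^sub>R iv (X + t *\<^sub>R Y))"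
    unfolding K by (rule op_between_Neumann [OF b [OF t] e])
  then have "(\<lambda>n. opow (K0 + t *\<^sub>R K1) n o\<^sub>L K1) sums ((r *\<^sub>R iv (X + t *\<^sub>R Y)) o\<^sub>L K1)"
    by (rule bounded_linear.sums [OF compose.bounded_linear_left])
  then have "(\<lambda>n. f' n t) sums tr ((r *\<^sub>R iv (X + t *\<^sub>R Y)) o\<^sub>L K1)"
    unfolding f'_def by (intro tr_sums(2) inR K01)
  also have "(r *\<^sub>R iv (X + t *\<^sub>R Y)) o\<^sub>L K1 = - (iv (X + t *\<^sub>R Y) o\<^sub>L Y)"
    using e by (simp add: K1_def compose.scaleR_left compose.scaleR_right compose.minus_right)
  also have "tr (- (iv (X + t *\<^sub>R Y) o\<^sub>L Y)) = - tr (iv (X + t *\<^sub>R Y) o\<^sub>L Y)"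
    by (intro tr_minus inR XY iv_in_R op_between_Neumann(2) [OF b [OF t] e])
  finally have sum: "(\<Sum>i. f' i t) = - tr (iv (X + t *\<^sub>R Y) o\<^sub>L Y)" by (simp add: sums_iff)
  have "((\<lambda>s. ln r - g s) has_real_derivative (0 - (\<Sum>i. f' i t))) (at t within {0..1})"
    by (intro DERIV_diff DERIV_const g(2) t)
  then have "((\<lambda>s. ell (X + s *\<^sub>R Y)) has_real_derivative (0 - (\<Sum>i. f' i t))) (at t within {0..1})"
    by (rule has_field_derivative_transform_within [of _ _ _ _ 1]) (use t geq in auto)
  then show ?thesis by (simp add: sum)
qed

text \<open>By the mean value theorem the difference is the trace of a product of two positive
  operators, an inverse and Z - X.\<close>

lemma ell_mono:
  assumes X: "op_between e r X" "X \<in> R" and Z: "op_between e r Z" "Z \<in> R" and e: "0 < e" "e < r"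
    and XZ: "positive_op (Z - X)"
  shows "ell X \<le> ell Z"
proof -
  define Y where "Y = Z - X"
  have YR: "Y \<in> R" unfolding Y_def by (intro inR X Z)
  have b: "op_between e r (X + t *\<^sub>R Y)" if "t \<in> {0..1}" for t
    unfolding Y_def by (rule op_between_segment [OF X(1) Z(1) that])
  have "\<exists>t\<in>{0..1}. ell (X + 1 *\<^sub>R Y) - ell (X + 0 *\<^sub>R Y) = tr (iv (X + t *\<^sub>R Y) o\<^sub>L Y) * (1 - 0)"
    by (rule mvt_very_simple) (use ell_deriv [OF X(2) YR b e] in \<open>auto simp: has_field_derivative_def\<close>)
  then obtain t where t: "t \<in> {0..1}" "ell (X + 1 *\<^sub>R Y) - ell (X + 0 *\<^sub>R Y) = tr (iv (X + t *\<^sub>R Y) o\<^sub>L Y)"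
    by auto
  have "0 \<le> tr (iv (X + t *\<^sub>R Y) o\<^sub>L Y)"
    using XZ unfolding Y_def [symmetric]
    by (intro tr_product_nonneg iv_positive [OF b [OF t(1)] e] iv_in_R op_between_Neumann(2) [OF b [OF t(1)] e] inR X YR)
  then show ?thesis using t(2) by (simp add: Y_def)
qed

text \<open>The second moment about c is the trace of the square of X - c, and faithfulness detects
  whether this square is 0.\<close>

lemma law_scalar:
  assumes X: "positive_bounded X r" "X \<in> R" and M: "law X r M"
  shows "X = c *\<^sub>R id_blinfun \<longleftrightarrow> (AE t in M. t = c)"
proof -
  interpret positive_bounded X r by fact
  interpret M: real_distribution M using M by (simp add: law_def)
  have AE: "AE t in M. t \<in> {0..r}" using M by (simp add: law_def)
  define Y where "Y = X - c *\<^sub>R id_blinfun"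
  have saY: "sa Y" unfolding Y_def by (intro bop saT)
  have YR: "Y \<in> R" unfolding Y_def by (intro inR X)
  define p where "p = [:- c, 1::real:]"
  have pY: "op_poly p X = Y" by (simp add: p_def Y_def)
  have I: "(\<integral>t. (t - c)\<^sup>2 \<partial>M) = tr (Y o\<^sub>L Y)"
  proof -
    have "(\<integral>t. (t - c)\<^sup>2 \<partial>M) = (\<integral>t. poly (p * p) t \<partial>M)" by (simp add: p_def power2_eq_square algebra_simps)
    also have "\<dots> = tr (op_poly (p * p) X)" using M by (simp only: law_def)
    finally show ?thesis by (simp add: pY)
  qed
  have int: "integrable M (\<lambda>t. (t - c)\<^sup>2)"
  proof (rule M.integrable_const_bound [of _ "(r + \<bar>c\<bar>)\<^sup>2"])
    show "AE t in M. norm ((t - c)\<^sup>2) \<le> (r + \<bar>c\<bar>)\<^sup>2"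
      using AE by (rule eventually_mono) (auto simp: abs_le_square_iff [symmetric])
  qed measurable
  have "Y = 0 \<longleftrightarrow> tr (Y o\<^sub>L Y) = 0"
    using tr_faithful [OF positive_op_square [OF saY]] sa_compose_self_0 [OF saY] YR by (auto simp: inR)
  also have "\<dots> \<longleftrightarrow> (AE t in M. (t - c)\<^sup>2 = 0)"
    unfolding I [symmetric] using int by (intro integral_nonneg_eq_0_iff_AE) auto
  finally show ?thesis by (simp add: Y_def)
qed

lemma ell_id: "ell id_blinfun = 0"
proof -
  have pb: "positive_bounded id_blinfun 2"
    by (intro positive_boundedI) (auto intro: order_trans [OF norm_blinfun_id_le])
  obtain M where M: "law id_blinfun 2 M" using law_exists [OF pb] by auto
  have "AE t in M. t = 1" using law_scalar [OF pb _ M, of 1] by simp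
  then have "(\<integral>t. ln (t + 0) \<partial>M) = ln (1 + 0)"
    using M by (intro geometric_mean_const(2)) (auto simp: law_def)
  then show ?thesis using ell_law [OF pb _ M] by simp
qed

section \<open>Multiplicativity under sandwiching\<close>

text \<open>The lower bound survives because S has the left inverse S', which bounds the norm of x
  by that of S x; the added 1 keeps the denominator positive.\<close>

lemma op_between_sandwich:
  assumes S: "sa S" and S': "S' o\<^sub>L S = id_blinfun" and C: "op_between e r C" and e: "0 < e" "0 \<le> r"
  shows "op_between (e / ((norm S')\<^sup>2 + 1)) (r * (norm S)\<^sup>2) (S o\<^sub>L C o\<^sub>L S)"
  unfolding op_between_def
proof (intro conjI allI)
  show "sa (S o\<^sub>L C o\<^sub>L S)" by (intro sa_sandwich S op_between_sa [OF C])
  fix x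
  have eq: "Re (cinner ((S o\<^sub>L C o\<^sub>L S) x) x) = Re (cinner (C (S x)) (S x))"
    by (simp add: sa_cinner [OF S])
  have "norm x = norm (S' (S x))" using S' by (metis blinfun_apply_blinfun_compose blinfun_apply_id_blinfun id_apply)
  also have "\<dots> \<le> norm S' * norm (S x)" by (rule norm_blinfun)
  finally have "(norm x)\<^sup>2 \<le> (norm S' * norm (S x))\<^sup>2" by (intro power_mono) auto
  also have "\<dots> \<le> ((norm S')\<^sup>2 + 1) * (norm (S x))\<^sup>2" by (simp add: power_mult_distrib distrib_right)
  finally have 1: "(norm x)\<^sup>2 / ((norm S')\<^sup>2 + 1) \<le> (norm (S x))\<^sup>2"
    by (simp add: pos_divide_le_eq add_nonneg_pos mult.commute)
  have "e / ((norm S')\<^sup>2 + 1) * (norm x)\<^sup>2 = e * ((norm x)\<^sup>2 / ((norm S')\<^sup>2 + 1))" by simp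
  also have "\<dots> \<le> e * (norm (S x))\<^sup>2" using 1 e by (intro mult_left_mono) auto
  also have "\<dots> \<le> Re (cinner (C (S x)) (S x))" using C by (simp add: op_between_def)
  finally show "e / ((norm S')\<^sup>2 + 1) * (norm x)\<^sup>2 \<le> Re (cinner ((S o\<^sub>L C o\<^sub>L S) x) x)" unfolding eq .
  have "Re (cinner (C (S x)) (S x)) \<le> r * (norm (S x))\<^sup>2" using C by (simp add: op_between_def)
  also have "\<dots> \<le> r * (norm S * norm x)\<^sup>2" using e by (intro mult_left_mono power_mono norm_blinfun) auto
  finally show "Re (cinner ((S o\<^sub>L C o\<^sub>L S) x) x) \<le> r * (norm S)\<^sup>2 * (norm x)\<^sup>2"
    unfolding eq by (simp add: power_mult_distrib mult.assoc)
qed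

text \<open>Up to the constant \<open>ell (S o\<^sub>L S)\<close>, both sides have the same derivative along the segment from the identity to \<open>C\<close>.\<close>

lemma ell_sandwich:
  assumes S: "sa S" "S \<in> R" and S': "bounded_op S'" "S o\<^sub>L S' = id_blinfun" "S' o\<^sub>L S = id_blinfun"
    and C: "op_between d b C" "C \<in> R" and d: "0 < d"
  shows "ell (S o\<^sub>L C o\<^sub>L S) = ell (S o\<^sub>L S) + ell C"
proof -
  \<comment> \<open>Common bounds for the identity and \<open>C\<close>, hence for the segment
    between them; the 2 in \<open>r\<close> keeps it strictly above \<open>m\<close>.\<close>
  define m where "m = min 1 d"
  define r where "r = max 2 (b + 1)"
  have m: "0 < m" "m < r" using d by (auto simp: m_def r_def)
  have bC: "op_between m r C" by (rule op_between_mono [OF C(1)]) (auto simp: m_def r_def)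
  have "op_between 1 1 (id_blinfun :: 'h op)" by (simp add: op_between_def Re_cinner_self)
  then have bid: "op_between m r (id_blinfun :: 'h op)" by (rule op_between_mono) (auto simp: m_def r_def)
  define Y where "Y = C - id_blinfun"
  have YR: "Y \<in> R" unfolding Y_def by (intro inR C)
  have S'R: "S' \<in> R" by (rule R_inverse [OF S(2) S'])
  have b1: "op_between m r (id_blinfun + t *\<^sub>R Y)" if "t \<in> {0..1}" for t
    unfolding Y_def by (rule op_between_segment [OF bid bC that])
  define m2 where "m2 = m / ((norm S')\<^sup>2 + 1)"
  \<comment> \<open>The added terms ensure m2 < r2.\<close>
  define r2 where "r2 = r * (norm S)\<^sup>2 + m2 + 1"
  have m2: "0 < m2" "m2 < r2" using m by (auto simp: m2_def r2_def add_nonneg_pos intro!: add_nonneg_pos)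
  have SCS: "S o\<^sub>L (id_blinfun + t *\<^sub>R Y) o\<^sub>L S = (S o\<^sub>L S) + t *\<^sub>R (S o\<^sub>L Y o\<^sub>L S)" for t
    by (simp add: compose.add_left compose.add_right compose.scaleR_left compose.scaleR_right)
  have b2: "op_between m2 r2 ((S o\<^sub>L S) + t *\<^sub>R (S o\<^sub>L Y o\<^sub>L S))" if "t \<in> {0..1}" for t
  proof -
    have "op_between m2 (r * (norm S)\<^sup>2) (S o\<^sub>L (id_blinfun + t *\<^sub>R Y) o\<^sub>L S)"
      unfolding m2_def using m by (intro op_between_sandwich S S' b1 that) auto
    then show ?thesis unfolding SCS by (rule op_between_mono) (use m2 in \<open>auto simp: r2_def\<close>)
  qed
  define \<phi> where "\<phi> t = ell ((S o\<^sub>L S) + t *\<^sub>R (S o\<^sub>L Y o\<^sub>L S)) - ell (id_blinfun + t *\<^sub>R Y)" for t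
  have deriv: "(\<phi> has_real_derivative 0) (at t within {0..1})" if t: "t \<in> {0..1}" for t
  proof -
    define Ct where "Ct = id_blinfun + t *\<^sub>R Y"
    have CtR: "Ct \<in> R" unfolding Ct_def by (intro inR YR)
    have inv: "invertible_op Ct" unfolding Ct_def by (rule op_between_Neumann(2) [OF b1 [OF t] m])
    have ivR: "iv Ct \<in> R" by (intro iv_in_R CtR inv)
    have ivS: "iv (S o\<^sub>L Ct o\<^sub>L S) = S' o\<^sub>L iv Ct o\<^sub>L S'"
    proof (rule iv_eqI)
      show "bounded_op (S' o\<^sub>L iv Ct o\<^sub>L S')" by (intro bop S' iv(1) inv)
      show "(S o\<^sub>L Ct o\<^sub>L S) o\<^sub>L (S' o\<^sub>L iv Ct o\<^sub>L S') = id_blinfun"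
        by (metis S'(2) iv(2) [OF inv] compose_assoc compose_id(1))
      show "(S' o\<^sub>L iv Ct o\<^sub>L S') o\<^sub>L (S o\<^sub>L Ct o\<^sub>L S) = id_blinfun"
        by (metis S'(3) iv(3) [OF inv] compose_assoc compose_id(1))
    qed
    \<comment> \<open>The inner pair S' S cancels here and the outer pair after the cyclic move,
      leaving the derivative along the unsandwiched path.\<close>
    have "(S' o\<^sub>L iv Ct o\<^sub>L S') o\<^sub>L (S o\<^sub>L Y o\<^sub>L S) = S' o\<^sub>L ((iv Ct o\<^sub>L Y) o\<^sub>L S)"
      by (metis S'(3) compose_assoc compose_id(1))
    then have "tr (iv (S o\<^sub>L Ct o\<^sub>L S) o\<^sub>L (S o\<^sub>L Y o\<^sub>L S)) = tr (S' o\<^sub>L ((iv Ct o\<^sub>L Y) o\<^sub>L S))"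
      unfolding ivS by simp
    also have "\<dots> = tr (((iv Ct o\<^sub>L Y) o\<^sub>L S) o\<^sub>L S')"
      by (intro tr_commute inR S'R ivR YR S)
    also have "((iv Ct o\<^sub>L Y) o\<^sub>L S) o\<^sub>L S' = iv Ct o\<^sub>L Y"
      by (metis S'(2) compose_assoc compose_id(1))
    finally have "tr (iv ((S o\<^sub>L S) + t *\<^sub>R (S o\<^sub>L Y o\<^sub>L S)) o\<^sub>L (S o\<^sub>L Y o\<^sub>L S)) - tr (iv (id_blinfun + t *\<^sub>R Y) o\<^sub>L Y) = 0"
      by (simp add: Ct_def SCS)
    moreover have "(\<phi> has_real_derivative (tr (iv ((S o\<^sub>L S) + t *\<^sub>R (S o\<^sub>L Y o\<^sub>L S)) o\<^sub>L (S o\<^sub>L Y o\<^sub>L S)) - tr (iv (id_blinfun + t *\<^sub>R Y) o\<^sub>L Y))) (at t within {0..1})"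
      unfolding \<phi>_def by (intro DERIV_diff ell_deriv [OF _ _ b2 m2 t] ell_deriv [OF _ _ b1 m t] inR S YR)
    ultimately show ?thesis by simp
  qed
  have "\<exists>t\<in>{0..1::real}. \<phi> 1 - \<phi> 0 = 0 * (1 - 0 :: real)"
    by (rule mvt_very_simple [where f' = "\<lambda>_. (*) 0"]) (use deriv in \<open>auto simp: has_field_derivative_def\<close>)
  then have "\<phi> 1 = \<phi> 0" by auto
  moreover have "(S o\<^sub>L S) + 1 *\<^sub>R (S o\<^sub>L Y o\<^sub>L S) = S o\<^sub>L C o\<^sub>L S"
    unfolding SCS [symmetric] by (simp add: Y_def)
  ultimately show ?thesis by (simp add: \<phi>_def ell_id Y_def)
qed

end

section \<open>Superadditivity and the case of equality\<close>

context tracial_algebra begin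

text \<open>Condenses the operator theory into one measure M, the law of C, so that both final
  claims concern numbers only. \<open>ell_sandwich\<close> covers A + d B for d > 0; the formula for
  A itself is a limit because C need not be bounded below.\<close>

lemma fk_det_add_invertible:
  assumes A: "positive_op A" "A \<in> R" and B: "positive_op B" "B \<in> R" and inv: "invertible_op B"
  obtains M r where "real_distribution M" "AE t in M. t \<in> {0..r}"
    "fk_det \<tau> A = fk_det \<tau> B * geometric_mean M"
    "fk_det \<tau> (A + B) = fk_det \<tau> B * exp (\<integral>t. ln (t + 1) \<partial>M)"
    "0 < fk_det \<tau> B" "\<And>c. (AE t in M. t = c) \<longleftrightarrow> A = c *\<^sub>R B"
proof -
  obtain S where S: "positive_op S" "S o\<^sub>L S = B" "S \<in> R" using R_square_root [OF B] .
  have saS: "sa S" by (rule positive_op_sa [OF S(1)])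
  \<comment> \<open>The inverse of the square root, written with the inverse of \<open>B\<close>
    because no inverse of \<open>S\<close> is at hand yet.\<close>
  define S' where "S' = S o\<^sub>L iv B"
  have bS': "bounded_op S'" unfolding S'_def by (intro bop sa_bounded_op saS iv inv)
  have SS': "S o\<^sub>L S' = id_blinfun"
    unfolding S'_def compose_assoc [symmetric] S(2) by (rule iv(2) [OF inv])
  have "(iv B o\<^sub>L S) o\<^sub>L S = id_blinfun"
    unfolding compose_assoc S(2) by (rule iv(3) [OF inv])
  then have S'S: "S' o\<^sub>L S = id_blinfun"
    by (metis SS' compose_assoc compose_id)
  have S'R: "S' \<in> R" by (rule R_inverse [OF S(3) bS' SS' S'S])
  have saS': "sa S'"
  proof -
    have "adj S' o\<^sub>L S = id_blinfun"
      using adj_compose [OF sa_bounded_op [OF saS] bS'] by (simp add: SS' sa_adj [OF saS] sa_adj [OF sa_id])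
    \<comment> \<open>A left inverse and a right inverse of \<open>S\<close> coincide.\<close>
    then have "adj S' = S'" by (metis SS' compose_assoc compose_id)
    then show ?thesis using bS' by (simp add: sa_iff_adj)
  qed
  define C where "C = S' o\<^sub>L A o\<^sub>L S'"
  have C: "positive_op C" "C \<in> R" unfolding C_def by (intro positive_op_sandwich saS' A inR S'R)+
  have SCS: "S o\<^sub>L C o\<^sub>L S = A"
    unfolding C_def by (metis S'S SS' compose_assoc compose_id)
  define r where "r = norm C + 1"
  have r: "0 < r" by (simp add: r_def add_nonneg_pos)
  have pbC: "positive_bounded C r" unfolding r_def using C by (intro positive_boundedI) (auto simp: add_nonneg_pos)
  obtain M where M: "law C r M" using law_exists [OF pbC C(2)] .
  have bC: "op_between 0 (norm C) C" by (rule op_between_norm [OF C(1)])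
  have bCd: "op_between d (norm C + d) (C + d *\<^sub>R id_blinfun)" for d
    using op_between_shift [OF bC, of d] by simp
  have one: "op_between 1 1 (id_blinfun :: 'h op)" by (simp add: op_between_def Re_cinner_self)
  define e where "e = 1 / ((norm S')\<^sup>2 + 1)"
  have e: "0 < e" by (simp add: e_def add_nonneg_pos)
  have bB: "op_between e ((norm S)\<^sup>2) B"
    using op_between_sandwich [OF saS S'S one] by (simp add: e_def S(2))
  \<comment> \<open>Enlarged so that the lower bound is strictly below the upper one.\<close>
  have bBr: "op_between e ((norm S)\<^sup>2 + e + 1) B" by (rule op_between_mono [OF bB]) (use e in auto)
  have detB: "fk_det \<tau> B = exp (ell B)"
    using e by (intro fk_det_ell [OF bBr B(2)]) (auto simp: add_nonneg_pos)
  have ell_eq: "ell (A + d *\<^sub>R B) = ell B + (\<integral>t. ln (t + d) \<partial>M)" if d: "0 < d" for d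
  proof -
    have "S o\<^sub>L (C + d *\<^sub>R id_blinfun) o\<^sub>L S = A + d *\<^sub>R B"
      by (simp add: compose.add_left compose.add_right compose.scaleR_left compose.scaleR_right SCS S(2))
    then have "ell (A + d *\<^sub>R B) = ell (S o\<^sub>L S) + ell (C + d *\<^sub>R id_blinfun)"
      using ell_sandwich [OF saS S(3) bS' SS' S'S bCd _ d] C by (simp add: inR)
    then show ?thesis using d by (simp add: S(2) ell_shift [OF pbC C(2) M])
  qed
  have bAd: "op_between (d * e) (norm A + d * (norm S)\<^sup>2) (A + d *\<^sub>R B)" if d: "0 \<le> d" for d
  proof -
    have 1: "d * (e * (norm x)\<^sup>2) \<le> d * Re (cinner (B x) x)" "d * Re (cinner (B x) x) \<le> d * ((norm S)\<^sup>2 * (norm x)\<^sup>2)" for x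
      using bB d by (auto simp: op_between_def intro!: mult_left_mono)
    have 2: "0 \<le> Re (cinner (A x) x)" "Re (cinner (A x) x) \<le> norm A * (norm x)\<^sup>2" for x
      using op_between_norm [OF A(1)] by (auto simp: op_between_def)
    have 3: "Re (cinner ((A + d *\<^sub>R B) x) x) = Re (cinner (A x) x) + d * Re (cinner (B x) x)" for x
      by (simp add: blinfun.add_left blinfun.scaleR_left cinner.add_left cinner.scaleR_left)
    have "d * e * (norm x)\<^sup>2 \<le> Re (cinner ((A + d *\<^sub>R B) x) x)"
      "Re (cinner ((A + d *\<^sub>R B) x) x) \<le> (norm A + d * (norm S)\<^sup>2) * (norm x)\<^sup>2" for x
      unfolding 3 distrib_right mult.assoc using 1 [of x] 2 [of x] by linarith+
    moreover have "sa (A + d *\<^sub>R B)" by (intro sa_add sa_scaleR positive_op_sa A B)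
    ultimately show ?thesis unfolding op_between_def by blast
  qed
  define \<delta> where "\<delta> n = 1 / real (Suc n)" for n
  have \<delta>: "0 < \<delta> n" "\<delta> n \<le> 1" "decseq \<delta>" "\<delta> \<longlonglongrightarrow> 0" for n
    using LIMSEQ_inverse_real_of_nat
    by (auto simp: \<delta>_def [abs_def] decseq_def inverse_eq_divide frac_le divide_le_eq)
  have c\<delta>: "decseq (\<lambda>n. c * \<delta> n)" "\<And>n. 0 < c * \<delta> n" "(\<lambda>n. c * \<delta> n) \<longlonglongrightarrow> 0" if "0 < c" for c
    using \<delta> that tendsto_mult_right_zero [OF \<delta>(4)] by (auto simp: decseq_def)
  have lim1: "(\<lambda>n. exp (ell (A + \<delta> n *\<^sub>R B))) \<longlonglongrightarrow> fk_det \<tau> B * geometric_mean M"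
  proof -
    have "(\<lambda>n. exp (\<integral>t. ln (t + \<delta> n) \<partial>M)) \<longlonglongrightarrow> geometric_mean M"
      using M r \<delta> by (intro geometric_mean_limit [of M r]) (auto simp: law_def)
    then have "(\<lambda>n. exp (ell B) * exp (\<integral>t. ln (t + \<delta> n) \<partial>M)) \<longlonglongrightarrow> exp (ell B) * geometric_mean M"
      by (rule tendsto_mult_left)
    then show ?thesis using \<delta>(1) by (simp add: ell_eq detB exp_add)
  qed
  \<comment> \<open>From e \<le> B \<le> s, adding a small multiple of B is squeezed between adding
    multiples of the identity, for which \<open>fk_det_limit\<close> is available. For fixed n all
    three operators are bounded below, so \<open>ell_mono\<close> applies.\<close>
  have lim2: "(\<lambda>n. exp (ell (A + \<delta> n *\<^sub>R B))) \<longlonglongrightarrow> fk_det \<tau> A"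
  proof (rule tendsto_sandwich)
    define s where "s = (norm S)\<^sup>2 + e"
    have s: "0 < s" "e \<le> s" using e by (auto simp: s_def add_nonneg_pos)
    show "(\<lambda>n. exp (ell (A + (e * \<delta> n) *\<^sub>R id_blinfun))) \<longlonglongrightarrow> fk_det \<tau> A"
      by (rule fk_det_limit [OF A c\<delta> [OF e]])
    show "(\<lambda>n. exp (ell (A + (s * \<delta> n) *\<^sub>R id_blinfun))) \<longlonglongrightarrow> fk_det \<tau> A"
      by (rule fk_det_limit [OF A c\<delta> [OF s(1)]])
    have bA: "op_between (e * \<delta> n) (norm A + s + e + 1) (A + c *\<^sub>R id_blinfun)" if "e * \<delta> n \<le> c" "c \<le> s" for n c
      using op_between_shift [OF op_between_norm [OF A(1)], of c]
      by (rule op_between_mono) (use that e in auto)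
    have es: "e * \<delta> n \<le> s * \<delta> n" "s * \<delta> n \<le> s" "e * \<delta> n \<le> s" for n
    proof -
      show 1: "e * \<delta> n \<le> s * \<delta> n" using s \<delta>(1) [of n] by (intro mult_right_mono) auto
      show 2: "s * \<delta> n \<le> s" using s \<delta>(2) [of n] by (simp add: mult_left_le)
      show "e * \<delta> n \<le> s" using 1 2 by linarith
    qed
    have bAB: "op_between (e * \<delta> n) (norm A + s + e + 1) (A + \<delta> n *\<^sub>R B)" for n
    proof (rule op_between_mono [OF bAd])
      have "\<delta> n * (norm S)\<^sup>2 \<le> 1 * (norm S)\<^sup>2" using \<delta>(2) [of n] by (intro mult_right_mono) auto
      then show "norm A + \<delta> n * (norm S)\<^sup>2 \<le> norm A + s + e + 1" using e by (simp add: s_def)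
    qed (use \<delta>(1) [of n] in \<open>auto simp: mult.commute\<close>)
    have bounds: "0 < e * \<delta> n" "e * \<delta> n < norm A + s + e + 1" for n
      using e \<delta>(1) [of n] es(3) [of n] norm_ge_zero [of A] by (simp, linarith)
    have pos': "positive_op (\<delta> n *\<^sub>R (B - e *\<^sub>R id_blinfun))" "positive_op (\<delta> n *\<^sub>R (s *\<^sub>R id_blinfun - B))" for n
    proof -
      have "op_between 0 ((norm S)\<^sup>2 - e) (B + (- e) *\<^sub>R id_blinfun)"
        using op_between_shift [OF bB, of "- e"] by simp
      then have "positive_op (B - e *\<^sub>R id_blinfun)"
        using op_between_positive by fastforce
      then show "positive_op (\<delta> n *\<^sub>R (B - e *\<^sub>R id_blinfun))"
        using \<delta>(1) [of n] by (intro positive_op_scaleR) auto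
      have "op_between e s B" by (rule op_between_mono [OF bB]) (use e in \<open>auto simp: s_def\<close>)
      then have "positive_bounded B s" using e s by (intro op_between_positive_bounded [of e]) auto
      then have "positive_op (s *\<^sub>R id_blinfun - B)" by (simp add: positive_bounded_def)
      then show "positive_op (\<delta> n *\<^sub>R (s *\<^sub>R id_blinfun - B))"
        using \<delta>(1) [of n] by (intro positive_op_scaleR) auto
    qed
    have pos: "positive_op ((A + \<delta> n *\<^sub>R B) - (A + (e * \<delta> n) *\<^sub>R id_blinfun))"
      "positive_op ((A + (s * \<delta> n) *\<^sub>R id_blinfun) - (A + \<delta> n *\<^sub>R B))" for n
    proof -
      have "(A + \<delta> n *\<^sub>R B) - (A + (e * \<delta> n) *\<^sub>R id_blinfun) = \<delta> n *\<^sub>R (B - e *\<^sub>R id_blinfun)"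
        "(A + (s * \<delta> n) *\<^sub>R id_blinfun) - (A + \<delta> n *\<^sub>R B) = \<delta> n *\<^sub>R (s *\<^sub>R id_blinfun - B)"
        by (simp_all only: add_diff_cancel_left scaleR_diff_right scaleR_scaleR mult.commute [of "\<delta> n"])
      then show "positive_op ((A + \<delta> n *\<^sub>R B) - (A + (e * \<delta> n) *\<^sub>R id_blinfun))"
        "positive_op ((A + (s * \<delta> n) *\<^sub>R id_blinfun) - (A + \<delta> n *\<^sub>R B))"
        using pos' by simp_all
    qed
    show "\<forall>\<^sub>F n in sequentially. exp (ell (A + (e * \<delta> n) *\<^sub>R id_blinfun)) \<le> exp (ell (A + \<delta> n *\<^sub>R B))"
      by (intro always_eventually allI, subst exp_le_cancel_iff, rule ell_mono [OF bA _ bAB _ bounds pos(1)])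
         (auto intro!: inR A B es)
    show "\<forall>\<^sub>F n in sequentially. exp (ell (A + \<delta> n *\<^sub>R B)) \<le> exp (ell (A + (s * \<delta> n) *\<^sub>R id_blinfun))"
      by (intro always_eventually allI, subst exp_le_cancel_iff, rule ell_mono [OF bAB _ bA _ bounds pos(2)])
         (auto intro!: inR A B es)
  qed
  show ?thesis
  proof
    show "real_distribution M" "AE t in M. t \<in> {0..r}" using M by (auto simp: law_def)
    show "fk_det \<tau> A = fk_det \<tau> B * geometric_mean M" by (rule LIMSEQ_unique [OF lim2 lim1])
    have bAB: "op_between e (norm A + (norm S)\<^sup>2 + e + 1) (A + B)"
    proof (rule op_between_mono)
      show "op_between e (norm A + (norm S)\<^sup>2) (A + B)" using bAd [of 1] by simp
    qed (use e in auto)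
    have "fk_det \<tau> (A + B) = exp (ell (A + B))"
      using e A B by (intro fk_det_ell [OF bAB]) (auto simp: add_nonneg_pos inR)
    then show "fk_det \<tau> (A + B) = fk_det \<tau> B * exp (\<integral>t. ln (t + 1) \<partial>M)"
      using ell_eq [of 1] by (simp add: detB exp_add)
    show "0 < fk_det \<tau> B" by (simp add: detB)
    fix c
    have "C = c *\<^sub>R id_blinfun \<longleftrightarrow> A = c *\<^sub>R B"
    proof
      assume C: "C = c *\<^sub>R id_blinfun"
      show "A = c *\<^sub>R B"
        unfolding SCS [symmetric] C S(2) [symmetric] by (simp add: compose.scaleR_left compose.scaleR_right)
    next
      assume "A = c *\<^sub>R B"
      moreover have "S' o\<^sub>L B o\<^sub>L S' = id_blinfun"
        unfolding S(2) [symmetric] by (metis S'S SS' compose_assoc compose_id)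
      ultimately show "C = c *\<^sub>R id_blinfun"
        unfolding C_def by (simp add: compose.scaleR_left compose.scaleR_right)
    qed
    then show "(AE t in M. t = c) \<longleftrightarrow> A = c *\<^sub>R B" using law_scalar [OF pbC C(2) M, of c] by simp
  qed
qed

text \<open>Only \<open>B\<close> has to become invertible, so \<open>A\<close> stays fixed. The
  shift of \<open>B\<close> is equally a shift of A + B, and \<open>fk_det_limit\<close> removes
  both.\<close>

lemma fk_det_superadditive:
  assumes A: "positive_op A" "A \<in> R" and B: "positive_op B" "B \<in> R"
  shows "fk_det \<tau> A + fk_det \<tau> B \<le> fk_det \<tau> (A + B)"
proof -
  have invertible: "fk_det \<tau> A + fk_det \<tau> D \<le> fk_det \<tau> (A + D)"
    if D: "positive_op D" "D \<in> R" "invertible_op D" for D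
  proof -
    obtain M r where M: "real_distribution M" "AE t in M. t \<in> {0..r}"
      and det: "fk_det \<tau> A = fk_det \<tau> D * geometric_mean M"
      "fk_det \<tau> (A + D) = fk_det \<tau> D * exp (\<integral>t. ln (t + 1) \<partial>M)" "0 < fk_det \<tau> D"
      using fk_det_add_invertible [OF A D] by metis
    have "fk_det \<tau> A + fk_det \<tau> D = fk_det \<tau> D * (1 + geometric_mean M)"
      unfolding det(1) by (simp add: distrib_left)
    also have "\<dots> \<le> fk_det \<tau> (A + D)"
      unfolding det(2) using geometric_mean_superadditive(1) [OF M] det(3) by (intro mult_left_mono) auto
    finally show ?thesis .
  qed
  define \<delta> where "\<delta> n = 1 / real (Suc n)" for n
  have \<delta>: "0 < \<delta> n" "decseq \<delta>" "\<delta> \<longlonglongrightarrow> 0" for n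
    using LIMSEQ_inverse_real_of_nat
    by (auto simp: \<delta>_def [abs_def] decseq_def inverse_eq_divide frac_le)
  have exp_ell: "fk_det \<tau> (X + \<delta> n *\<^sub>R id_blinfun) = exp (ell (X + \<delta> n *\<^sub>R id_blinfun))"
    "invertible_op (X + \<delta> n *\<^sub>R id_blinfun)" if X: "positive_op X" "X \<in> R" for X n
  proof -
    have "op_between (\<delta> n) (norm X + \<delta> n + 1) (X + \<delta> n *\<^sub>R id_blinfun)"
      using op_between_shift [OF op_between_norm [OF X(1)], of "\<delta> n"]
      by (rule op_between_mono) auto
    then show "fk_det \<tau> (X + \<delta> n *\<^sub>R id_blinfun) = exp (ell (X + \<delta> n *\<^sub>R id_blinfun))"
      "invertible_op (X + \<delta> n *\<^sub>R id_blinfun)"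
      using X \<delta>(1) [of n] by (auto intro!: fk_det_ell op_between_Neumann(2) inR simp: add_nonneg_pos)
  qed
  have "(\<lambda>n. fk_det \<tau> A + exp (ell (B + \<delta> n *\<^sub>R id_blinfun))) \<longlonglongrightarrow> fk_det \<tau> A + fk_det \<tau> B"
    by (intro tendsto_intros fk_det_limit B \<delta>)
  moreover have "(\<lambda>n. exp (ell ((A + B) + \<delta> n *\<^sub>R id_blinfun))) \<longlonglongrightarrow> fk_det \<tau> (A + B)"
    by (intro fk_det_limit positive_op_add inR A B \<delta>)
  moreover have "fk_det \<tau> A + exp (ell (B + \<delta> n *\<^sub>R id_blinfun)) \<le> exp (ell ((A + B) + \<delta> n *\<^sub>R id_blinfun))" for n
  proof -
    have "fk_det \<tau> A + fk_det \<tau> (B + \<delta> n *\<^sub>R id_blinfun) \<le> fk_det \<tau> (A + (B + \<delta> n *\<^sub>R id_blinfun))"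
      using B \<delta>(1) [of n] by (intro invertible exp_ell(2) positive_op_add positive_op_scaleR inR) auto
    then show ?thesis
      using exp_ell(1) [OF B, of n] exp_ell(1) [of "A + B" n] A B by (simp add: inR positive_op_add add.assoc)
  qed
  ultimately show ?thesis by (intro LIMSEQ_le) auto
qed

text \<open>Cancelling the positive determinant of \<open>B\<close> leaves equality in the
  inequality for M. The scalar is the point at which M is concentrated, nonnegative as a geometric
  mean.\<close>

lemma fk_det_add_eq_iff:
  assumes A: "positive_op A" "A \<in> R" and B: "positive_op B" "B \<in> R" and inv: "invertible_op B"
  shows "fk_det \<tau> (A + B) = fk_det \<tau> A + fk_det \<tau> B \<longleftrightarrow> (\<exists>c::real. c \<ge> 0 \<and> A = c *\<^sub>R B)"
proof -
  obtain M r where M: "real_distribution M" "AE t in M. t \<in> {0..r}"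
    and det: "fk_det \<tau> A = fk_det \<tau> B * geometric_mean M"
    "fk_det \<tau> (A + B) = fk_det \<tau> B * exp (\<integral>t. ln (t + 1) \<partial>M)" "0 < fk_det \<tau> B"
    and AE: "\<And>c. (AE t in M. t = c) \<longleftrightarrow> A = c *\<^sub>R B"
    using fk_det_add_invertible [OF A B inv] by metis
  have "fk_det \<tau> (A + B) = fk_det \<tau> A + fk_det \<tau> B \<longleftrightarrow>
      fk_det \<tau> B * (1 + geometric_mean M) = fk_det \<tau> B * exp (\<integral>t. ln (t + 1) \<partial>M)"
    unfolding det(1,2) by (auto simp: distrib_left)
  also have "\<dots> \<longleftrightarrow> 1 + geometric_mean M = exp (\<integral>t. ln (t + 1) \<partial>M)" using det(3) by simp
  also have "\<dots> \<longleftrightarrow> (\<exists>c\<ge>0. AE t in M. t = c)"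
  proof
    assume "1 + geometric_mean M = exp (\<integral>t. ln (t + 1) \<partial>M)"
    then have "AE t in M. t = geometric_mean M" by (rule geometric_mean_superadditive(2) [OF M])
    moreover have "0 \<le> geometric_mean M" by (simp add: geometric_mean_def)
    ultimately show "\<exists>c\<ge>0. AE t in M. t = c" by blast
  next
    assume "\<exists>c\<ge>0. AE t in M. t = c"
    then obtain c where c: "0 \<le> c" "AE t in M. t = c" by blast
    show "1 + geometric_mean M = exp (\<integral>t. ln (t + 1) \<partial>M)"
      using c(1) by (simp add: geometric_mean_const [OF M(1) c])
  qed
  finally show ?thesis by (simp add: AE)
qed

end

theorem theorem3p1:
  fixes R :: "'h::{chilbert_space, second_countable_topology} op set"
    and \<tau> :: "'h op \<Rightarrow> complex"
    and A B :: "'h op"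
  assumes "finite_von_neumann_algebra R"
    and "faithful_tracial_state R \<tau>"
    and "A \<in> R" "positive_op A"
    and "B \<in> R" "positive_op B"
  shows "fk_det \<tau> (A + B) \<ge> fk_det \<tau> A + fk_det \<tau> B \<and>
    (invertible_op B \<longrightarrow>
      (fk_det \<tau> (A + B) = fk_det \<tau> A + fk_det \<tau> B \<longleftrightarrow> (\<exists>c::real. c \<ge> 0 \<and> A = c *\<^sub>R B)))"
proof -
  interpret tracial_algebra R \<tau>
    using assms by unfold_locales (auto simp: finite_von_neumann_algebra_def)
  show ?thesis
    using fk_det_superadditive fk_det_add_eq_iff assms by blast
qed

end
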